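(* Let $G$ be a compact Lie group and let $f,g\colon X\to Y$ be $G$-maps between $G$-spaces, with $X$ a $G$-CW complex of dimension at least $2$. Let $s\ge 0$ be an integer and suppose that $Y$ is $s$-$G$-connected, that is, for every closed subgroup $H\le G$ the fixed-point set $Y^H$ is $s$-connected. Then $$D_G(f,g)<\frac{\mathrm{hdim}_G(X)+1}{s+1}.$$
   Context: For a closed subgroup $H\le G$, $Y^H=\{y\in Y\mid hy=y\text{ for all }h\in H\}$. For a $G$-CW complex $X$, $\mathrm{hdim}_G(X)$ denotes the minimal dimension $\dim(X')$ of a $G$-CW complex $X'$ that is $G$-homotopy equivalent to $X$. Equivariant homotopic distance: $D_G(f,g)$ is the least integer $n\ge 0$ such that $X$ has an open cover $\{U_0,\dots,U_n\}$ by $G$-invariant open sets with $f|_{U_i}\simeq_G g|_{U_i}$ ($G$-homotopic) for all $0\le i\le n$; it is $\infty$ if no such $n$ exists.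
   Formalization: The formal theorem assumes hdim_G(X) is finite; otherwise the bound would read D_G(f,g) < ∞, which fails for G trivial, X = Y = CP^∞, s = 1, f = id, g constant. *)

theory Defs
  imports
    "HOL-Analysis.Analysis"
    "HOL-Library.Extended_Nat"
    "HOL-Algebra.Left_Coset"
    "HOL-Algebra.Group_Action"
begin

section \<open>Compact Lie groups\<close>

text \<open>
  Points of \<open>\<real>\<^sup>n\<close> are sequences vanishing from index \<open>n\<close> on, as in \<^const>\<open>Euclidean_space\<close>; this
  includes \<open>n = 0\<close>, so that finite discrete groups are Lie groups. The sets \<open>S\<close> below are open in
  \<open>\<real>\<^sup>n\<close>, and \<open>C\<^sup>k\<close> is expressed by iterated continuous partial derivatives.
\<close>

primrec Ck_on :: "nat \<Rightarrow> nat \<Rightarrow> (nat \<Rightarrow> real) set \<Rightarrow> ((nat \<Rightarrow> real) \<Rightarrow> real) \<Rightarrow> bool" where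
  "Ck_on n 0 S f \<longleftrightarrow> continuous_map (subtopology (Euclidean_space n) S) euclideanreal f"
| "Ck_on n (Suc k) S f \<longleftrightarrow>
     continuous_map (subtopology (Euclidean_space n) S) euclideanreal f \<and>
     (\<forall>i<n. \<exists>f'. (\<forall>x\<in>S. ((\<lambda>t. f (x(i := t))) has_real_derivative f' x) (at (x i))) \<and>
        Ck_on n k S f')"

definition smooth_map ::
    "nat \<Rightarrow> nat \<Rightarrow> (nat \<Rightarrow> real) set \<Rightarrow> ((nat \<Rightarrow> real) \<Rightarrow> nat \<Rightarrow> real) \<Rightarrow> bool" where
  "smooth_map m n S F \<longleftrightarrow> (\<forall>j<n. \<forall>k. Ck_on m k S (\<lambda>x. F x j))"

definition is_chart :: "'g topology \<Rightarrow> nat \<Rightarrow> 'g set \<Rightarrow> ('g \<Rightarrow> nat \<Rightarrow> real) \<Rightarrow> bool" where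
  "is_chart T n U c \<longleftrightarrow>
     openin T U \<and> openin (Euclidean_space n) (c ` U) \<and>
     homeomorphic_map (subtopology T U) (subtopology (Euclidean_space n) (c ` U)) c"

definition smooth_atlas ::
    "'g topology \<Rightarrow> nat \<Rightarrow> ('g set \<times> ('g \<Rightarrow> nat \<Rightarrow> real)) set \<Rightarrow> bool" where
  "smooth_atlas T n A \<longleftrightarrow>
     (\<forall>(U, c)\<in>A. is_chart T n U c) \<and>
     (\<Union>(U, c)\<in>A. U) = topspace T \<and>
     (\<forall>(U, c)\<in>A. \<forall>(V, d)\<in>A. smooth_map n n (c ` (U \<inter> V)) (\<lambda>x. d (inv_into U c x)))"

definition topological_group :: "('g, 'm) monoid_scheme \<Rightarrow> 'g topology \<Rightarrow> bool" where
  "topological_group G T \<longleftrightarrow>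
     group G \<and> topspace T = carrier G \<and>
     continuous_map (prod_topology T T) T (\<lambda>(a, b). a \<otimes>\<^bsub>G\<^esub> b) \<and>
     continuous_map T T (\<lambda>a. inv\<^bsub>G\<^esub> a)"

text \<open>The two halves of a point of \<open>\<real>\<^sup>n\<^sup>+\<^sup>n = \<real>\<^sup>n \<times> \<real>\<^sup>n\<close>.\<close>

definition fst_half :: "nat \<Rightarrow> (nat \<Rightarrow> real) \<Rightarrow> nat \<Rightarrow> real" where
  "fst_half n z = (\<lambda>i. if i < n then z i else 0)"

definition snd_half :: "nat \<Rightarrow> (nat \<Rightarrow> real) \<Rightarrow> nat \<Rightarrow> real" where
  "snd_half n z = (\<lambda>i. if i < n then z (n + i) else 0)"

text \<open>
  Multiplication and inversion are smooth when read in charts. The domains of their coordinate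
  expressions are open because both maps are continuous.
\<close>

definition lie_group :: "('g, 'm) monoid_scheme \<Rightarrow> 'g topology \<Rightarrow> bool" where
  "lie_group G T \<longleftrightarrow>
     topological_group G T \<and> Hausdorff_space T \<and> second_countable T \<and>
     (\<exists>n A. smooth_atlas T n A \<and>
        (\<forall>(U, c)\<in>A. \<forall>(V, d)\<in>A. \<forall>(W, e)\<in>A.
           smooth_map (n + n) n
             {z \<in> topspace (Euclidean_space (n + n)).
                fst_half n z \<in> c ` U \<and> snd_half n z \<in> d ` V \<and>
                inv_into U c (fst_half n z) \<otimes>\<^bsub>G\<^esub> inv_into V d (snd_half n z) \<in> W}
             (\<lambda>z. e (inv_into U c (fst_half n z) \<otimes>\<^bsub>G\<^esub> inv_into V d (snd_half n z)))) \<and>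
        (\<forall>(U, c)\<in>A. \<forall>(V, d)\<in>A.
           smooth_map n n {x \<in> c ` U. inv\<^bsub>G\<^esub> (inv_into U c x) \<in> V}
             (\<lambda>x. d (inv\<^bsub>G\<^esub> (inv_into U c x)))))"

definition compact_lie_group :: "('g, 'm) monoid_scheme \<Rightarrow> 'g topology \<Rightarrow> bool" where
  "compact_lie_group G T \<longleftrightarrow> lie_group G T \<and> compact_space T"

definition closed_subgroup :: "('g, 'm) monoid_scheme \<Rightarrow> 'g topology \<Rightarrow> 'g set \<Rightarrow> bool" where
  "closed_subgroup G T H \<longleftrightarrow> subgroup H G \<and> closedin T H"

section \<open>\<open>G\<close>-spaces, \<open>G\<close>-maps and \<open>G\<close>-homotopy\<close>

definition g_space ::
    "('g, 'm) monoid_scheme \<Rightarrow> 'g topology \<Rightarrow> ('g \<Rightarrow> 'x \<Rightarrow> 'x) \<Rightarrow> 'x topology \<Rightarrow> bool" where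
  "g_space G T \<phi> X \<longleftrightarrow>
     group_action G (topspace X) \<phi> \<and>
     continuous_map (prod_topology T X) X (\<lambda>(a, x). \<phi> a x)"

definition equivariant_on ::
    "('g, 'm) monoid_scheme \<Rightarrow> ('g \<Rightarrow> 'x \<Rightarrow> 'x) \<Rightarrow> ('g \<Rightarrow> 'y \<Rightarrow> 'y) \<Rightarrow> 'x set \<Rightarrow> ('x \<Rightarrow> 'y) \<Rightarrow> bool" where
  "equivariant_on G \<phi> \<psi> S f \<longleftrightarrow> (\<forall>a\<in>carrier G. \<forall>x\<in>S. f (\<phi> a x) = \<psi> a (f x))"

definition g_map ::
    "('g, 'm) monoid_scheme \<Rightarrow> ('g \<Rightarrow> 'x \<Rightarrow> 'x) \<Rightarrow> 'x topology \<Rightarrow> ('g \<Rightarrow> 'y \<Rightarrow> 'y) \<Rightarrow> 'y topology \<Rightarrow>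
      ('x \<Rightarrow> 'y) \<Rightarrow> bool" where
  "g_map G \<phi> X \<psi> Y f \<longleftrightarrow> continuous_map X Y f \<and> equivariant_on G \<phi> \<psi> (topspace X) f"

text \<open>A homotopy is equivariant for the trivial action on the interval iff every stage is.\<close>

definition g_homotopic ::
    "('g, 'm) monoid_scheme \<Rightarrow> ('g \<Rightarrow> 'x \<Rightarrow> 'x) \<Rightarrow> 'x topology \<Rightarrow> ('g \<Rightarrow> 'y \<Rightarrow> 'y) \<Rightarrow> 'y topology \<Rightarrow>
      ('x \<Rightarrow> 'y) \<Rightarrow> ('x \<Rightarrow> 'y) \<Rightarrow> bool" where
  "g_homotopic G \<phi> X \<psi> Y f g \<longleftrightarrow> homotopic_with (equivariant_on G \<phi> \<psi> (topspace X)) X Y f g"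

definition g_homotopy_equivalent ::
    "('g, 'm) monoid_scheme \<Rightarrow> ('g \<Rightarrow> 'x \<Rightarrow> 'x) \<Rightarrow> 'x topology \<Rightarrow> ('g \<Rightarrow> 'y \<Rightarrow> 'y) \<Rightarrow> 'y topology \<Rightarrow>
      bool" where
  "g_homotopy_equivalent G \<phi> X \<psi> Y \<longleftrightarrow>
     (\<exists>f g. g_map G \<phi> X \<psi> Y f \<and> g_map G \<psi> Y \<phi> X g \<and>
        g_homotopic G \<phi> X \<phi> X (g \<circ> f) id \<and> g_homotopic G \<psi> Y \<psi> Y (f \<circ> g) id)"

definition invariant_set ::
    "('g, 'm) monoid_scheme \<Rightarrow> ('g \<Rightarrow> 'x \<Rightarrow> 'x) \<Rightarrow> 'x set \<Rightarrow> bool" where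
  "invariant_set G \<phi> U \<longleftrightarrow> (\<forall>a\<in>carrier G. \<forall>x\<in>U. \<phi> a x \<in> U)"

definition g_distance ::
    "('g, 'm) monoid_scheme \<Rightarrow> ('g \<Rightarrow> 'x \<Rightarrow> 'x) \<Rightarrow> 'x topology \<Rightarrow> ('g \<Rightarrow> 'y \<Rightarrow> 'y) \<Rightarrow> 'y topology \<Rightarrow>
      ('x \<Rightarrow> 'y) \<Rightarrow> ('x \<Rightarrow> 'y) \<Rightarrow> enat" where
  "g_distance G \<phi> X \<psi> Y f g =
     Inf {enat n | n. \<exists>U :: nat \<Rightarrow> 'x set.
       (\<Union>i\<le>n. U i) = topspace X \<and>
       (\<forall>i\<le>n. openin X (U i) \<and> invariant_set G \<phi> (U i) \<and>
          g_homotopic G \<phi> (subtopology X (U i)) \<psi> Y f g)}"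

section \<open>Connectivity of fixed-point sets\<close>

definition fixed_points ::
    "('g \<Rightarrow> 'y \<Rightarrow> 'y) \<Rightarrow> 'y topology \<Rightarrow> 'g set \<Rightarrow> 'y set" where
  "fixed_points \<psi> Y H = {y \<in> topspace Y. \<forall>h\<in>H. \<psi> h y = y}"

text \<open>
  \<open>\<pi>\<^sub>k(Y, y)\<close> consists of the pointed homotopy classes of pointed maps from the \<open>k\<close>-sphere,
  here with basepoint \<open>e\<^sub>0\<close>. For \<open>k = 0\<close> it is the set of path components.
\<close>

definition sphere_base :: "nat \<Rightarrow> real" where
  "sphere_base = (\<lambda>i. if i = 0 then 1 else 0)"

definition trivial_homotopy_group :: "nat \<Rightarrow> 'y topology \<Rightarrow> 'y \<Rightarrow> bool" where
  "trivial_homotopy_group k Y y \<longleftrightarrow>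
     (\<forall>f. continuous_map (nsphere k) Y f \<and> f sphere_base = y \<longrightarrow>
        homotopic_with (\<lambda>h. h sphere_base = y) (nsphere k) Y f (\<lambda>_. y))"

definition s_connected :: "nat \<Rightarrow> 'y topology \<Rightarrow> bool" where
  "s_connected s Y \<longleftrightarrow>
     topspace Y \<noteq> {} \<and> (\<forall>k\<le>s. \<forall>y\<in>topspace Y. trivial_homotopy_group k Y y)"

definition s_g_connected ::
    "nat \<Rightarrow> ('g, 'm) monoid_scheme \<Rightarrow> 'g topology \<Rightarrow> ('g \<Rightarrow> 'y \<Rightarrow> 'y) \<Rightarrow> 'y topology \<Rightarrow> bool" where
  "s_g_connected s G T \<psi> Y \<longleftrightarrow>
     (\<forall>H. closed_subgroup G T H \<longrightarrow> s_connected s (subtopology Y (fixed_points \<psi> Y H)))"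

section \<open>\<open>G\<close>-CW complexes\<close>

text \<open>The orbit \<open>G/H\<close> with the quotient topology.\<close>

definition coset_space :: "('g, 'm) monoid_scheme \<Rightarrow> 'g topology \<Rightarrow> 'g set \<Rightarrow> 'g set topology" where
  "coset_space G T H =
     topology (\<lambda>U. U \<subseteq> lcosets\<^bsub>G\<^esub> H \<and> openin T {a \<in> topspace T. a <#\<^bsub>G\<^esub> H \<in> U})"

lemma openin_coset_space:
  "openin (coset_space G T H) U \<longleftrightarrow>
     U \<subseteq> lcosets\<^bsub>G\<^esub> H \<and> openin T {a \<in> topspace T. a <#\<^bsub>G\<^esub> H \<in> U}"
proof -
  let ?P = "\<lambda>U. {a \<in> topspace T. a <#\<^bsub>G\<^esub> H \<in> U}"
  have int: "?P (U \<inter> V) = ?P U \<inter> ?P V" for U V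
    by auto
  have union: "?P (\<Union>\<U>) = (\<Union>U\<in>\<U>. ?P U)" for \<U>
    by auto
  have "istopology (\<lambda>U. U \<subseteq> lcosets\<^bsub>G\<^esub> H \<and> openin T (?P U))"
    unfolding istopology_def int union by (blast intro: openin_Int openin_Union)
  then show ?thesis
    by (simp add: coset_space_def topology_inverse')
qed

lemma topspace_coset_space:
  assumes "topspace T = carrier G"
  shows "topspace (coset_space G T H) = lcosets\<^bsub>G\<^esub> H"
proof -
  have "{a \<in> topspace T. a <#\<^bsub>G\<^esub> H \<in> lcosets\<^bsub>G\<^esub> H} = topspace T"
    using assms by (auto simp: LCOSETS_def)
  then have "openin (coset_space G T H) (lcosets\<^bsub>G\<^esub> H)"
    by (simp add: openin_coset_space)
  then show ?thesis
    by (meson openin_coset_space openin_subset openin_topspace subset_antisym)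
qed

lemma quotient_map_coset_space:
  assumes "topspace T = carrier G"
  shows "quotient_map T (coset_space G T H) (\<lambda>a. a <#\<^bsub>G\<^esub> H)"
  using assms
  by (auto simp: quotient_map_def topspace_coset_space openin_coset_space LCOSETS_def)

text \<open>For \<open>n = 0\<close> the disc is a point and its boundary sphere is empty.\<close>

definition disc :: "nat \<Rightarrow> (nat \<Rightarrow> real) topology" where
  "disc n = subtopology (Euclidean_space n) {x. (\<Sum>i<n. (x i)\<^sup>2) \<le> 1}"

definition disc_boundary :: "nat \<Rightarrow> (nat \<Rightarrow> real) set" where
  "disc_boundary n = {x \<in> topspace (disc n). (\<Sum>i<n. (x i)\<^sup>2) = 1}"

definition disc_interior :: "nat \<Rightarrow> (nat \<Rightarrow> real) set" where
  "disc_interior n = {x \<in> topspace (disc n). (\<Sum>i<n. (x i)\<^sup>2) < 1}"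

text \<open>
  \<open>B\<close> is obtained from \<open>A\<close> by attaching the cells \<open>G/H\<^sub>j \<times> D\<^sup>n\<close> along \<open>G\<close>-maps
  \<open>G/H\<^sub>j \<times> S\<^sup>n\<^sup>-\<^sup>1 \<rightarrow> A\<close>, with characteristic maps \<open>\<Phi>\<^sub>j\<close>. The last two conjuncts say that \<open>B\<close> is
  the pushout: as a set, and with the final topology. Indexing the cells by points of the space
  loses no generality, since every cell may be indexed by one of its interior points.
\<close>

definition attach_g_cells ::
    "('g, 'm) monoid_scheme \<Rightarrow> 'g topology \<Rightarrow> ('g \<Rightarrow> 'x \<Rightarrow> 'x) \<Rightarrow> 'x topology \<Rightarrow> nat \<Rightarrow>
      'x set \<Rightarrow> 'x set \<Rightarrow> bool" where
  "attach_g_cells G T \<phi> X n A B \<longleftrightarrow>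
     A \<subseteq> B \<and>
     (\<exists>(J :: 'x set) (H :: 'x \<Rightarrow> 'g set) (\<Phi> :: 'x \<Rightarrow> 'g set \<times> (nat \<Rightarrow> real) \<Rightarrow> 'x).
        (\<forall>j\<in>J.
           closed_subgroup G T (H j) \<and>
           continuous_map (prod_topology (coset_space G T (H j)) (disc n)) (subtopology X B) (\<Phi> j) \<and>
           (\<forall>a\<in>carrier G. \<forall>C\<in>lcosets\<^bsub>G\<^esub> (H j). \<forall>u\<in>topspace (disc n).
              \<Phi> j (a <#\<^bsub>G\<^esub> C, u) = \<phi> a (\<Phi> j (C, u))) \<and>
           \<Phi> j ` ((lcosets\<^bsub>G\<^esub> (H j)) \<times> disc_boundary n) \<subseteq> A) \<and>
        bij_betw (\<lambda>(j, p). \<Phi> j p) (SIGMA j:J. (lcosets\<^bsub>G\<^esub> (H j)) \<times> disc_interior n) (B - A) \<and>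
        (\<forall>U\<subseteq>B. openin (subtopology X B) U \<longleftrightarrow>
           openin (subtopology X A) (U \<inter> A) \<and>
           (\<forall>j\<in>J. openin (prod_topology (coset_space G T (H j)) (disc n))
              {p \<in> (lcosets\<^bsub>G\<^esub> (H j)) \<times> topspace (disc n). \<Phi> j p \<in> U})))"

text \<open>A \<open>G\<close>-CW complex is given with its skeletal filtration \<open>sk\<close>.\<close>

definition g_cw_complex ::
    "('g, 'm) monoid_scheme \<Rightarrow> 'g topology \<Rightarrow> ('g \<Rightarrow> 'x \<Rightarrow> 'x) \<Rightarrow> 'x topology \<Rightarrow> (nat \<Rightarrow> 'x set) \<Rightarrow>
      bool" where
  "g_cw_complex G T \<phi> X sk \<longleftrightarrow>
     g_space G T \<phi> X \<and>
     attach_g_cells G T \<phi> X 0 {} (sk 0) \<and>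
     (\<forall>n. attach_g_cells G T \<phi> X (Suc n) (sk n) (sk (Suc n))) \<and>
     (\<Union>n. sk n) = topspace X \<and>
     (\<forall>U\<subseteq>topspace X. openin X U \<longleftrightarrow> (\<forall>n. openin (subtopology X (sk n)) (U \<inter> sk n)))"

text \<open>A cell \<open>G/H \<times> D\<^sup>n\<close> counts as \<open>n\<close>-dimensional; the dimension of \<open>G/H\<close> is not added.\<close>

definition gcw_dim :: "'x topology \<Rightarrow> (nat \<Rightarrow> 'x set) \<Rightarrow> enat" where
  "gcw_dim X sk = Inf {enat n | n. sk n = topspace X}"

text \<open>
  A definition cannot quantify over the types on which the competing complexes \<open>X'\<close> live, so that
  type is a parameter, to be left as a type variable in theorems. A strict upper bound
  in terms of \<open>hdim TYPE('z)\<close> for all \<open>'z\<close> is one for all \<open>X'\<close>. The value is \<open>\<infinity>\<close> if there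
  is no finite-dimensional \<open>X'\<close>.
\<close>

definition hdim ::
    "'z itself \<Rightarrow> ('g, 'm) monoid_scheme \<Rightarrow> 'g topology \<Rightarrow> ('g \<Rightarrow> 'x \<Rightarrow> 'x) \<Rightarrow> 'x topology \<Rightarrow> enat" where
  "hdim TYPE('z) G T \<phi> X =
     Inf {gcw_dim X' sk' | (X' :: 'z topology) \<phi>' sk'.
       g_cw_complex G T \<phi>' X' sk' \<and> g_homotopy_equivalent G \<phi> X \<phi>' X'}"

end

theory Submission
  imports Defs
begin

text \<open>
  Homotopies from \<open>f\<close> to \<open>g\<close> over the members of a numerable open cover \<open>U\<^sub>0, \<dots>, U\<^sub>n\<close> are the same as a
  section of the \<open>(n+1)\<close>-fold fibrewise join of the fibration of paths from \<open>f x\<close> to \<open>g x\<close>. Over a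
  cell \<open>G/H \<times> D\<^sup>k\<close> equivariance reduces the problem to paths in \<open>Y\<^sup>H\<close>; their space is
  \<open>(s-1)\<close>-connected, so its \<open>(n+1)\<close>-fold join is \<open>((n+1)(s+1)-2)\<close>-connected, and an equivariant section
  extends over all cells of dimension less than \<open>(n+1)(s+1)\<close>. If \<open>X\<close> is equivalent to a complex of
  dimension \<open>d\<close>, then \<open>n = \<lfloor>d/(s+1)\<rfloor>\<close> suffices, and covers pull back along the equivalence.
\<close>

section \<open>Path spaces and joins\<close>

text \<open>Open covers are awkward to extend cell by cell, because the members over a skeleton must
  first be thickened. A section of the join is one continuous map and extends through the pushout
  topology of each attachment; the open sets are recovered as the places where a barycentric
  coordinate is positive. Two obstacles shape the rest. The connectivity of the join, phrased as
  extension from spheres to discs (\<open>extensible\<close>), comes from general position in a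
  cube: a grid skeleton of dimension below \<open>b\<close> is disjoint from the dual skeleton of
  codimension \<open>b\<close>, and a point of the join needs only one coordinate of positive
  weight, so the first \<open>n\<close> coordinates can live near the former and the last one near
  the latter. Secondly, the endpoints \<open>f x\<close> and \<open>g x\<close> of the paths move
  with \<open>x\<close>, so the fibres over a disc vary; a collar transports the boundary data to
  the fibre over the centre. Since junk is never identified, conditions on sections are imposed only
  for times in [0,1] and coordinates of positive weight.\<close>

text \<open>
  The compact-open topology on paths \<open>[0,1] \<rightarrow> Y\<close>. Values outside \<open>[0,1]\<close> are junk that the topology does
  not see.
\<close>

definition path_space :: "'y topology \<Rightarrow> (real \<Rightarrow> 'y) topology" where
  "path_space Y = subtopology
     (topology_generated_by {{\<gamma>. \<gamma> ` C \<subseteq> U} |C U. compact C \<and> C \<subseteq> {0..1} \<and> openin Y U})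
     {\<gamma>. pathin Y \<gamma>}"

lemma Union_path_space_subbasis:
  "\<Union>{{\<gamma>. \<gamma> ` C \<subseteq> U} |C U. compact C \<and> C \<subseteq> {0..1::real} \<and> openin Y U} = UNIV"
proof -
  have "UNIV \<in> {{\<gamma>. \<gamma> ` C \<subseteq> U} |C U. compact C \<and> C \<subseteq> {0..1::real} \<and> openin Y U}"
    by (rule CollectI, rule exI[of _ "{}"], rule exI[of _ "{}"]) auto
  then show ?thesis by blast
qed

lemma topspace_path_space: "topspace (path_space Y) = {\<gamma>. pathin Y \<gamma>}"
  by (simp add: path_space_def topology_generated_by_topspace Union_path_space_subbasis)

text \<open>The exponential law for the compact-open topology. One direction uses that points of
  [0,1] have small compact neighbourhoods; in the other the tube lemma, applied to
  \<open>{x} \<times> C\<close>, makes the preimage of each subbasic set open.\<close>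

lemma continuous_map_path_space:
  "continuous_map X (path_space Y) h \<longleftrightarrow>
     continuous_map (prod_topology X (top_of_set {0..1})) Y (\<lambda>(x, t). h x t)"
    (is "?L \<longleftrightarrow> ?R")
proof
  assume L: ?L
  have path: "continuous_map (top_of_set {0..1}) Y (h x)" if "x \<in> topspace X" for x
    using continuous_map_image_subset_topspace[OF L] that
    by (auto simp: topspace_path_space pathin_def)
  have op: "openin X {x \<in> topspace X. h x ` C \<subseteq> U}"
    if "compact C" "C \<subseteq> {0..1}" "openin Y U" for C U
  proof -
    have "continuous_map X (topology_generated_by
        {{\<gamma>. \<gamma> ` C \<subseteq> U} |C U. compact C \<and> C \<subseteq> {0..1} \<and> openin Y U}) h"
      using L unfolding path_space_def by (simp add: continuous_map_in_subtopology)
    then have "openin X (h -` {\<gamma>. \<gamma> ` C \<subseteq> U} \<inter> topspace X)"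
      unfolding continuous_on_generated_topo_iff using that by blast
    moreover have "h -` {\<gamma>. \<gamma> ` C \<subseteq> U} \<inter> topspace X = {x \<in> topspace X. h x ` C \<subseteq> U}" by auto
    ultimately show ?thesis by simp
  qed
  show ?R
    unfolding continuous_map_def
  proof (intro conjI allI impI)
    show "(\<lambda>(x, t). h x t) \<in> topspace (prod_topology X (top_of_set {0..1})) \<rightarrow> topspace Y"
      using path by (auto simp: continuous_map_def)
  next
    fix U assume U: "openin Y U"
    show "openin (prod_topology X (top_of_set {0..1}))
        {p \<in> topspace (prod_topology X (top_of_set {0..1})). (case p of (x, t) \<Rightarrow> h x t) \<in> U}"
    proof (subst openin_subopen, safe)
      fix x t assume *: "(x, t) \<in> topspace (prod_topology X (top_of_set {0..1::real}))" "h x t \<in> U"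
      then have x: "x \<in> topspace X" and t: "t \<in> {0..1}" by auto
      have "openin (top_of_set {0..1}) {t \<in> {0..1}. h x t \<in> U}"
        using path[OF x] U by (auto simp: continuous_map_def)
      then obtain e where e: "e > 0" "ball t e \<inter> {0..1} \<subseteq> {t \<in> {0..1}. h x t \<in> U}"
        using t *(2) by (force simp: openin_contains_ball)
      let ?C = "cball t (e/2) \<inter> {0..1}"
      let ?W = "{x \<in> topspace X. h x ` ?C \<subseteq> U}"
      have "openin X ?W"
        by (rule op) (use U in \<open>auto intro: compact_Int\<close>)
      moreover have "openin (top_of_set {0..1}) ({0..1} \<inter> ball t (e/2))"
        by (simp add: openin_open_Int)
      ultimately have "openin (prod_topology X (top_of_set {0..1})) (?W \<times> ({0..1} \<inter> ball t (e/2)))"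
        by (simp add: openin_prod_Times_iff)
      moreover have "?C \<subseteq> ball t e \<inter> {0..1}" using e(1) by auto
      then have "x \<in> ?W" using x e(2) by blast
      moreover have "t \<in> {0..1} \<inter> ball t (e/2)" using t e(1) by auto
      moreover have "?W \<times> ({0..1} \<inter> ball t (e/2)) \<subseteq>
          {p \<in> topspace (prod_topology X (top_of_set {0..1})). (case p of (x, t) \<Rightarrow> h x t) \<in> U}"
        by (force simp: image_subset_iff)
      ultimately show "\<exists>T. openin (prod_topology X (top_of_set {0..1})) T \<and> (x, t) \<in> T \<and>
          T \<subseteq> {p \<in> topspace (prod_topology X (top_of_set {0..1})). (case p of (x, t) \<Rightarrow> h x t) \<in> U}"
        by blast
    qed
  qed
next
  assume R: ?R
  show ?L
    unfolding path_space_def continuous_map_in_subtopology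
  proof (intro conjI)
    show "h \<in> topspace X \<rightarrow> {\<gamma>. pathin Y \<gamma>}"
    proof (intro funcsetI CollectI)
      fix x assume x: "x \<in> topspace X"
      have "continuous_map (top_of_set {0..1}) (prod_topology X (top_of_set {0..1})) (\<lambda>t. (x, t))"
        using x by (simp add: continuous_map_paired)
      from continuous_map_compose[OF this R] show "pathin Y (h x)"
        by (simp add: pathin_def comp_def)
    qed
    show "continuous_map X (topology_generated_by
        {{\<gamma>. \<gamma> ` C \<subseteq> U} |C U. compact C \<and> C \<subseteq> {0..1} \<and> openin Y U}) h"
      unfolding continuous_on_generated_topo_iff
    proof (intro conjI allI impI)
      fix V assume "V \<in> {{\<gamma>. \<gamma> ` C \<subseteq> U} |C U. compact C \<and> C \<subseteq> {0..1::real} \<and> openin Y U}"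
      then obtain C U where V: "V = {\<gamma>. \<gamma> ` C \<subseteq> U}" and C: "compact C" "C \<subseteq> {0..1}" and U: "openin Y U"
        by blast
      have O: "openin (prod_topology X (top_of_set {0..1}))
          {p \<in> topspace (prod_topology X (top_of_set {0..1})). (case p of (x, t) \<Rightarrow> h x t) \<in> U}"
        using R U by (simp add: continuous_map_def)
      have "openin X (h -` V \<inter> topspace X)"
      proof (subst openin_subopen, safe)
        fix x assume x: "h x \<in> V" "x \<in> topspace X"
        obtain A B where AB: "openin X A" "openin (top_of_set {0..1}) B" "{x} \<subseteq> A" "C \<subseteq> B" "A \<times> B \<subseteq>
          {p \<in> topspace (prod_topology X (top_of_set {0..1})). (case p of (x, t) \<Rightarrow> h x t) \<in> U}"
        proof (rule Wallace_theorem_prod_topology[OF _ _ O])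
          show "compactin X {x}" using x by simp
          show "compactin (top_of_set {0..1}) C" using C by (simp add: compactin_subtopology)
          show "{x} \<times> C \<subseteq> {p \<in> topspace (prod_topology X (top_of_set {0..1})). (case p of (x, t) \<Rightarrow> h x t) \<in> U}"
            using x C V by auto
        qed
        have "A \<subseteq> h -` V \<inter> topspace X"
        proof
          fix x' assume x': "x' \<in> A"
          have "h x' c \<in> U" if "c \<in> C" for c
          proof -
            have "(x', c) \<in> A \<times> B" using x' that AB(4) by auto
            with AB(5) show ?thesis by auto
          qed
          then show "x' \<in> h -` V \<inter> topspace X"
            using x' openin_subset[OF AB(1)] V by auto
        qed
        then show "\<exists>S. openin X S \<and> x \<in> S \<and> S \<subseteq> h -` V \<inter> topspace X"
          using AB(1,3) by (intro exI[of _ A]) simp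
      qed
      then show "openin X (h -` V \<inter> topspace X)" .
    next
      show "h ` topspace X \<subseteq> \<Union>{{\<gamma>. \<gamma> ` C \<subseteq> U} |C U. compact C \<and> C \<subseteq> {0..1::real} \<and> openin Y U}"
        by (simp add: Union_path_space_subbasis)
    qed
  qed
qed

section \<open>The join and linear homotopies in it\<close>

text \<open>
  A point \<open>u\<close> of the \<open>n\<close>-fold join has the barycentric coordinates \<open>fst (u i)\<close> for \<open>i < n\<close>, which are
  only required to be nonnegative and not all zero, and \<open>snd (u i)\<close> is junk where \<open>fst (u i) = 0\<close>.
  Points that differ only in junk need not be identified, since the topology, the coarsest one making
  all coordinates continuous where they are defined, does not separate them.
\<close>

definition join_space :: "nat \<Rightarrow> 'p topology \<Rightarrow> (nat \<Rightarrow> real \<times> 'p) topology" where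
  "join_space n P = subtopology
     (topology_generated_by
        ({{u. fst (u i) \<in> V} |i V. i < n \<and> open V} \<union>
         {{u. 0 < fst (u i) \<and> snd (u i) \<in> V} |i V. i < n \<and> openin P V} \<union> {UNIV}))
     {u. (\<forall>i<n. 0 \<le> fst (u i) \<and> (0 < fst (u i) \<longrightarrow> snd (u i) \<in> topspace P)) \<and>
         (\<exists>i<n. 0 < fst (u i))}"

lemma topspace_join_space:
  "topspace (join_space n P) =
     {u. (\<forall>i<n. 0 \<le> fst (u i) \<and> (0 < fst (u i) \<longrightarrow> snd (u i) \<in> topspace P)) \<and>
         (\<exists>i<n. 0 < fst (u i))}"
  unfolding join_space_def topspace_subtopology topology_generated_by_topspace by auto

text \<open>The universal property of an initial topology with partially defined coordinates: the
  \<open>i\<close>-th fibre coordinate is tested only where its weight is positive. That set is open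
  in \<open>X\<close>, so openness in the subspace gives openness in \<open>X\<close>.\<close>

lemma continuous_map_join_space:
  "continuous_map X (join_space n P) u \<longleftrightarrow>
     (\<forall>x\<in>topspace X. (\<forall>i<n. 0 \<le> fst (u x i)) \<and> (\<exists>i<n. 0 < fst (u x i))) \<and>
     (\<forall>i<n. continuous_map X euclideanreal (\<lambda>x. fst (u x i)) \<and>
        continuous_map (subtopology X {x. 0 < fst (u x i)}) P (\<lambda>x. snd (u x i)))"
    (is "?L \<longleftrightarrow> ?R")
proof
  assume L: ?L
  have 1: "(\<forall>i<n. 0 \<le> fst (u x i) \<and> (0 < fst (u x i) \<longrightarrow> snd (u x i) \<in> topspace P)) \<and>
       (\<exists>i<n. 0 < fst (u x i))" if "x \<in> topspace X" for x
    using continuous_map_image_subset_topspace[OF L] that by (auto simp: topspace_join_space)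
  have gen: "openin X (u -` W \<inter> topspace X)"
    if "W \<in> {{u. fst (u i) \<in> V} |i V. i < n \<and> open V} \<union>
         {{u. 0 < fst (u i) \<and> snd (u i) \<in> V} |i V. i < n \<and> openin P V} \<union> {UNIV}" for W
    using L[unfolded join_space_def continuous_map_in_subtopology continuous_on_generated_topo_iff,
        THEN conjunct1, THEN conjunct1, THEN spec[of _ W]] that
    by (rule mp)
  have 2: "continuous_map X euclideanreal (\<lambda>x. fst (u x i))" if i: "i < n" for i
    unfolding continuous_map_def
  proof (intro conjI allI impI)
    fix V :: "real set" assume "openin euclidean V"
    then have "openin X (u -` {u. fst (u i) \<in> V} \<inter> topspace X)"
      by (intro gen) (use i in auto)
    moreover have "u -` {u. fst (u i) \<in> V} \<inter> topspace X = {x \<in> topspace X. fst (u x i) \<in> V}" by auto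
    ultimately show "openin X {x \<in> topspace X. fst (u x i) \<in> V}" by simp
  qed auto
  have 3: "continuous_map (subtopology X {x. 0 < fst (u x i)}) P (\<lambda>x. snd (u x i))" if i: "i < n" for i
    unfolding continuous_map_def
  proof (intro conjI allI impI)
    show "(\<lambda>x. snd (u x i)) \<in> topspace (subtopology X {x. 0 < fst (u x i)}) \<rightarrow> topspace P"
      using 1 i by auto
    fix V assume "openin P V"
    then have "openin X (u -` {u. 0 < fst (u i) \<and> snd (u i) \<in> V} \<inter> topspace X)"
      by (intro gen) (use i in auto)
    moreover have "{x \<in> topspace (subtopology X {x. 0 < fst (u x i)}). snd (u x i) \<in> V} =
        (u -` {u. 0 < fst (u i) \<and> snd (u i) \<in> V} \<inter> topspace X) \<inter> {x. 0 < fst (u x i)}"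
      by auto
    ultimately show "openin (subtopology X {x. 0 < fst (u x i)})
        {x \<in> topspace (subtopology X {x. 0 < fst (u x i)}). snd (u x i) \<in> V}"
      unfolding openin_subtopology by blast
  qed
  show ?R using 1 2 3 by simp
next
  assume R: ?R
  have pos: "openin X {x \<in> topspace X. 0 < fst (u x i)}" if "i < n" for i
    using R that openin_continuous_map_preimage[of X euclideanreal "\<lambda>x. fst (u x i)" "{0<..}"]
    by simp
  show ?L
    unfolding join_space_def continuous_map_in_subtopology continuous_on_generated_topo_iff
  proof (intro conjI allI impI)
    show "u \<in> topspace X \<rightarrow> {u. (\<forall>i<n. 0 \<le> fst (u i) \<and> (0 < fst (u i) \<longrightarrow> snd (u i) \<in> topspace P)) \<and>
         (\<exists>i<n. 0 < fst (u i))}"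
      using R by (auto simp: continuous_map_def Pi_iff)
  next
    fix W :: "(nat \<Rightarrow> real \<times> 'b) set" assume W: "W \<in> {{u. fst (u i) \<in> V} |i V. i < n \<and> open V} \<union>
         {{u. 0 < fst (u i) \<and> snd (u i) \<in> V} |i V. i < n \<and> openin P V} \<union> {UNIV}"
    then consider i V where "i < n" "open V" "W = {u. fst (u i) \<in> V}"
      | i V where "i < n" "openin P V" "W = {u. 0 < fst (u i) \<and> snd (u i) \<in> V}"
      | "W = UNIV" by blast
    then show "openin X (u -` W \<inter> topspace X)"
    proof cases
      case (1 i V)
      then have "openin X {x \<in> topspace X. fst (u x i) \<in> V}"
        using R by (intro openin_continuous_map_preimage[of X euclideanreal "\<lambda>x. fst (u x i)" V]) auto
      moreover have "u -` W \<inter> topspace X = {x \<in> topspace X. fst (u x i) \<in> V}" using 1 by auto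
      ultimately show ?thesis by simp
    next
      case (2 i V)
      then have "openin (subtopology X {x. 0 < fst (u x i)})
        {x \<in> topspace (subtopology X {x. 0 < fst (u x i)}). snd (u x i) \<in> V}"
        using R by (intro openin_continuous_map_preimage) auto
      then obtain T where T: "openin X T" "{x \<in> topspace (subtopology X {x. 0 < fst (u x i)}). snd (u x i) \<in> V} =
        T \<inter> {x. 0 < fst (u x i)}" by (auto simp: openin_subtopology)
      then have "u -` W \<inter> topspace X = T \<inter> {x \<in> topspace X. 0 < fst (u x i)}"
        using 2 openin_subset[OF T(1)] by auto
      then show ?thesis using T pos[OF 2(1)] by auto
    qed auto
  qed auto
qed

text \<open>Interpolate the weights linearly and keep the fibre coordinates constant in time. Where
  both weights are positive the two fibre coordinates agree, so they glue along two open sets to one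
  map \<open>p\<close>.\<close>

lemma join_homotopic_linear:
  assumes u: "continuous_map X (join_space n P) u" and v: "continuous_map X (join_space n P) v"
    and eq: "\<And>x i. \<lbrakk>x \<in> topspace X; i < n; 0 < fst (u x i); 0 < fst (v x i)\<rbrakk> \<Longrightarrow> snd (u x i) = snd (v x i)"
  shows "homotopic_with (\<lambda>_. True) X (join_space n P) u v"
proof -
  define p where "p = (\<lambda>x i. if 0 < fst (u x i) then snd (u x i) else snd (v x i))"
  note U = u[unfolded continuous_map_join_space] and V = v[unfolded continuous_map_join_space]
  have opu: "openin X {x \<in> topspace X. 0 < fst (u x i)}" if "i < n" for i
    using U that openin_continuous_map_preimage[of X euclideanreal "\<lambda>x. fst (u x i)" "{0<..}"] by simp
  have opv: "openin X {x \<in> topspace X. 0 < fst (v x i)}" if "i < n" for i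
    using V that openin_continuous_map_preimage[of X euclideanreal "\<lambda>x. fst (v x i)" "{0<..}"] by simp
  let ?D = "\<lambda>i. {x \<in> topspace X. 0 < fst (u x i) \<or> 0 < fst (v x i)}"
  have p: "continuous_map (subtopology X (?D i)) P (\<lambda>x. p x i)" if i: "i < n" for i
  proof (rule pasting_lemma[where I = "UNIV :: bool set"
        and T = "\<lambda>b. {x \<in> topspace X. 0 < fst ((if b then u else v) x i)}"
        and f = "\<lambda>b x. snd ((if b then u else v) x i)"])
    fix b :: bool
    let ?S = "{x \<in> topspace X. 0 < fst ((if b then u else v) x i)}"
    have "openin X ?S" using opu[OF i] opv[OF i] by (cases b) auto
    moreover have "?S \<subseteq> ?D i" by auto
    ultimately show "openin (subtopology X (?D i)) ?S"
      unfolding openin_subtopology by (intro exI[of _ ?S] conjI) auto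
    have "?D i \<inter> ?S = topspace X \<inter> {x. 0 < fst ((if b then u else v) x i)}"
      by auto
    then have "subtopology (subtopology X (?D i)) ?S = subtopology X {x. 0 < fst ((if b then u else v) x i)}"
      unfolding subtopology_subtopology by (simp only: subtopology_restrict)
    then show "continuous_map (subtopology (subtopology X (?D i)) ?S) P (\<lambda>x. snd ((if b then u else v) x i))"
      using U V i by (cases b) auto
  next
    fix b b' :: bool and x
    assume "x \<in> topspace (subtopology X (?D i)) \<inter> {x \<in> topspace X. 0 < fst ((if b then u else v) x i)}
        \<inter> {x \<in> topspace X. 0 < fst ((if b' then u else v) x i)}"
    then show "snd ((if b then u else v) x i) = snd ((if b' then u else v) x i)"
      using eq[of x i] i by (cases b; cases b') auto
  next
    fix x assume "x \<in> topspace (subtopology X (?D i))"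
    then show "\<exists>b. b \<in> UNIV \<and> x \<in> {x \<in> topspace X. 0 < fst ((if b then u else v) x i)} \<and>
         p x i = snd ((if b then u else v) x i)"
      by (intro exI[of _ "0 < fst (u x i)"]) (auto simp: p_def)
  qed
  \<comment> \<open>The values at times 0 and 1 are set separately because the homotopy has to end
    in \<open>u\<close> and \<open>v\<close> literally, junk included; where the weight is positive
    they coincide with \<open>p\<close>.\<close>
  define w where "w = (\<lambda>(t::real, x) i. ((1 - t) * fst (u x i) + t * fst (v x i),
      if t = 0 then snd (u x i) else if t = 1 then snd (v x i) else p x i))"
  have pos: "0 < fst (u x i) \<or> 0 < fst (v x i)"
    if "0 < fst (w (t, x) i)" "x \<in> topspace X" "t \<in> {0..1}" "i < n" for t x i
  proof (rule ccontr)
    assume "\<not> ?thesis"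
    moreover have "0 \<le> fst (u x i)" "0 \<le> fst (v x i)" using U V that(2,4) by simp_all
    ultimately have "fst (u x i) = 0" "fst (v x i) = 0" by linarith+
    with that(1) show False by (simp add: w_def)
  qed
  have "continuous_map (prod_topology (top_of_set {0..1}) X) (join_space n P) w"
    unfolding continuous_map_join_space
  proof (intro conjI ballI allI impI)
    fix q i assume "q \<in> topspace (prod_topology (top_of_set {0..1::real}) X)" "i < n"
    moreover from this have "0 \<le> fst (u (snd q) i)" "0 \<le> fst (v (snd q) i)"
      using U V by auto
    ultimately show "0 \<le> fst (w q i)"
      by (auto simp: w_def)
  next
    fix q assume "q \<in> topspace (prod_topology (top_of_set {0..1::real}) X)"
    then obtain t x where q: "q = (t, x)" "t \<in> {0..1}" "x \<in> topspace X" by auto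
    have nn: "\<forall>i<n. 0 \<le> fst (u x i)" "\<forall>i<n. 0 \<le> fst (v x i)" using U V q(3) by simp_all
    obtain i j where ij: "i < n" "0 < fst (u x i)" "j < n" "0 < fst (v x j)"
      using conjunct1[OF U] conjunct1[OF V] q(3) by meson
    show "\<exists>i<n. 0 < fst (w q i)"
    proof (cases "t = 1")
      case True then show ?thesis using ij q by (auto simp: w_def)
    next
      case False
      then have "0 < (1 - t) * fst (u x i) + t * fst (v x i)"
        using ij q nn by (intro add_pos_nonneg) auto
      then show ?thesis using ij q by (auto simp: w_def)
    qed
  next
    fix i assume i: "i < n"
    have "continuous_map (prod_topology (top_of_set {0..1}) X) euclideanreal
        (\<lambda>q. (1 - fst q) * fst (u (snd q) i) + fst q * fst (v (snd q) i))"
    proof -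
      have 1: "continuous_map (prod_topology (top_of_set {0..1}) X) euclideanreal fst"
        using continuous_map_fst continuous_map_in_subtopology by blast
      have "continuous_map X euclideanreal (\<lambda>x. fst (u x i))"
        "continuous_map X euclideanreal (\<lambda>x. fst (v x i))"
        using i U V by auto
      from this[THEN continuous_map_compose[OF continuous_map_snd]]
      show ?thesis
        by (intro continuous_map_add continuous_map_real_mult continuous_map_diff 1) (auto simp: comp_def)
    qed
    then show "continuous_map (prod_topology (top_of_set {0..1}) X) euclideanreal (\<lambda>x. fst (w x i))"
      by (simp add: w_def case_prod_unfold)
    let ?S = "subtopology (prod_topology (top_of_set {0..1}) X) {q. 0 < fst (w q i)}"
    have "continuous_map ?S (subtopology X (?D i)) snd"
      unfolding continuous_map_in_subtopology
    proof
      show "snd \<in> topspace ?S \<rightarrow> ?D i"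
      proof
        fix q assume "q \<in> topspace ?S"
        then show "snd q \<in> ?D i" using pos[of "fst q" "snd q" i] i by auto
      qed
    next
      show "continuous_map ?S X snd"
        by (rule continuous_map_from_subtopology[OF continuous_map_snd])
    qed
    from continuous_map_compose[OF this p[OF i]]
    have "continuous_map ?S P (\<lambda>q. p (snd q) i)" by (simp add: comp_def)
    then show "continuous_map ?S P (\<lambda>q. snd (w q i))"
      by (rule continuous_map_eq) (auto simp: w_def p_def eq i)
  qed
  moreover have "w (0, x) = u x" "w (1, x) = v x" for x
    by (auto simp: w_def)
  ultimately show ?thesis
    unfolding homotopic_with_def by blast
qed

section \<open>Extending maps over discs and grid cells\<close>

lemma continuous_map_closed_cases:
  assumes "closedin X A" "closedin X B" "topspace X \<subseteq> A \<union> B"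
    and "continuous_map (subtopology X A) Y f" "continuous_map (subtopology X B) Y g"
    and eq: "\<And>x. \<lbrakk>x \<in> A; x \<in> B\<rbrakk> \<Longrightarrow> f x = g x"
  shows "continuous_map X Y (\<lambda>x. if x \<in> A then f x else g x)"
proof (rule pasting_lemma_closed[where I = "UNIV :: bool set" and T = "\<lambda>b. if b then A else B"
      and f = "\<lambda>b. if b then f else g"])
  fix i j x assume "x \<in> topspace X \<inter> (if i then A else B) \<inter> (if j then A else B)"
  then show "(if i then f else g) x = (if j then f else g) x"
    using eq[of x] by (cases i; cases j) auto
next
  fix x assume "x \<in> topspace X"
  then show "\<exists>j. j \<in> UNIV \<and> x \<in> (if j then A else B) \<and> (if x \<in> A then f x else g x) = (if j then f else g) x"
    using assms(3) by (intro exI[of _ "x \<in> A"]) auto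
qed (use assms in \<open>auto split: if_splits\<close>)

definition extends :: "(nat \<Rightarrow> real) set \<Rightarrow> (nat \<Rightarrow> real) set \<Rightarrow> 'p topology \<Rightarrow> bool" where
  "extends S B P \<longleftrightarrow> (\<forall>u. continuous_map (top_of_set B) P u \<longrightarrow>
     (\<exists>v. continuous_map (top_of_set S) P v \<and> (\<forall>x\<in>B. v x = u x)))"

text \<open>A map on \<open>B'\<close> is pulled back along \<open>\<beta>\<close>, extended, and
  then restricted along \<open>\<alpha>\<close>. The inverse law is used on \<open>B'\<close> alone,
  which admits maps \<open>\<alpha>\<close> that are not homeomorphisms.\<close>

lemma extends_transfer:
  assumes ext: "extends S B P"
    and \<alpha>: "continuous_on S' \<alpha>" "\<alpha> ` S' \<subseteq> S" "\<alpha> ` B' \<subseteq> B"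
    and \<beta>: "continuous_on B \<beta>" "\<beta> ` B \<subseteq> B'" and inv: "\<And>x. x \<in> B' \<Longrightarrow> \<beta> (\<alpha> x) = x"
  shows "extends S' B' P"
  unfolding extends_def
proof (intro allI impI)
  fix u assume u: "continuous_map (top_of_set B') P u"
  have "continuous_map (top_of_set B) (top_of_set B') \<beta>"
    using \<beta> by (auto simp: continuous_map_in_subtopology)
  from continuous_map_compose[OF this u]
  obtain v where v: "continuous_map (top_of_set S) P v" "\<And>x. x \<in> B \<Longrightarrow> v x = u (\<beta> x)"
    using ext unfolding extends_def by (auto simp: comp_def)
  have "continuous_map (top_of_set S') (top_of_set S) \<alpha>"
    using \<alpha> by (auto simp: continuous_map_in_subtopology)
  from continuous_map_compose[OF this v(1)] have "continuous_map (top_of_set S') P (\<lambda>x. v (\<alpha> x))"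
    by (simp add: comp_def)
  moreover have "v (\<alpha> x) = u x" if "x \<in> B'" for x
    using that \<alpha>(3) v(2) inv by auto
  ultimately show "\<exists>v. continuous_map (top_of_set S') P v \<and> (\<forall>x\<in>B'. v x = u x)" by blast
qed

definition disc_set :: "nat \<Rightarrow> (nat \<Rightarrow> real) set" where
  "disc_set n = {x. (\<forall>i\<ge>n. x i = 0) \<and> (\<Sum>i<n. (x i)\<^sup>2) \<le> 1}"

lemma disc_eq: "disc n = top_of_set (disc_set n)"
  by (auto simp: disc_def Euclidean_space_def euclidean_product_topology subtopology_subtopology
      disc_set_def intro!: arg_cong[where f = top_of_set])

lemma topspace_disc: "topspace (disc n) = disc_set n"
  by (simp add: disc_eq)

lemma disc_boundary_eq: "disc_boundary n = {x. (\<forall>i\<ge>n. x i = 0) \<and> (\<Sum>i<n. (x i)\<^sup>2) = 1}"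
  by (auto simp: disc_boundary_def topspace_disc disc_set_def)

lemma disc_boundary_subset: "disc_boundary n \<subseteq> disc_set n"
  by (auto simp: disc_boundary_def topspace_disc)

lemma nsphere_eq: "nsphere n = top_of_set (disc_boundary (Suc n))"
  by (auto simp: nsphere_def Euclidean_space_def euclidean_product_topology subtopology_subtopology
      disc_boundary_eq lessThan_Suc_atMost intro!: arg_cong[where f = top_of_set])

text \<open>For \<open>k = 0\<close> this says that \<open>P\<close> is nonempty; for
  \<open>k > 0\<close>, that every map from the (k-1)-sphere to \<open>P\<close> is freely
  null-homotopic. Extensibility for all \<open>k < m\<close> is thus (m-2)-connectedness.\<close>

definition extensible :: "nat \<Rightarrow> 'p topology \<Rightarrow> bool" where
  "extensible k P \<longleftrightarrow> extends (disc_set k) (disc_boundary k) P"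

section \<open>Cubes and round balls\<close>

primrec sup_norm :: "nat \<Rightarrow> (nat \<Rightarrow> real) \<Rightarrow> real" where
  "sup_norm 0 z = 0"
| "sup_norm (Suc k) z = max (sup_norm k z) \<bar>z k\<bar>"

definition two_norm :: "nat \<Rightarrow> (nat \<Rightarrow> real) \<Rightarrow> real" where
  "two_norm k z = sqrt (\<Sum>i<k. (z i)\<^sup>2)"

lemma continuous_on_coordinate [continuous_intros]:
  "continuous_on S (\<lambda>x::nat \<Rightarrow> real. x i)"
  by (rule continuous_on_subset[OF continuous_on_product_coordinates]) simp

lemma continuous_on_sup_norm: "continuous_on S (sup_norm k)"
proof -
  have "continuous_on S (\<lambda>z. sup_norm k z)"
    by (induction k) (auto intro!: continuous_intros)
  then show ?thesis by simp
qed

lemma continuous_on_two_norm: "continuous_on S (two_norm k)"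
  unfolding two_norm_def[abs_def]
  by (intro continuous_intros)

lemma sup_norm_nonneg: "0 \<le> sup_norm k z"
  by (induction k) auto

lemma sup_norm_le_iff: "0 \<le> c \<Longrightarrow> sup_norm k z \<le> c \<longleftrightarrow> (\<forall>i<k. \<bar>z i\<bar> \<le> c)"
  by (induction k) (auto simp: less_Suc_eq)

lemma sup_norm_attained: "0 < sup_norm k z \<Longrightarrow> \<exists>i<k. \<bar>z i\<bar> = sup_norm k z"
  by (induction k) (auto simp: max_def less_Suc_eq)

lemma sup_norm_scale: "0 \<le> c \<Longrightarrow> sup_norm k (\<lambda>i. c * z i) = c * sup_norm k z"
  by (induction k) (auto simp: max_mult_distrib_left abs_mult)

lemma two_norm_nonneg: "0 \<le> two_norm k z"
  by (simp add: two_norm_def sum_nonneg)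

lemma two_norm_scale: "0 \<le> c \<Longrightarrow> two_norm k (\<lambda>i. c * z i) = c * two_norm k z"
  by (simp add: two_norm_def power_mult_distrib real_sqrt_mult flip: sum_distrib_left)

lemma sup_norm_pos_iff: "0 < sup_norm k z \<longleftrightarrow> (\<exists>i<k. z i \<noteq> 0)"
  using sup_norm_le_iff[of 0 k z] by (auto simp: not_le[symmetric])

lemma two_norm_pos_iff: "0 < two_norm k z \<longleftrightarrow> (\<exists>i<k. z i \<noteq> 0)"
proof -
  have "(\<Sum>i<k. (z i)\<^sup>2) = 0 \<longleftrightarrow> (\<forall>i<k. z i = 0)"
    by (subst sum_nonneg_eq_0_iff) auto
  then show ?thesis
    using two_norm_nonneg[of k z] by (auto simp: two_norm_def less_le)
qed

lemma disc_set_two_norm: "disc_set k = {z. (\<forall>i\<ge>k. z i = 0) \<and> two_norm k z \<le> 1}"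
  by (simp add: disc_set_def two_norm_def)

lemma disc_boundary_two_norm: "disc_boundary k = {z. (\<forall>i\<ge>k. z i = 0) \<and> two_norm k z = 1}"
  by (simp add: disc_boundary_eq two_norm_def)

lemma extends_change_norm:
  fixes N1 N2 :: "(nat \<Rightarrow> real) \<Rightarrow> real"
  assumes ext: "extends {z. (\<forall>i\<ge>k. z i = 0) \<and> N1 z \<le> 1} {z. (\<forall>i\<ge>k. z i = 0) \<and> N1 z = 1} P"
    and cont: "continuous_on UNIV N1" "continuous_on UNIV N2"
    and nonneg: "\<And>z. 0 \<le> N1 z" "\<And>z. 0 \<le> N2 z"
    and scale: "\<And>c z. 0 \<le> c \<Longrightarrow> N1 (\<lambda>i. c * z i) = c * N1 z" "\<And>c z. 0 \<le> c \<Longrightarrow> N2 (\<lambda>i. c * z i) = c * N2 z"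
    and pos: "\<And>z. 0 < N1 z \<longleftrightarrow> 0 < N2 z"
  shows "extends {z. (\<forall>i\<ge>k. z i = 0) \<and> N2 z \<le> 1} {z. (\<forall>i\<ge>k. z i = 0) \<and> N2 z = 1} P"
proof -
  \<comment> \<open>Radial rescaling of one ball onto the other would divide by a norm at the
    origin. The denominator \<open>N1 z + (1 - N2 z)\<close> is positive on the whole ball and at
    least \<open>N1 z\<close>, so \<open>\<alpha>\<close> maps ball to ball; on the boundary
    \<open>N2 z = 1\<close> it equals \<open>N1 z\<close>, and \<open>\<alpha>\<close> is radial
    projection.\<close>
  define \<alpha> where "\<alpha> = (\<lambda>z i. inverse (N1 z + (1 - N2 z)) * z i :: real)"
  define \<beta> where "\<beta> = (\<lambda>z i. inverse (N2 z) * z i :: real)"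
  have c1: "continuous_on S N1" and c2: "continuous_on S N2" for S
    by (rule continuous_on_subset[OF cont(1)] continuous_on_subset[OF cont(2)], simp)+
  have d: "0 < N1 z + (1 - N2 z)" if "N2 z \<le> 1" for z
    using that nonneg(1)[of z] pos[of z] by (cases "N2 z = 1") auto
  have 1: "N1 z = 1 \<Longrightarrow> 0 < N2 z" for z using pos[of z] by simp
  have N\<alpha>: "N1 (\<alpha> z) = inverse (N1 z + (1 - N2 z)) * N1 z" "N2 (\<alpha> z) = inverse (N1 z + (1 - N2 z)) * N2 z"
    if "N2 z \<le> 1" for z
    unfolding \<alpha>_def using d[OF that] by (auto intro!: scale)
  have N\<beta>: "N2 (\<beta> z) = inverse (N2 z) * N2 z" for z
    unfolding \<beta>_def using nonneg(2)[of z] by (auto intro!: scale)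
  show ?thesis
  proof (rule extends_transfer[OF ext, where \<alpha> = \<alpha> and \<beta> = \<beta>])
    have "N1 z + (1 - N2 z) \<noteq> 0" if "N2 z \<le> 1" for z using d[OF that] by simp
    then show "continuous_on {z. (\<forall>i\<ge>k. z i = 0) \<and> N2 z \<le> 1} \<alpha>"
      unfolding \<alpha>_def
      by (intro continuous_on_coordinatewise_then_product continuous_intros c1 c2) auto
    show "\<alpha> ` {z. (\<forall>i\<ge>k. z i = 0) \<and> N2 z \<le> 1} \<subseteq> {z. (\<forall>i\<ge>k. z i = 0) \<and> N1 z \<le> 1}"
    proof safe
      fix z assume "N2 z \<le> 1"
      then show "N1 (\<alpha> z) \<le> 1"
        using d[of z] by (simp add: N\<alpha> field_simps)
    qed (auto simp: \<alpha>_def)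
    show "\<alpha> ` {z. (\<forall>i\<ge>k. z i = 0) \<and> N2 z = 1} \<subseteq> {z. (\<forall>i\<ge>k. z i = 0) \<and> N1 z = 1}"
    proof safe
      fix z assume "N2 z = 1"
      then show "N1 (\<alpha> z) = 1"
        using d[of z] by (simp add: N\<alpha> field_simps)
    qed (auto simp: \<alpha>_def)
    show "continuous_on {z. (\<forall>i\<ge>k. z i = 0) \<and> N1 z = 1} \<beta>"
      unfolding \<beta>_def using 1
      by (intro continuous_on_coordinatewise_then_product continuous_intros c1 c2) fastforce+
    show "\<beta> ` {z. (\<forall>i\<ge>k. z i = 0) \<and> N1 z = 1} \<subseteq> {z. (\<forall>i\<ge>k. z i = 0) \<and> N2 z = 1}"
    proof safe
      fix z assume "N1 z = 1"
      then show "N2 (\<beta> z) = 1"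
        using 1[of z] by (simp add: N\<beta>)
    qed (auto simp: \<beta>_def)
    fix z assume "z \<in> {z. (\<forall>i\<ge>k. z i = 0) \<and> N2 z = 1}"
    then have z: "N2 z = 1" by simp
    have "N2 (\<alpha> z) = inverse (N1 z)" using z by (simp add: N\<alpha>)
    then show "\<beta> (\<alpha> z) = z"
      using d[of z] z by (auto simp: \<beta>_def \<alpha>_def)
  qed
qed

section \<open>Axis-parallel boxes of arbitrary dimension\<close>

definition grid_box :: "(nat \<Rightarrow> real) \<Rightarrow> nat set \<Rightarrow> real \<Rightarrow> (nat \<Rightarrow> real) set" where
  "grid_box a D N = {x. \<forall>i. if i \<in> D then a i \<le> x i \<and> x i \<le> a i + N else x i = a i}"

definition grid_boundary :: "(nat \<Rightarrow> real) \<Rightarrow> nat set \<Rightarrow> real \<Rightarrow> (nat \<Rightarrow> real) set" where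
  "grid_boundary a D N = {x \<in> grid_box a D N. \<exists>i\<in>D. x i = a i \<or> x i = a i + N}"

lemma grid_box_charts:
  assumes "finite D" "0 < N"
  obtains \<alpha> \<beta> where
    "continuous_on UNIV \<alpha>" "continuous_on UNIV \<beta>"
    "\<alpha> ` grid_box a D N \<subseteq> {z. (\<forall>i\<ge>card D. z i = 0) \<and> sup_norm (card D) z \<le> 1}"
    "\<alpha> ` grid_boundary a D N \<subseteq> {z. (\<forall>i\<ge>card D. z i = 0) \<and> sup_norm (card D) z = 1}"
    "\<beta> ` {z. (\<forall>i\<ge>card D. z i = 0) \<and> sup_norm (card D) z \<le> 1} \<subseteq> grid_box a D N"
    "\<beta> ` {z. (\<forall>i\<ge>card D. z i = 0) \<and> sup_norm (card D) z = 1} \<subseteq> grid_boundary a D N"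
    "\<And>x. x \<in> grid_box a D N \<Longrightarrow> \<beta> (\<alpha> x) = x"
    "\<And>z. \<forall>i\<ge>card D. z i = 0 \<Longrightarrow> \<alpha> (\<beta> z) = z"
proof -
  define k where "k = card D"
  obtain e where e: "bij_betw e {..<k} D"
    using ex_bij_betw_nat_finite[OF assms(1)] by (auto simp: k_def atLeast0LessThan)
  define e' where "e' = inv_into {..<k} e"
  have e': "e' i < k" "e (e' i) = i" if "i \<in> D" for i
    using bij_betw_inv_into_right[OF e that] that inv_into_into[of i e "{..<k}"] bij_betw_imp_surj_on[OF e]
    by (auto simp: e'_def)
  have ee: "e i \<in> D" "e' (e i) = i" if "i < k" for i
    using bij_betw_inv_into_left[OF e] that bij_betwE[OF e] by (auto simp: e'_def)
  define sc where "sc = (\<lambda>x c. 2 * (x - c) / N - 1)"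
  define un where "un = (\<lambda>w c. c + N * ((w + 1) / 2))"
  have sc: "\<bar>sc x c\<bar> \<le> 1 \<longleftrightarrow> c \<le> x \<and> x \<le> c + N" "\<bar>sc x c\<bar> = 1 \<longleftrightarrow> x = c \<or> x = c + N" for x c
    using assms(2) by (auto simp: sc_def abs_if abs_le_iff field_simps)
  have un: "un (sc x c) c = x" "sc (un w c) c = w" for x c w
    using assms(2) by (auto simp: sc_def un_def field_simps)
  define \<alpha> where "\<alpha> = (\<lambda>x i. if i < k then sc (x (e i)) (a (e i)) else 0)"
  define \<beta> where "\<beta> = (\<lambda>z i. if i \<in> D then un (z (e' i)) (a i) else a i)"
  have ca: "continuous_on UNIV \<alpha>"
  proof (rule continuous_on_coordinatewise_then_product)
    fix i show "continuous_on UNIV (\<lambda>x. \<alpha> x i)"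
      using assms(2) by (cases "i < k") (auto simp: \<alpha>_def sc_def intro!: continuous_intros)
  qed
  have cb: "continuous_on UNIV \<beta>"
  proof (rule continuous_on_coordinatewise_then_product)
    fix i show "continuous_on UNIV (\<lambda>x. \<beta> x i)"
      by (cases "i \<in> D") (auto simp: \<beta>_def un_def intro!: continuous_intros)
  qed
  have A0: "\<alpha> x i = 0" if "k \<le> i" for x i using that by (simp add: \<alpha>_def)
  have A: "sup_norm k (\<alpha> x) \<le> 1" if "x \<in> grid_box a D N" for x
    using that ee by (auto simp: sup_norm_le_iff \<alpha>_def grid_box_def sc)
  have A1: "sup_norm k (\<alpha> x) = 1" if x: "x \<in> grid_boundary a D N" for x
  proof -
    obtain i where i: "i \<in> D" "x i = a i \<or> x i = a i + N" and xb: "x \<in> grid_box a D N"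
      using x by (auto simp: grid_boundary_def)
    have "\<bar>\<alpha> x (e' i)\<bar> = 1" using i e'[OF i(1)] by (simp add: \<alpha>_def sc)
    moreover have "\<bar>\<alpha> x (e' i)\<bar> \<le> sup_norm k (\<alpha> x)"
      using sup_norm_le_iff[of "sup_norm k (\<alpha> x)" k "\<alpha> x"] sup_norm_nonneg[of k "\<alpha> x"] e'[OF i(1)] by simp
    ultimately show ?thesis using A[OF xb] by simp
  qed
  have inv1: "\<beta> (\<alpha> x) = x" if "x \<in> grid_box a D N" for x
    using that by (auto simp: \<alpha>_def \<beta>_def e' un grid_box_def fun_eq_iff split: if_splits)
  have inv2: "\<alpha> (\<beta> z) = z" if "\<forall>i\<ge>k. z i = 0" for z
    using that by (auto simp: \<alpha>_def \<beta>_def ee un fun_eq_iff)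
  have B: "\<beta> z \<in> grid_box a D N" if "sup_norm k z \<le> 1" for z
  proof -
    have "a i \<le> un (z (e' i)) (a i) \<and> un (z (e' i)) (a i) \<le> a i + N" if "i \<in> D" for i
    proof -
      have "\<bar>z (e' i)\<bar> \<le> 1"
        using \<open>sup_norm k z \<le> 1\<close> e'[OF that] by (simp add: sup_norm_le_iff)
      then show ?thesis using sc(1)[of "un (z (e' i)) (a i)" "a i"] by (simp add: un)
    qed
    then show ?thesis by (auto simp: grid_box_def \<beta>_def)
  qed
  have B1: "\<beta> z \<in> grid_boundary a D N" if z: "sup_norm k z = 1" for z
  proof -
    obtain i where i: "i < k" "\<bar>z i\<bar> = 1" using sup_norm_attained[of k z] z by auto
    then have "\<beta> z (e i) = a (e i) \<or> \<beta> z (e i) = a (e i) + N"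
      using sc(2)[of "un (z i) (a (e i))" "a (e i)"] by (simp add: \<beta>_def ee un)
    then show ?thesis using B[of z] z ee[OF i(1)] by (auto simp: grid_boundary_def)
  qed
  have A1': "grid_boundary a D N \<subseteq> grid_box a D N" by (auto simp: grid_boundary_def)
  show ?thesis
    by (rule that[OF ca cb]) (use A0 A A1 B B1 inv1 inv2 A1' in \<open>auto simp: k_def[symmetric]\<close>)
qed

text \<open>Attaching maps live on round discs, whereas subdivision calls for cubes. The box is
  carried affinely to the unit ball of the sup norm, which the change of norm compares with the
  round disc.\<close>

lemma extends_grid_box_iff:
  assumes "finite D" "0 < N"
  shows "extends (grid_box a D N) (grid_boundary a D N) P \<longleftrightarrow> extensible (card D) P"
proof (rule grid_box_charts[OF assms, of a])
  let ?k = "card D"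
  fix \<alpha> \<beta>
  assume ab: "continuous_on UNIV \<alpha>" "continuous_on UNIV \<beta>"
    "\<alpha> ` grid_box a D N \<subseteq> {z. (\<forall>i\<ge>?k. z i = 0) \<and> sup_norm ?k z \<le> 1}"
    "\<alpha> ` grid_boundary a D N \<subseteq> {z. (\<forall>i\<ge>?k. z i = 0) \<and> sup_norm ?k z = 1}"
    "\<beta> ` {z. (\<forall>i\<ge>?k. z i = 0) \<and> sup_norm ?k z \<le> 1} \<subseteq> grid_box a D N"
    "\<beta> ` {z. (\<forall>i\<ge>?k. z i = 0) \<and> sup_norm ?k z = 1} \<subseteq> grid_boundary a D N"
    "\<And>x. x \<in> grid_box a D N \<Longrightarrow> \<beta> (\<alpha> x) = x"
    "\<And>z. \<forall>i\<ge>?k. z i = 0 \<Longrightarrow> \<alpha> (\<beta> z) = z"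
  have c: "continuous_on S \<alpha>" "continuous_on S \<beta>" for S
     apply (rule continuous_on_subset[OF ab(1) subset_UNIV])
    apply (rule continuous_on_subset[OF ab(2) subset_UNIV])
    done
  have pos: "0 < sup_norm ?k z \<longleftrightarrow> 0 < two_norm ?k z" for z
    by (simp add: sup_norm_pos_iff two_norm_pos_iff)
  show ?thesis
  proof
    assume "extends (grid_box a D N) (grid_boundary a D N) P"
    then have "extends {z. (\<forall>i\<ge>?k. z i = 0) \<and> sup_norm ?k z \<le> 1} {z. (\<forall>i\<ge>?k. z i = 0) \<and> sup_norm ?k z = 1} P"
      by (rule extends_transfer[OF _ c(2) ab(5,6) c(1) ab(4)]) (use ab(8) in auto)
    then show "extensible ?k P"
      unfolding extensible_def disc_set_two_norm disc_boundary_two_norm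
      by (rule extends_change_norm)
        (auto simp: continuous_on_sup_norm continuous_on_two_norm sup_norm_nonneg two_norm_nonneg
          sup_norm_scale two_norm_scale pos)
  next
    assume "extensible ?k P"
    then have "extends {z. (\<forall>i\<ge>?k. z i = 0) \<and> sup_norm ?k z \<le> 1} {z. (\<forall>i\<ge>?k. z i = 0) \<and> sup_norm ?k z = 1} P"
      unfolding extensible_def disc_set_two_norm disc_boundary_two_norm
      by (rule extends_change_norm)
        (auto simp: continuous_on_sup_norm continuous_on_two_norm sup_norm_nonneg two_norm_nonneg
          sup_norm_scale two_norm_scale pos)
    then show "extends (grid_box a D N) (grid_boundary a D N) P"
      by (rule extends_transfer[OF _ c(1) ab(3,4) c(2) ab(6)])
        (use ab(7) in \<open>auto simp: grid_boundary_def\<close>)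
  qed
qed

text \<open>The homotopy is spread over the shell \<open>1/2 \<le> N x \<le> 1\<close>, run at time
  \<open>2 - 2 * N x\<close>, and the inner ball is sent to \<open>c\<close>.\<close>

lemma nullhomotopic_imp_extension:
  fixes N :: "(nat \<Rightarrow> real) \<Rightarrow> real" and k :: nat
  defines "C \<equiv> {z. (\<forall>i\<ge>k. z i = 0) \<and> N z \<le> 1}"
    and "B \<equiv> {z. (\<forall>i\<ge>k. z i = 0) \<and> N z = 1}"
  assumes cont: "\<And>S. continuous_on S N" and scale: "\<And>c z. 0 \<le> c \<Longrightarrow> N (\<lambda>i. c * z i) = c * N z"
    and hom: "homotopic_with (\<lambda>_. True) (top_of_set B) P u (\<lambda>_. c)" and c: "c \<in> topspace P"
  shows "\<exists>v. continuous_map (top_of_set C) P v \<and> (\<forall>x\<in>B. v x = u x)"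
proof -
  obtain h where h: "continuous_map (prod_topology (top_of_set {0..1::real}) (top_of_set B)) P h"
    "\<And>x. h (0, x) = u x" "\<And>x. h (1, x) = c"
    using hom unfolding homotopic_with_def by metis
  \<comment> \<open>Truncation at 1/2 keeps the radial projection \<open>q\<close> continuous at the
    origin; on the shell \<open>m x = N x\<close>, and \<open>q x\<close> lies on the unit sphere of
    \<open>N\<close>.\<close>
  define m where "m = (\<lambda>x. max (1/2) (N x))"
  define q where "q = (\<lambda>x i. inverse (m x) * x i :: real)"
  let ?A = "{x \<in> C. 1/2 \<le> N x}" and ?B = "{x \<in> C. N x \<le> 1/2}"
  have mpos: "0 < m x" for x by (simp add: m_def less_max_iff_disj)
  have q: "q x \<in> B" if "x \<in> ?A" for x
  proof -
    have "N (q x) = inverse (m x) * N x"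
      unfolding q_def using mpos[of x] by (intro scale) simp
    moreover have "m x = N x" using that by (simp add: m_def)
    ultimately show ?thesis using that mpos[of x] by (auto simp: B_def C_def q_def)
  qed
  have mc: "continuous_on S m" for S
    unfolding m_def by (intro continuous_intros cont)
  have qc: "continuous_on S q" for S
    unfolding q_def using mpos
    by (intro continuous_on_coordinatewise_then_product continuous_intros mc) (simp add: less_imp_neq[symmetric])
  have clo: "closedin (top_of_set C) ?A" "closedin (top_of_set C) ?B"
    using closedin_continuous_map_preimage[of "top_of_set C" euclideanreal "N" "{1/2..}"]
      closedin_continuous_map_preimage[of "top_of_set C" euclideanreal "N" "{..1/2}"]
    by (simp_all add: cont)
  have "continuous_map (top_of_set C) P
      (\<lambda>x. if x \<in> ?A then h (2 - 2 * N x, q x) else c)"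
  proof (rule continuous_map_closed_cases[OF clo])
    have "continuous_map (top_of_set ?A) (prod_topology (top_of_set {0..1::real}) (top_of_set B))
        (\<lambda>x. (2 - 2 * N x, q x))"
      unfolding continuous_map_paired
    proof
      show "continuous_map (top_of_set ?A) (top_of_set {0..1}) (\<lambda>x. 2 - 2 * N x)"
        by (auto simp: C_def intro!: continuous_intros cont)
      show "continuous_map (top_of_set ?A) (top_of_set B) q"
        using q qc by auto
    qed
    from continuous_map_compose[OF this h(1)]
    have "continuous_map (top_of_set ?A) P (\<lambda>x. h (2 - 2 * N x, q x))"
      by (simp add: comp_def)
    moreover have "C \<inter> ?A = ?A" by auto
    ultimately show "continuous_map (subtopology (top_of_set C) ?A) P (\<lambda>x. h (2 - 2 * N x, q x))"
      unfolding subtopology_subtopology by simp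
  next
    fix x assume "x \<in> ?A" "x \<in> ?B"
    then have "2 - 2 * N x = 1" by auto
    then show "h (2 - 2 * N x, q x) = c" by (simp only: h(3))
  qed (use c in auto)
  moreover have "(if x \<in> ?A then h (2 - 2 * N x, q x) else c) = u x" if "x \<in> B" for x
  proof -
    have "N x = 1" "x \<in> C"
      using that by (auto simp: B_def C_def)
    moreover from this have "q x = x" by (simp add: q_def m_def fun_eq_iff)
    ultimately show ?thesis using h(2) by simp
  qed
  ultimately show ?thesis by blast
qed

text \<open>The form in which the join argument delivers connectivity: free null-homotopies on the
  boundary of a box, with a constant that depends on the map. They are carried to the sup-norm
  sphere, where the shell construction applies.\<close>

lemma extensible_if_nullhomotopic_on_grid:
  assumes D: "finite D" "0 < N"
    and null: "\<And>u. continuous_map (top_of_set (grid_boundary a D N)) P u \<Longrightarrow>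
      \<exists>c\<in>topspace P. homotopic_with (\<lambda>_. True) (top_of_set (grid_boundary a D N)) P u (\<lambda>_. c)"
  shows "extensible (card D) P"
  unfolding extends_grid_box_iff[OF D, of a, symmetric] extends_def
proof (intro allI impI)
  fix u assume u: "continuous_map (top_of_set (grid_boundary a D N)) P u"
  obtain c where c: "c \<in> topspace P"
    and hom: "homotopic_with (\<lambda>_. True) (top_of_set (grid_boundary a D N)) P u (\<lambda>_. c)"
    using null[OF u] by blast
  let ?k = "card D"
  let ?C = "{z. (\<forall>i\<ge>?k. z i = 0) \<and> sup_norm ?k z \<le> 1}" and ?B = "{z. (\<forall>i\<ge>?k. z i = 0) \<and> sup_norm ?k z = 1}"
  show "\<exists>v. continuous_map (top_of_set (grid_box a D N)) P v \<and> (\<forall>x\<in>grid_boundary a D N. v x = u x)"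
  proof (rule grid_box_charts[OF D, of a])
    fix \<alpha> \<beta>
    assume ab: "continuous_on UNIV \<alpha>" "continuous_on UNIV \<beta>"
      "\<alpha> ` grid_box a D N \<subseteq> ?C" "\<alpha> ` grid_boundary a D N \<subseteq> ?B"
      "\<beta> ` ?C \<subseteq> grid_box a D N" "\<beta> ` ?B \<subseteq> grid_boundary a D N"
      "\<And>x. x \<in> grid_box a D N \<Longrightarrow> \<beta> (\<alpha> x) = x"
      "\<And>z. \<forall>i\<ge>?k. z i = 0 \<Longrightarrow> \<alpha> (\<beta> z) = z"
    have "continuous_map (top_of_set ?B) (top_of_set (grid_boundary a D N)) \<beta>"
      using ab(6) continuous_on_subset[OF ab(2) subset_UNIV] by (auto simp: continuous_map_in_subtopology)
    from homotopic_with_compose_continuous_map_right[OF hom this]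
    have "homotopic_with (\<lambda>_. True) (top_of_set ?B) P (u \<circ> \<beta>) (\<lambda>_. c)"
      by (simp add: comp_def)
    from nullhomotopic_imp_extension[OF continuous_on_sup_norm sup_norm_scale this c]
    obtain v where v: "continuous_map (top_of_set ?C) P v" "\<And>z. z \<in> ?B \<Longrightarrow> v z = u (\<beta> z)"
      by (auto simp only: comp_def)
    have "continuous_map (top_of_set (grid_box a D N)) (top_of_set ?C) \<alpha>"
      using ab(3) continuous_on_subset[OF ab(1) subset_UNIV] by (auto simp: continuous_map_in_subtopology)
    from continuous_map_compose[OF this v(1)]
    have "continuous_map (top_of_set (grid_box a D N)) P (v \<circ> \<alpha>)" .
    moreover have "(v \<circ> \<alpha>) x = u x" if "x \<in> grid_boundary a D N" for x
      using that ab(4,7) v(2)[of "\<alpha> x"] by (auto simp: grid_boundary_def)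
    ultimately show ?thesis by blast
  qed
qed

section \<open>Extension over subcomplexes of the integer grid\<close>

text \<open>A cell of the integer grid: \<open>fst c\<close> is its least corner, \<open>snd c\<close> its set of free coordinates.\<close>

definition cell :: "(nat \<Rightarrow> nat) \<times> nat set \<Rightarrow> (nat \<Rightarrow> real) set" where
  "cell c = grid_box (\<lambda>i. real (fst c i)) (snd c) 1"

definition cell_boundary :: "(nat \<Rightarrow> nat) \<times> nat set \<Rightarrow> (nat \<Rightarrow> real) set" where
  "cell_boundary c = grid_boundary (\<lambda>i. real (fst c i)) (snd c) 1"

lemma closed_grid_box: "closed (grid_box a D N)"
proof -
  have "grid_box a D N = (\<Inter>i. {x. if i \<in> D then a i \<le> x i \<and> x i \<le> a i + N else x i = a i})"
    by (auto simp: grid_box_def)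
  moreover have "closed {x::nat \<Rightarrow> real. if i \<in> D then a i \<le> x i \<and> x i \<le> a i + N else x i = a i}" for i
    by (cases "i \<in> D") (auto intro!: closed_Collect_conj closed_Collect_le closed_Collect_eq continuous_intros)
  ultimately show ?thesis by (metis (no_types, lifting) closed_INT)
qed

lemma closed_cell: "closed (cell c)"
  by (simp add: cell_def closed_grid_box)

text \<open>On the free coordinates of \<open>c\<close> an interior point lies strictly between
  consecutive integers, which forces these coordinates to be free in \<open>c'\<close> with the same
  corner; the remaining coordinates are constant on \<open>c\<close>.\<close>

lemma cell_interior_subset:
  assumes "x \<in> cell c" "x \<notin> cell_boundary c" "x \<in> cell c'"
  shows "cell c \<subseteq> cell c'"
proof
  fix y assume y: "y \<in> cell c"
  have "if i \<in> snd c' then real (fst c' i) \<le> y i \<and> y i \<le> real (fst c' i) + 1 else y i = real (fst c' i)" for i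
  proof (cases "i \<in> snd c")
    case True
    then have x1: "real (fst c i) < x i" "x i < real (fst c i) + 1"
      using assms(1,2) unfolding cell_def cell_boundary_def grid_boundary_def grid_box_def
      by (force simp: less_le)+
    have y1: "real (fst c i) \<le> y i" "y i \<le> real (fst c i) + 1"
      using y True unfolding cell_def grid_box_def by (auto split: if_splits)
    show ?thesis
    proof (cases "i \<in> snd c'")
      case True
      then have "real (fst c' i) \<le> x i" "x i \<le> real (fst c' i) + 1"
        using assms(3) unfolding cell_def grid_box_def by (auto split: if_splits)
      with x1 have "fst c i = fst c' i" by linarith
      with True y1 show ?thesis by simp
    next
      case False
      then have "real (fst c' i) = x i"
        using assms(3) unfolding cell_def grid_box_def by (auto split: if_splits)
      with x1 have "real (fst c i) < real (fst c' i)" "real (fst c' i) < real (Suc (fst c i))" by simp_all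
      then show ?thesis unfolding of_nat_less_iff by simp
    qed
  next
    case False
    then have "x i = y i" using assms(1) y unfolding cell_def grid_box_def by (auto split: if_splits)
    moreover have "if i \<in> snd c' then real (fst c' i) \<le> x i \<and> x i \<le> real (fst c' i) + 1 else x i = real (fst c' i)"
      using assms(3) unfolding cell_def grid_box_def by blast
    ultimately show ?thesis by (simp only:)
  qed
  then show "y \<in> cell c'" unfolding cell_def grid_box_def by blast
qed

lemma cell_face:
  assumes "x \<in> cell_boundary c" "finite (snd c)"
  obtains c' where "x \<in> cell c'" "cell c' \<subseteq> cell c" "snd c' \<subset> snd c"
proof -
  obtain i where i: "i \<in> snd c" "x i = real (fst c i) \<or> x i = real (fst c i) + 1" and x: "x \<in> cell c"
    using assms(1) by (auto simp: cell_boundary_def grid_boundary_def cell_def)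
  define c' where "c' = ((fst c)(i := if x i = real (fst c i) then fst c i else Suc (fst c i)), snd c - {i})"
  have i': "fst c' i = fst c i \<or> fst c' i = Suc (fst c i)" "x i = real (fst c' i)" "i \<notin> snd c'"
    using i(2) by (auto simp: c'_def)
  have j': "fst c' j = fst c j" "j \<in> snd c' \<longleftrightarrow> j \<in> snd c" if "j \<noteq> i" for j
    using that by (auto simp: c'_def)
  have mem: "y \<in> cell b \<longleftrightarrow> (\<forall>j. if j \<in> snd b then real (fst b j) \<le> y j \<and> y j \<le> real (fst b j) + 1
      else y j = real (fst b j))" for y b
    by (simp add: cell_def grid_box_def)
  show ?thesis
  proof
    have "if j \<in> snd c' then real (fst c' j) \<le> x j \<and> x j \<le> real (fst c' j) + 1 else x j = real (fst c' j)" for j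
      using x[unfolded mem, THEN spec[of _ j]] i' j'[of j] by (cases "j = i") simp_all
    then show "x \<in> cell c'" unfolding mem by blast
    show "cell c' \<subseteq> cell c"
    proof
      fix y assume "y \<in> cell c'"
      then have "if j \<in> snd c' then real (fst c' j) \<le> y j \<and> y j \<le> real (fst c' j) + 1 else y j = real (fst c' j)" for j
        unfolding mem by blast
      then have "if j \<in> snd c then real (fst c j) \<le> y j \<and> y j \<le> real (fst c j) + 1 else y j = real (fst c j)" for j
        using i' i(1) j'[of j] by (cases "j = i") (smt (verit) of_nat_Suc)+
      then show "y \<in> cell c" unfolding mem by blast
    qed
    show "snd c' \<subset> snd c" using i by (auto simp: c'_def)
  qed
qed

text \<open>Testing the inclusion at the least corner of \<open>c'\<close> and at its unit
  translates along the free directions shows that free directions of \<open>c'\<close> are free in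
  \<open>c\<close>; if the free directions coincide, so do the corners.\<close>

lemma cell_subset_cases:
  assumes sub: "cell c' \<subseteq> cell c"
  shows "c' = c \<or> snd c' \<subset> snd c"
proof -
  define l where "l = (\<lambda>i. real (fst c' i))"
  have "l \<in> cell c'" by (auto simp: cell_def grid_box_def l_def)
  then have l: "if i \<in> snd c then real (fst c i) \<le> l i \<and> l i \<le> real (fst c i) + 1 else l i = real (fst c i)" for i
    using sub unfolding cell_def grid_box_def by blast
  have up: "i \<in> snd c \<and> l i + 1 \<le> real (fst c i) + 1" if "i \<in> snd c'" for i
  proof -
    have "l(i := l i + 1) \<in> cell c'" using that by (auto simp: cell_def grid_box_def l_def)
    then have "l(i := l i + 1) \<in> cell c" using sub by blast
    then have "if i \<in> snd c then real (fst c i) \<le> l i + 1 \<and> l i + 1 \<le> real (fst c i) + 1 else l i + 1 = real (fst c i)"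
      unfolding cell_def grid_box_def by (auto dest: spec[of _ i])
    then show ?thesis using l[of i] by (auto split: if_splits)
  qed
  have le: "snd c' \<subseteq> snd c" using up by blast
  show ?thesis
  proof (cases "snd c' = snd c")
    case True
    have "fst c' i = fst c i" for i
      using l[of i] up[of i] True by (cases "i \<in> snd c") (auto simp: l_def)
    then show ?thesis using True by (simp add: prod_eq_iff fun_eq_iff)
  next
    case False
    then show ?thesis using le by (simp add: psubset_eq)
  qed
qed

text \<open>Such sets of cells are the subcomplexes of the grid.\<close>

definition face_closed :: "((nat \<Rightarrow> nat) \<times> nat set) set \<Rightarrow> bool" where
  "face_closed C \<longleftrightarrow> (\<forall>c\<in>C. \<forall>c'. cell c' \<subseteq> cell c \<longrightarrow> c' \<in> C)"

lemma face_closedD: "\<lbrakk>face_closed C; c \<in> C; cell c' \<subseteq> cell c\<rbrakk> \<Longrightarrow> c' \<in> C"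
  unfolding face_closed_def by blast

text \<open>Induction on the number of missing cells, adding one of least dimension: its proper
  faces are all present, so its boundary lies in the part already treated and it meets that part in
  nothing else. Finiteness keeps the unions closed, so the pieces paste.\<close>

lemma extend_over_cells:
  assumes "finite C" "L \<subseteq> C" "face_closed C" "face_closed L"
    and fin: "\<And>c. c \<in> C \<Longrightarrow> finite (snd c)"
    and ext: "\<And>c. c \<in> C - L \<Longrightarrow> extensible (card (snd c)) P"
    and u: "continuous_map (top_of_set (\<Union>(cell ` L))) P u"
  shows "\<exists>v. continuous_map (top_of_set (\<Union>(cell ` C))) P v \<and> (\<forall>x\<in>\<Union>(cell ` L). v x = u x)"
  using assms(2,4) ext u
proof (induction "card (C - L)" arbitrary: L u rule: less_induct)
  case less
  show ?case
  proof (cases "C = L")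
    case True then show ?thesis using less.prems by blast
  next
    case False
    then have ne: "C - L \<noteq> {}" using less.prems(1) by blast
    define c where "c = arg_min_on (card \<circ> snd) (C - L)"
    have "finite (C - L)" using assms(1) by simp
    from arg_min_if_finite[OF this ne, of "card \<circ> snd"]
    have c: "c \<in> C - L" and cmin: "\<And>c'. c' \<in> C - L \<Longrightarrow> card (snd c) \<le> card (snd c')"
      unfolding c_def[symmetric] by (simp_all add: not_less)
    have finc: "finite (snd c)" using c fin by blast
    have face: "c' \<in> L" if "cell c' \<subseteq> cell c" "snd c' \<subset> snd c" for c'
    proof (rule ccontr)
      assume "c' \<notin> L"
      moreover have "c' \<in> C" using face_closedD[OF assms(3) _ that(1)] c by blast
      ultimately have "card (snd c) \<le> card (snd c')" using cmin by blast
      then show False using psubset_card_mono[OF finc that(2)] by simp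
    qed
    have bd: "cell_boundary c \<subseteq> \<Union>(cell ` L)"
    proof
      fix x assume "x \<in> cell_boundary c"
      from cell_face[OF this finc] obtain c' where "x \<in> cell c'" "cell c' \<subseteq> cell c" "snd c' \<subset> snd c" .
      then show "x \<in> \<Union>(cell ` L)" using face[of c'] by auto
    qed
    \<comment> \<open>A common point interior to \<open>c\<close> would make \<open>c\<close> a face
      of a cell of \<open>L\<close>, and hence a member of \<open>L\<close>.\<close>
    have int: "cell c \<inter> \<Union>(cell ` L) \<subseteq> cell_boundary c"
    proof (rule ccontr)
      assume "\<not> ?thesis"
      then obtain x c' where x: "x \<in> cell c" "x \<notin> cell_boundary c" "c' \<in> L" "x \<in> cell c'" by blast
      then have "cell c \<subseteq> cell c'" using cell_interior_subset by blast
      then have "c \<in> L" using face_closedD[OF less.prems(2) x(3)] by blast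
      then show False using c by simp
    qed
    have "continuous_map (top_of_set (cell_boundary c)) P u"
      using continuous_map_from_subtopology_mono[OF less.prems(4) bd] by simp
    moreover have "extends (cell c) (cell_boundary c) P"
      unfolding cell_def cell_boundary_def by (rule iffD2[OF extends_grid_box_iff[OF finc] less.prems(3)[OF c]]) simp
    ultimately obtain w where w: "continuous_map (top_of_set (cell c)) P w" "\<And>x. x \<in> cell_boundary c \<Longrightarrow> w x = u x"
      unfolding extends_def by blast
    define L' where "L' = insert c L"
    have finL: "finite L" using less.prems(1) assms(1) finite_subset by blast
    let ?u = "\<lambda>x. if x \<in> \<Union>(cell ` L) then u x else w x"
    have U': "\<Union>(cell ` L') = \<Union>(cell ` L) \<union> cell c" by (auto simp: L'_def)
    have h5: "continuous_map (top_of_set (\<Union>(cell ` L'))) P ?u"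
    proof (rule continuous_map_closed_cases[where B = "cell c"])
      have "closed (\<Union>(cell ` L))" using finL closed_cell by auto
      then show "closedin (top_of_set (\<Union>(cell ` L'))) (\<Union>(cell ` L))"
        by (intro closed_subset) (auto simp: U')
      show "closedin (top_of_set (\<Union>(cell ` L'))) (cell c)"
        by (intro closed_subset closed_cell) (auto simp: U')
      show "topspace (top_of_set (\<Union>(cell ` L'))) \<subseteq> \<Union>(cell ` L) \<union> cell c" by (simp add: U')
      have "\<Union>(cell ` L') \<inter> \<Union>(cell ` L) = \<Union>(cell ` L)" "\<Union>(cell ` L') \<inter> cell c = cell c" by (auto simp: U')
      then show "continuous_map (subtopology (top_of_set (\<Union>(cell ` L'))) (\<Union>(cell ` L))) P u"
        "continuous_map (subtopology (top_of_set (\<Union>(cell ` L'))) (cell c)) P w"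
        unfolding subtopology_subtopology using less.prems(4) w(1) by simp_all
      fix x assume "x \<in> \<Union>(cell ` L)" "x \<in> cell c"
      then show "u x = w x" using int w(2) by auto
    qed
    have h1: "card (C - L') < card (C - L)"
      unfolding L'_def using c assms(1) by (intro psubset_card_mono) auto
    have h3: "face_closed L'"
      unfolding face_closed_def L'_def
    proof (intro ballI allI impI)
      fix b c' assume b: "b \<in> insert c L" and sub: "cell c' \<subseteq> cell b"
      show "c' \<in> insert c L"
      proof (cases "b = c")
        case True
        then show ?thesis using cell_subset_cases[OF sub] face[of c'] sub by auto
      next
        case False
        then have "b \<in> L" using b by simp
        then show ?thesis using face_closedD[OF less.prems(2) _ sub] by simp
      qed
    qed
    have h2: "L' \<subseteq> C" using c less.prems(1) by (simp add: L'_def)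
    have h4: "extensible (card (snd b)) P" if "b \<in> C - L'" for b
      using that less.prems(3)[of b] by (simp add: L'_def)
    from less.hyps[OF h1 h2 h3 h4 h5]
    obtain v where v: "continuous_map (top_of_set (\<Union>(cell ` C))) P v" "\<forall>x\<in>\<Union>(cell ` L'). v x = ?u x"
      by blast
    have "v x = u x" if "x \<in> \<Union>(cell ` L)" for x
      using v(2) that U' by (metis UnI1)
    then show ?thesis using v(1) by blast
  qed
qed

section \<open>Geometry of the integer grid\<close>

lemma continuous_map_compose_on:
  assumes "continuous_map (top_of_set S) P g" "continuous_on S' \<phi>" "\<phi> ` S' \<subseteq> S"
  shows "continuous_map (top_of_set S') P (\<lambda>x. g (\<phi> x))"
proof -
  have "continuous_map (top_of_set S') (top_of_set S) \<phi>"
    using assms(2,3) by (auto simp: continuous_map_in_subtopology)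
  from continuous_map_compose[OF this assms(1)] show ?thesis by (simp add: comp_def)
qed

lemma continuous_map_join_on:
  "continuous_map (top_of_set S) (join_space n P) u \<longleftrightarrow>
     (\<forall>x\<in>S. (\<forall>i<n. 0 \<le> fst (u x i)) \<and> (\<exists>i<n. 0 < fst (u x i))) \<and>
     (\<forall>i<n. continuous_on S (\<lambda>x. fst (u x i)) \<and>
        continuous_map (top_of_set {x \<in> S. 0 < fst (u x i)}) P (\<lambda>x. snd (u x i)))"
  by (simp add: continuous_map_join_space subtopology_subtopology Int_def)

lemma sum_pos_iff:
  fixes f :: "'a \<Rightarrow> real"
  assumes "finite A" "\<And>x. x \<in> A \<Longrightarrow> 0 \<le> f x"
  shows "0 < sum f A \<longleftrightarrow> (\<exists>x\<in>A. 0 < f x)"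
proof -
  have "sum f A = 0 \<longleftrightarrow> (\<forall>x\<in>A. f x = 0)" by (rule sum_nonneg_eq_0_iff[OF assms])
  moreover have "0 \<le> sum f A" by (rule sum_nonneg[OF assms(2)])
  ultimately show ?thesis using assms(2) by (metis less_le)
qed

lemma prod_pos_iff:
  fixes f :: "'a \<Rightarrow> real"
  assumes "finite A" "\<And>x. x \<in> A \<Longrightarrow> 0 \<le> f x"
  shows "0 < prod f A \<longleftrightarrow> (\<forall>x\<in>A. 0 < f x)"
proof -
  have "prod f A = 0 \<longleftrightarrow> (\<exists>x\<in>A. f x = 0)" by (rule prod_zero_iff[OF assms(1)])
  moreover have "0 \<le> prod f A" by (rule prod_nonneg[OF assms(2)])
  ultimately show ?thesis using assms(2) by (metis less_le)
qed

lemma mem_cell: "x \<in> cell c \<longleftrightarrow> (\<forall>i. if i \<in> snd c then real (fst c i) \<le> x i \<and> x i \<le> real (fst c i) + 1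
    else x i = real (fst c i))"
  by (simp add: cell_def grid_box_def)

lemma cell_convex:
  assumes "x \<in> cell c" "y \<in> cell c" "0 \<le> t" "t \<le> 1"
  shows "(\<lambda>i. (1 - t) * x i + t * y i) \<in> cell c"
  unfolding mem_cell
proof
  fix i
  note xy = assms(1,2)[unfolded mem_cell, THEN spec[of _ i]]
  show "if i \<in> snd c then real (fst c i) \<le> (1 - t) * x i + t * y i \<and> (1 - t) * x i + t * y i \<le> real (fst c i) + 1
    else (1 - t) * x i + t * y i = real (fst c i)"
  proof (cases "i \<in> snd c")
    case True
    then have b: "x i \<in> {real (fst c i)..real (fst c i) + 1}" "y i \<in> {real (fst c i)..real (fst c i) + 1}"
      using xy by auto
    have "(1 - t) *\<^sub>R x i + t *\<^sub>R y i \<in> {real (fst c i)..real (fst c i) + 1}"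
      by (rule convexD[OF convex_closed_interval b]) (use assms(3,4) in auto)
    then show ?thesis using True by simp
  next
    case False
    then show ?thesis using xy by (simp add: algebra_simps)
  qed
qed

section \<open>Cells of a subdivided cube\<close>

abbreviation grid_cube :: "nat \<Rightarrow> nat \<Rightarrow> (nat \<Rightarrow> real) set" where
  "grid_cube k N \<equiv> grid_box (\<lambda>_. 0) {..<k} (real N)"

lemma mem_grid_cube: "x \<in> grid_cube k N \<longleftrightarrow>
    (\<forall>i. if i < k then 0 \<le> x i \<and> x i \<le> real N else x i = 0)"
  unfolding grid_box_def by (simp only: mem_Collect_eq lessThan_iff add_0)

lemma cell_subset_grid_box_iff:
  "cell c \<subseteq> grid_cube k N \<longleftrightarrow>
     (\<forall>i. (i \<in> snd c \<longrightarrow> i < k \<and> fst c i < N) \<and> (i < k \<longrightarrow> fst c i \<le> N) \<and> (k \<le> i \<longrightarrow> fst c i = 0))"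
    (is "?L \<longleftrightarrow> ?R")
proof
  assume L: ?L
  \<comment> \<open>The bounds are read off at the least corner \<open>l\<close> and the greatest
    corner \<open>h\<close> of the cell.\<close>
  define l where "l = (\<lambda>i. real (fst c i))"
  define h where "h = (\<lambda>i. real (fst c i) + (if i \<in> snd c then 1 else 0))"
  have "l \<in> cell c" "h \<in> cell c" by (simp_all add: mem_cell l_def h_def)
  with L have "l \<in> grid_cube k N" "h \<in> grid_cube k N" by auto
  then have lh: "if i < k then 0 \<le> l i \<and> l i \<le> real N else l i = 0"
    "if i < k then 0 \<le> h i \<and> h i \<le> real N else h i = 0" for i
    unfolding mem_grid_cube by blast+
  show ?R
  proof (intro allI conjI impI)
    fix i
    show "fst c i \<le> N" if "i < k" using lh(1)[of i] that by (simp add: l_def)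
    show "fst c i = 0" if "k \<le> i" using lh(1)[of i] that by (simp add: l_def)
    assume i: "i \<in> snd c"
    show ik: "i < k"
    proof (rule ccontr)
      assume "\<not> i < k"
      then show False using lh(2)[of i] i by (simp add: h_def)
    qed
    have "real (Suc (fst c i)) \<le> real N" using lh(2)[of i] i ik by (simp add: h_def)
    then show "fst c i < N" by simp
  qed
next
  assume R: ?R
  show ?L
  proof
    fix x assume x: "x \<in> cell c"
    have "if i < k then 0 \<le> x i \<and> x i \<le> real N else x i = 0" for i
    proof (cases "i \<in> snd c")
      case True
      then have "real (fst c i) + 1 \<le> real N" "i < k" using R by (auto simp: Suc_le_eq[symmetric] simp flip: of_nat_Suc)
      then show ?thesis using x[unfolded mem_cell, THEN spec[of _ i]] True by auto
    next
      case False
      then show ?thesis using x[unfolded mem_cell, THEN spec[of _ i]] R by auto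
    qed
    then show "x \<in> grid_cube k N" unfolding mem_grid_cube by blast
  qed
qed

lemma finite_cells_subset_grid_box: "finite {c. cell c \<subseteq> grid_cube k N}"
proof (rule finite_subset)
  let ?A = "{f. \<forall>i. (i \<in> {..<k} \<longrightarrow> f i \<in> {..N}) \<and> (i \<notin> {..<k} \<longrightarrow> f i = (0::nat))}"
  show "{c. cell c \<subseteq> grid_cube k N} \<subseteq> ?A \<times> Pow {..<k}"
    by (auto simp: cell_subset_grid_box_iff)
  show "finite (?A \<times> Pow {..<k})"
    by (intro finite_cartesian_product finite_set_of_finite_funs) auto
qed

text \<open>For a point with nonnegative coordinates this is the only grid cell that has it in its
  relative interior: integral coordinates are pinned, all others are free.\<close>

definition carrier_cell :: "(nat \<Rightarrow> real) \<Rightarrow> (nat \<Rightarrow> nat) \<times> nat set" where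
  "carrier_cell x = (\<lambda>i. nat \<lfloor>x i\<rfloor>, {i. x i \<notin> \<int>})"

lemma carrier_cell_bounds:
  assumes "0 \<le> x i"
  shows "i \<in> snd (carrier_cell x) \<Longrightarrow> real (fst (carrier_cell x) i) < x i \<and> x i < real (fst (carrier_cell x) i) + 1"
    and "i \<notin> snd (carrier_cell x) \<Longrightarrow> x i = real (fst (carrier_cell x) i)"
proof -
  have f: "real (nat \<lfloor>x i\<rfloor>) = of_int \<lfloor>x i\<rfloor>" using assms by simp
  have "x i \<in> \<int>" if "of_int \<lfloor>x i\<rfloor> = x i" using that Ints_of_int by metis
  moreover have "of_int \<lfloor>x i\<rfloor> \<le> x i" "x i < of_int \<lfloor>x i\<rfloor> + 1" by linarith+
  ultimately show "i \<in> snd (carrier_cell x) \<Longrightarrow> real (fst (carrier_cell x) i) < x i \<and> x i < real (fst (carrier_cell x) i) + 1"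
    by (auto simp: carrier_cell_def f simp del: of_nat_nat intro: le_neq_trans)
  show "i \<notin> snd (carrier_cell x) \<Longrightarrow> x i = real (fst (carrier_cell x) i)"
    by (auto simp: carrier_cell_def f simp del: of_nat_nat elim: Ints_cases)
qed

lemma mem_carrier_cell: "(\<And>i. 0 \<le> x i) \<Longrightarrow> x \<in> cell (carrier_cell x)"
  unfolding mem_cell using carrier_cell_bounds[of x] by (auto simp: less_imp_le)

lemma carrier_cell_grid_box:
  assumes x: "x \<in> grid_cube k N"
  shows "cell (carrier_cell x) \<subseteq> grid_cube k N" "x \<in> cell (carrier_cell x)"
    "x \<in> grid_boundary (\<lambda>_. 0) {..<k} (real N) \<Longrightarrow> cell (carrier_cell x) \<subseteq> grid_boundary (\<lambda>_. 0) {..<k} (real N)"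
proof -
  have x': "if i < k then 0 \<le> x i \<and> x i \<le> real N else x i = 0" for i
    using x unfolding mem_grid_cube by blast
  have pos: "0 \<le> x i" for i using x'[of i] by (cases "i < k") auto
  show mem: "x \<in> cell (carrier_cell x)" by (rule mem_carrier_cell[OF pos])
  let ?c = "carrier_cell x"
  show sub: "cell ?c \<subseteq> grid_cube k N"
    unfolding cell_subset_grid_box_iff
  proof (intro allI conjI impI)
    fix i
    show ik: "i < k" if i: "i \<in> snd ?c"
    proof (rule ccontr)
      assume "\<not> i < k"
      then have "x i = 0" using x'[of i] by simp
      then show False using i by (simp add: carrier_cell_def)
    qed
    show "fst ?c i < N" if i: "i \<in> snd ?c"
    proof -
      have "real (fst ?c i) < real N" using carrier_cell_bounds(1)[OF pos i] x'[of i] ik[OF i] by auto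
      then show ?thesis by simp
    qed
    show "fst ?c i \<le> N" if "i < k"
      using x'[of i] that by (simp add: carrier_cell_def nat_le_iff floor_le_iff le_less_trans)
    show "fst ?c i = 0" if "k \<le> i" using x'[of i] that by (simp add: carrier_cell_def)
  qed
  assume "x \<in> grid_boundary (\<lambda>_. 0) {..<k} (real N)"
  then obtain i where i: "i < k" "x i = 0 \<or> x i = real N" by (auto simp: grid_boundary_def)
  \<comment> \<open>A coordinate equal to 0 or \<open>N\<close> is integral and therefore pinned in
    the carrier, so the whole carrier stays in that face of the cube.\<close>
  have ni: "i \<notin> snd ?c" using i(2) by (auto simp: carrier_cell_def)
  show "cell ?c \<subseteq> grid_boundary (\<lambda>_. 0) {..<k} (real N)"
  proof
    fix y assume y: "y \<in> cell ?c"
    have "y i = x i" using y[unfolded mem_cell, THEN spec[of _ i]] carrier_cell_bounds(2)[OF pos ni] ni by simp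
    then show "y \<in> grid_boundary (\<lambda>_. 0) {..<k} (real N)"
      using i y sub by (auto simp: grid_boundary_def)
  qed
qed

section \<open>Monotone collapsing maps of the line\<close>

definition clamp01 :: "real \<Rightarrow> real" where
  "clamp01 t = max 0 (min 1 t)"

text \<open>
  On \<open>[0,N]\<close>, \<open>squeeze\<close> collapses the \<open>3/8\<close>-neighbourhood of every integer to that integer, and
  \<open>halve\<close>, whose values are in units of \<open>1/2\<close>, collapses the \<open>1/8\<close>-neighbourhoods of the integers and
  the \<open>1/4\<close>-neighbourhoods of the half-integers; \<open>bump\<close> is supported by the latter.
\<close>

definition squeeze :: "nat \<Rightarrow> real \<Rightarrow> real" where
  "squeeze N x = (\<Sum>z<N. clamp01 (4 * (x - real z) - 3/2))"

definition halve :: "nat \<Rightarrow> real \<Rightarrow> real" where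
  "halve N x = (\<Sum>z<N. clamp01 (8 * (x - real z) - 1) + clamp01 (8 * (x - real z) - 6))"

definition bump :: "nat \<Rightarrow> real \<Rightarrow> real" where
  "bump N x = (\<Sum>z<N. max 0 (1/4 - \<bar>x - real z - 1/2\<bar>))"

lemma clamp01_mono: "s \<le> t \<Longrightarrow> clamp01 s \<le> clamp01 t"
  by (auto simp: clamp01_def)

lemma clamp01_0: "t \<le> 0 \<Longrightarrow> clamp01 t = 0" and clamp01_1: "1 \<le> t \<Longrightarrow> clamp01 t = 1"
  by (auto simp: clamp01_def)

lemma squeeze_mono: "x \<le> y \<Longrightarrow> squeeze N x \<le> squeeze N y"
  unfolding squeeze_def by (intro sum_mono clamp01_mono) simp

lemma halve_mono: "x \<le> y \<Longrightarrow> halve N x \<le> halve N y"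
  unfolding halve_def by (intro sum_mono add_mono clamp01_mono) simp_all

lemma sum_if_less: "f \<le> N \<Longrightarrow> (\<Sum>z<N. if z < f then c else (0::real)) = c * real f"
proof -
  assume "f \<le> N"
  then have "(\<Sum>z<N. if z < f then c else (0::real)) = (\<Sum>z\<in>{..<f}. c)"
    by (intro sum.mono_neutral_cong_right) auto
  then show ?thesis by simp
qed

lemma nat_less_real: "z < f \<Longrightarrow> real z + 1 \<le> real f"
  by (simp add: nat_less_real_le)

lemma squeeze_near:
  assumes "f \<le> N" "\<bar>x - real f\<bar> \<le> 3/8"
  shows "squeeze N x = real f"
proof -
  have h: "x - real f \<le> 3/8" "real f - x \<le> 3/8" using assms(2) by linarith+
  have "clamp01 (4 * (x - real z) - 3/2) = (if z < f then 1 else 0)" for z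
  proof (cases "z < f")
    case True
    from nat_less_real[OF this] h have "1 \<le> 4 * (x - real z) - 3/2" by argo
    then show ?thesis using True by (simp add: clamp01_1)
  next
    case False
    then have "real f \<le> real z" by simp
    with h have "4 * (x - real z) - 3/2 \<le> 0" by argo
    then show ?thesis using False by (simp add: clamp01_0)
  qed
  then show ?thesis unfolding squeeze_def using sum_if_less[OF assms(1), of 1] by simp
qed

lemma halve_near:
  assumes "f \<le> N" "\<bar>x - real f\<bar> \<le> 1/8"
  shows "halve N x = 2 * real f"
proof -
  have h: "x - real f \<le> 1/8" "real f - x \<le> 1/8" using assms(2) by linarith+
  have "clamp01 (8 * (x - real z) - 1) + clamp01 (8 * (x - real z) - 6) = (if z < f then 2 else 0)" for z
  proof (cases "z < f")
    case True
    from nat_less_real[OF this] h have "1 \<le> 8 * (x - real z) - 1" "1 \<le> 8 * (x - real z) - 6" by argo+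
    then show ?thesis using True by (simp add: clamp01_1)
  next
    case False
    then have "real f \<le> real z" by simp
    with h have "8 * (x - real z) - 1 \<le> 0" "8 * (x - real z) - 6 \<le> 0" by argo+
    then show ?thesis using False by (simp add: clamp01_0)
  qed
  then show ?thesis unfolding halve_def using sum_if_less[OF assms(1), of 2] by simp
qed

lemma halve_middle:
  assumes "f < N" "\<bar>x - real f - 1/2\<bar> \<le> 1/4"
  shows "halve N x = 2 * real f + 1"
proof -
  have h: "x - real f \<le> 3/4" "real f - x \<le> - (1/4)" using assms(2) by linarith+
  have "clamp01 (8 * (x - real z) - 1) + clamp01 (8 * (x - real z) - 6) = (if z < f then 2 else 0) + (if z = f then 1 else 0)" for z
  proof -
    consider "z < f" | "z = f" | "f < z" by linarith
    then show ?thesis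
    proof cases
      case 1
      from nat_less_real[OF 1] h have "1 \<le> 8 * (x - real z) - 1" "1 \<le> 8 * (x - real z) - 6" by argo+
      then show ?thesis using 1 by (simp add: clamp01_1)
    next
      case 2
      then have "real z = real f" by simp
      with h have "1 \<le> 8 * (x - real z) - 1" "8 * (x - real z) - 6 \<le> 0" by argo+
      then show ?thesis using 2 by (simp add: clamp01_1 clamp01_0)
    next
      case 3
      from nat_less_real[OF 3] h have "8 * (x - real z) - 1 \<le> 0" "8 * (x - real z) - 6 \<le> 0" by argo+
      then show ?thesis using 3 by (simp add: clamp01_0)
    qed
  qed
  then show ?thesis unfolding halve_def using sum_if_less[of f N 2] assms(1) by (simp add: sum.distrib)
qed

lemma bump_pos_iff: "0 < bump N x \<longleftrightarrow> (\<exists>f<N. \<bar>x - real f - 1/2\<bar> < 1/4)"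
  unfolding bump_def by (subst sum_pos_iff) (auto simp: less_max_iff_disj)

lemma continuous_on_squeeze [continuous_intros]:
  "continuous_on S g \<Longrightarrow> continuous_on S (\<lambda>x. squeeze N (g x))"
  unfolding squeeze_def clamp01_def by (intro continuous_intros)

lemma continuous_on_halve [continuous_intros]:
  "continuous_on S g \<Longrightarrow> continuous_on S (\<lambda>x. halve N (g x))"
  unfolding halve_def clamp01_def by (intro continuous_intros)

lemma continuous_on_bump [continuous_intros]:
  "continuous_on S g \<Longrightarrow> continuous_on S (\<lambda>x. bump N (g x))"
  unfolding bump_def by (intro continuous_intros)

section \<open>Neighbourhoods of cells and the dual skeleton\<close>

definition cell_top :: "(nat \<Rightarrow> nat) \<times> nat set \<Rightarrow> nat \<Rightarrow> nat" where
  "cell_top c i = (if i \<in> snd c then Suc (fst c i) else fst c i)"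

definition near :: "nat \<Rightarrow> real \<Rightarrow> (nat \<Rightarrow> nat) \<times> nat set \<Rightarrow> (nat \<Rightarrow> real) \<Rightarrow> bool" where
  "near k r c x \<longleftrightarrow> (\<forall>i<k. real (fst c i) - r < x i \<and> x i < real (cell_top c i) + r)"

text \<open>A product of tent functions whose positivity set is the open neighbourhood
  \<open>near k r c\<close>. Sums of these serve as unnormalised weights in the join.\<close>

definition weight :: "nat \<Rightarrow> real \<Rightarrow> (nat \<Rightarrow> nat) \<times> nat set \<Rightarrow> (nat \<Rightarrow> real) \<Rightarrow> real" where
  "weight k r c x =
     (\<Prod>i<k. max 0 (min (x i - (real (fst c i) - r)) (real (cell_top c i) + r - x i)))"

lemma weight_nonneg: "0 \<le> weight k r c x"
  unfolding weight_def by (intro prod_nonneg) simp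

lemma weight_pos_iff: "0 < weight k r c x \<longleftrightarrow> near k r c x"
  unfolding weight_def near_def by (subst prod_pos_iff) (auto simp: less_max_iff_disj)

lemma continuous_on_weight [continuous_intros]: "continuous_on S (weight k r c)"
  unfolding weight_def[abs_def] by (intro continuous_intros)

lemma near_if_mem_cell: "x \<in> cell c \<Longrightarrow> 0 < r \<Longrightarrow> near k r c x"
  unfolding near_def mem_cell
proof (intro allI impI)
  fix i assume "\<forall>i. if i \<in> snd c then real (fst c i) \<le> x i \<and> x i \<le> real (fst c i) + 1
    else x i = real (fst c i)" "0 < r"
  from spec[OF this(1), of i] this(2)
  show "real (fst c i) - r < x i \<and> x i < real (cell_top c i) + r"
    by (auto simp: cell_top_def split: if_splits)
qed

text \<open>\<open>squeeze\<close> is monotone and constant on the 3/8-neighbourhood of each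
  integer, so in each coordinate only the two ends of the enlarged interval matter.\<close>

lemma squeeze_near_cell:
  assumes c: "cell c \<subseteq> grid_cube k N" and n: "near k (3/8) c x"
    and x: "x \<in> grid_cube k N"
  shows "(\<lambda>i. squeeze N (x i)) \<in> cell c"
  unfolding mem_cell
proof
  fix i
  note c' = c[unfolded cell_subset_grid_box_iff, THEN spec[of _ i]]
  show "if i \<in> snd c then real (fst c i) \<le> squeeze N (x i) \<and> squeeze N (x i) \<le> real (fst c i) + 1
        else squeeze N (x i) = real (fst c i)"
  proof (cases "i < k")
    case False
    then have "x i = 0" "fst c i = 0" "i \<notin> snd c" using x c' by (auto simp: grid_box_def)
    then show ?thesis using squeeze_near[of 0 N 0] by simp
  next
    case True
    then have b: "real (fst c i) - 3/8 \<le> x i" "x i \<le> real (cell_top c i) + 3/8"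
      using n by (auto simp: near_def less_imp_le)
    have f: "fst c i \<le> N" "cell_top c i \<le> N" using c' True by (auto simp: cell_top_def)
    have "real (fst c i) \<le> squeeze N (x i)"
      using squeeze_mono[OF b(1), of N] squeeze_near[OF f(1), of "real (fst c i) - 3/8"] by simp
    moreover have "squeeze N (x i) \<le> real (cell_top c i)"
      using squeeze_mono[OF b(2), of N] squeeze_near[OF f(2), of "real (cell_top c i) + 3/8"] by simp
    ultimately show ?thesis by (auto simp: cell_top_def split: if_splits)
  qed
qed

lemma halve_near_cell:
  assumes c: "cell c \<subseteq> grid_cube k N" and n: "near k (1/8) c x"
    and x: "x \<in> grid_cube k N"
  shows "(\<lambda>i. halve N (x i) / 2) \<in> cell c"
  unfolding mem_cell
proof
  fix i
  note c' = c[unfolded cell_subset_grid_box_iff, THEN spec[of _ i]]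
  show "if i \<in> snd c then real (fst c i) \<le> halve N (x i) / 2 \<and> halve N (x i) / 2 \<le> real (fst c i) + 1
        else halve N (x i) / 2 = real (fst c i)"
  proof (cases "i < k")
    case False
    then have "x i = 0" "fst c i = 0" "i \<notin> snd c" using x c' by (auto simp: grid_box_def)
    then show ?thesis using halve_near[of 0 N 0] by simp
  next
    case True
    then have b: "real (fst c i) - 1/8 \<le> x i" "x i \<le> real (cell_top c i) + 1/8"
      using n by (auto simp: near_def less_imp_le)
    have f: "fst c i \<le> N" "cell_top c i \<le> N" using c' True by (auto simp: cell_top_def)
    have "2 * real (fst c i) \<le> halve N (x i)"
      using halve_mono[OF b(1), of N] halve_near[OF f(1), of "real (fst c i) - 1/8"] by simp
    moreover have "halve N (x i) \<le> 2 * real (cell_top c i)"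
      using halve_mono[OF b(2), of N] halve_near[OF f(2), of "real (cell_top c i) + 1/8"] by simp
    ultimately show ?thesis by (auto simp: cell_top_def split: if_splits)
  qed
qed

text \<open>Where \<open>bump\<close> vanishes, a coordinate is at least 1/4 away from every
  half-integer of the range, hence within 1/4 of an integer, and is rounded to it at a cost below
  3/8. The coordinates left free have positive \<open>bump\<close>, so there are fewer than
  \<open>b\<close> of them.\<close>

lemma near_small_face_or_many_bumps:
  assumes x: "x \<in> grid_cube k N" and few: "card {i\<in>{..<k}. 0 < bump N (x i)} < b"
  obtains c where "cell c \<subseteq> cell (carrier_cell x)" "card (snd c) < b" "near k (3/8) c x"
proof -
  let ?c = "carrier_cell x"
  define D where "D = {i \<in> snd ?c. 0 < bump N (x i)}"
  \<comment> \<open>A coordinate to be rounded is at most 1/4 or at least 3/4 above its floor; the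
    threshold 3/8 separates the two cases.\<close>
  define f where "f = (\<lambda>i. if i \<in> snd ?c - D \<and> real (fst ?c i) + 3/8 \<le> x i then Suc (fst ?c i) else fst ?c i)"
  have sub: "cell ?c \<subseteq> grid_cube k N" using carrier_cell_grid_box[OF x] by simp
  note R = sub[unfolded cell_subset_grid_box_iff, THEN spec]
  have x0: "0 \<le> x i" for i
    using x[unfolded mem_grid_cube, THEN spec[of _ i]] by (auto split: if_splits)
  note bd = carrier_cell_bounds[OF x0]
  have Dk: "D \<subseteq> {i\<in>{..<k}. 0 < bump N (x i)}" using R by (auto simp: D_def)
  show ?thesis
  proof
    show "card (snd (f, D)) < b"
      using card_mono[OF _ Dk] few by simp
    show "cell (f, D) \<subseteq> cell ?c"
    proof
      fix y assume y: "y \<in> cell (f, D)"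
      have "if i \<in> snd ?c then real (fst ?c i) \<le> y i \<and> y i \<le> real (fst ?c i) + 1 else y i = real (fst ?c i)" for i
        using y[unfolded mem_cell, THEN spec[of _ i]] by (auto simp: f_def D_def split: if_splits)
      then show "y \<in> cell ?c" unfolding mem_cell by blast
    qed
    show "near k (3/8) (f, D) x"
      unfolding near_def
    proof (intro allI impI)
      fix i assume i: "i < k"
      show "real (fst (f, D) i) - 3/8 < x i \<and> x i < real (cell_top (f, D) i) + 3/8"
      proof (cases "i \<in> snd ?c")
        case False
        then show ?thesis using bd(2)[OF False] by (auto simp: f_def D_def cell_top_def)
      next
        case True
        note b1 = bd(1)[OF True]
        show ?thesis
        proof (cases "i \<in> D")
          case True
          then show ?thesis using b1 by (auto simp: f_def cell_top_def)
        next
          case False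
          then have "\<not> 0 < bump N (x i)" using \<open>i \<in> snd ?c\<close> by (simp add: D_def)
          moreover have "fst ?c i < N" using R[of i] True by simp
          ultimately have m: "\<not> \<bar>x i - real (fst ?c i) - 1/2\<bar> < 1/4" unfolding bump_pos_iff by blast
          show ?thesis
          proof (cases "real (fst ?c i) + 3/8 \<le> x i")
            case True
            then have "real (fst ?c i) + 3/4 \<le> x i" using m by linarith
            then show ?thesis using True \<open>i \<in> snd ?c\<close> False b1 by (simp add: f_def cell_top_def)
          next
            case f: False
            then show ?thesis using \<open>i \<in> snd ?c\<close> False b1 by (simp add: f_def cell_top_def)
          qed
        qed
      qed
    qed
  qed
qed

text \<open>On the support of \<open>bump\<close> the function \<open>halve\<close> is locally
  constant with odd values. This is what places the image of a point with \<open>b\<close> such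
  coordinates in the dual skeleton.\<close>

lemma halve_odd:
  assumes "0 < bump N (x i)"
  shows "i \<notin> snd (carrier_cell (\<lambda>i. halve N (x i)))" "odd (fst (carrier_cell (\<lambda>i. halve N (x i))) i)"
proof -
  obtain f where f: "f < N" "\<bar>x i - real f - 1/2\<bar> < 1/4" using assms bump_pos_iff by blast
  then have "halve N (x i) = real (2 * f + 1)" using halve_middle[of f N "x i"] by simp
  then show "i \<notin> snd (carrier_cell (\<lambda>i. halve N (x i)))" "odd (fst (carrier_cell (\<lambda>i. halve N (x i))) i)"
    unfolding carrier_cell_def fst_conv snd_conv by (auto simp del: of_nat_Suc)
qed

lemma halve_grid_box:
  assumes "x \<in> grid_cube k N"
  shows "(\<lambda>i. halve N (x i)) \<in> grid_cube k (2 * N)"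
  unfolding mem_grid_cube
proof
  fix i
  have "halve N 0 = 0" "halve N (real N) = 2 * real N" using halve_near[of 0 N 0] halve_near[of N N "real N"] by simp_all
  moreover note assms[unfolded mem_grid_cube, THEN spec[of _ i]]
  ultimately show "if i < k then 0 \<le> halve N (x i) \<and> halve N (x i) \<le> real (2 * N) else halve N (x i) = 0"
    using halve_mono[of 0 "x i" N] halve_mono[of "x i" "real N" N] by (auto split: if_splits)
qed

text \<open>The grid of half-units subdivides the integer grid, so a small cell with a relatively
  interior point in \<open>c\<close> lies in \<open>c\<close> entirely.\<close>

lemma carrier_cell_half:
  assumes y: "(\<lambda>i. y i / 2) \<in> cell c" and z: "z \<in> cell (carrier_cell y)"
  shows "(\<lambda>i. z i / 2) \<in> cell c"
  unfolding mem_cell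
proof
  fix i
  note yi = y[unfolded mem_cell, THEN spec[of _ i]] and zi = z[unfolded mem_cell, THEN spec[of _ i]]
  have y0: "0 \<le> y i"
    using yi by (auto split: if_splits intro: order_trans[OF of_nat_0_le_iff])
  note bd = carrier_cell_bounds[of y i, OF y0]
  show "if i \<in> snd c then real (fst c i) \<le> z i / 2 \<and> z i / 2 \<le> real (fst c i) + 1 else z i / 2 = real (fst c i)"
  proof (cases "i \<in> snd (carrier_cell y)")
    case False
    then have "z i = y i" using bd(2) zi by simp
    with yi show ?thesis by (simp only:)
  next
    case True
    note b1 = bd(1)[OF True]
    define m where "m = fst (carrier_cell y) i"
    have ic: "i \<in> snd c"
    proof (rule ccontr)
      assume "i \<notin> snd c"
      then have "y i = real (2 * fst c i)" using yi by simp
      then show False using True by (auto simp: carrier_cell_def)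
    qed
    then have "real (2 * fst c i) \<le> y i" "y i \<le> real (2 * fst c i + 2)" using yi by simp_all
    with b1 have "real (2 * fst c i) < real (m + 1)" "real m < real (2 * fst c i + 2)" by (simp_all add: m_def)
    then have "2 * fst c i \<le> m" "m + 1 \<le> 2 * fst c i + 2" unfolding of_nat_less_iff by simp_all
    then have "real (2 * fst c i) \<le> real m" "real (m + 1) \<le> real (2 * fst c i + 2)" unfolding of_nat_le_iff .
    moreover have "real m \<le> z i" "z i \<le> real m + 1" using zi True by (simp_all add: m_def)
    ultimately show ?thesis using ic by simp
  qed
qed

lemma face_closed_small: "face_closed {c. cell c \<subseteq> grid_cube k N \<and> card (snd c) < b}"
  unfolding face_closed_def
proof (intro ballI allI impI)
  fix c c' :: "(nat \<Rightarrow> nat) \<times> nat set"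
  assume c: "c \<in> {c. cell c \<subseteq> grid_cube k N \<and> card (snd c) < b}" and sub: "cell c' \<subseteq> cell c"
  have "snd c \<subseteq> {..<k}" using c by (auto simp: cell_subset_grid_box_iff)
  then have "finite (snd c)" using finite_subset by blast
  moreover have "snd c' \<subseteq> snd c" using cell_subset_cases[OF sub] by auto
  ultimately have "card (snd c') \<le> card (snd c)" by (rule card_mono)
  with c sub show "c' \<in> {c. cell c \<subseteq> grid_cube k N \<and> card (snd c) < b}" by auto
qed

lemma cell_face_fixed:
  assumes "cell c' \<subseteq> cell c" "i \<notin> snd c"
  shows "i \<notin> snd c'" "fst c' i = fst c i"
proof -
  have "(\<lambda>i. real (fst c' i)) \<in> cell c'" by (simp add: mem_cell)
  then have "(\<lambda>i. real (fst c' i)) \<in> cell c" using assms(1) by blast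
  from this[unfolded mem_cell, THEN spec[of _ i]] assms(2) show "fst c' i = fst c i" by simp
  show "i \<notin> snd c'" using cell_subset_cases[OF assms(1)] assms(2) by auto
qed

text \<open>In half-units the odd integers are the midpoints of edges. These cells have at least
  \<open>b\<close> coordinates pinned to midpoints, whereas a point of an integer cell of dimension
  below \<open>b\<close> has fewer than \<open>b\<close> nonintegral coordinates: they form the dual
  skeleton, of codimension \<open>b\<close>.\<close>

definition dual_cells :: "nat \<Rightarrow> nat \<Rightarrow> nat \<Rightarrow> ((nat \<Rightarrow> nat) \<times> nat set) set" where
  "dual_cells k N b = {c. cell c \<subseteq> grid_cube k N \<and>
     (\<exists>D\<subseteq>{..<k}. card D = b \<and> (\<forall>i\<in>D. i \<notin> snd c \<and> odd (fst c i)))}"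

lemma face_closed_dual_cells: "face_closed (dual_cells k N b)"
  unfolding face_closed_def
proof (intro ballI allI impI)
  fix c c' :: "(nat \<Rightarrow> nat) \<times> nat set"
  assume c: "c \<in> dual_cells k N b" and sub: "cell c' \<subseteq> cell c"
  obtain D where D: "D \<subseteq> {..<k}" "card D = b" "\<And>i. i \<in> D \<Longrightarrow> i \<notin> snd c \<and> odd (fst c i)"
    using c unfolding dual_cells_def by blast
  have "i \<notin> snd c' \<and> odd (fst c' i)" if "i \<in> D" for i
    using cell_face_fixed[OF sub, of i] D(3)[OF that] by simp
  with D(1,2) c sub show "c' \<in> dual_cells k N b"
    unfolding dual_cells_def by blast
qed

lemma finite_dual_cells: "finite (dual_cells k N b)"
  by (rule finite_subset[OF _ finite_cells_subset_grid_box[of k N]]) (auto simp: dual_cells_def)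

lemma card_dual_cell:
  assumes "c \<in> dual_cells k N b"
  shows "card (snd c) + b \<le> k" "finite (snd c)"
proof -
  obtain D where D: "D \<subseteq> {..<k}" "card D = b" "D \<inter> snd c = {}"
    using assms unfolding dual_cells_def by blast
  have s: "snd c \<subseteq> {..<k}" using assms by (auto simp: dual_cells_def cell_subset_grid_box_iff)
  then show fin: "finite (snd c)" using finite_subset by blast
  have "card (D \<union> snd c) = card D + card (snd c)"
    by (rule card_Un_disjoint) (use D fin finite_subset in auto)
  moreover have "card (D \<union> snd c) \<le> card {..<k}" by (rule card_mono) (use D s in auto)
  ultimately show "card (snd c) + b \<le> k" using D(2) by simp
qed

text \<open>Nothing is known about \<open>g\<close> outside \<open>Z\<close>, but \<open>Z\<close>
  and the zero set of \<open>w\<close> are closed in \<open>S\<close> and cover it, and the product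
  vanishes on the second.\<close>

lemma continuous_on_weighted:
  fixes w g :: "(nat \<Rightarrow> real) \<Rightarrow> real"
  assumes w: "continuous_on S w" and g: "continuous_on Z g" and Z: "closed Z" "Z \<subseteq> S"
    and supp: "\<And>x. x \<in> S \<Longrightarrow> x \<notin> Z \<Longrightarrow> w x = 0"
  shows "continuous_on S (\<lambda>x. w x * g x)"
proof -
  have "continuous_map (top_of_set S) euclideanreal (\<lambda>x. if x \<in> Z then w x * g x else 0)"
  proof (rule continuous_map_closed_cases[where B = "{x \<in> S. w x \<in> {0}}"])
    show "closedin (top_of_set S) Z" using Z by (simp add: closed_subset)
    show "closedin (top_of_set S) {x \<in> S. w x \<in> {0}}"
      using w closedin_continuous_map_preimage[of "top_of_set S" euclideanreal w "{0}"] by simp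
    show "continuous_map (subtopology (top_of_set S) Z) euclideanreal (\<lambda>x. w x * g x)"
      using Z(2) continuous_on_subset[OF w Z(2)] g
      by (simp add: subtopology_subtopology Int_absorb1 continuous_on_mult)
  qed (use supp in auto)
  moreover have "(if x \<in> Z then w x * g x else 0) = w x * g x" if "x \<in> S" for x
    using supp[OF that] by simp
  ultimately have "continuous_map (top_of_set S) euclideanreal (\<lambda>x. w x * g x)"
    by (rule continuous_map_eq) simp
  then show ?thesis by simp
qed

section \<open>Connectivity of joins\<close>

lemma homotopic_with_top_of_set:
  assumes "continuous_map (top_of_set ({0..1} \<times> K)) P h" "\<And>x. h (0::real, x) = f x" "\<And>x. h (1, x) = g x"
  shows "homotopic_with (\<lambda>_. True) (top_of_set K) P f g"
  unfolding homotopic_with_def using assms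
  by (intro exI[of _ h]) (simp add: prod_topology_subtopology_eu)

lemma continuous_map_join_snoc:
  assumes "\<And>x i. \<lbrakk>x \<in> Z; i < n\<rbrakk> \<Longrightarrow> 0 \<le> fst (r x i)" "\<And>x. x \<in> Z \<Longrightarrow> 0 \<le> fst (l x)"
    and "\<And>x. x \<in> Z \<Longrightarrow> (\<exists>i<n. 0 < fst (r x i)) \<or> 0 < fst (l x)"
    and "\<And>i. i < n \<Longrightarrow> continuous_on Z (\<lambda>x. fst (r x i))" "continuous_on Z (\<lambda>x. fst (l x))"
    and "\<And>i. i < n \<Longrightarrow> continuous_map (top_of_set {x \<in> Z. 0 < fst (r x i)}) P (\<lambda>x. snd (r x i))"
    and "continuous_map (top_of_set {x \<in> Z. 0 < fst (l x)}) P (\<lambda>x. snd (l x))"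
  shows "continuous_map (top_of_set Z) (join_space (Suc n) P) (\<lambda>x i. if i < n then r x i else l x)"
  unfolding continuous_map_join_on
proof (intro conjI ballI allI impI)
  fix x i assume "x \<in> Z" "i < Suc n"
  then show "0 \<le> fst (if i < n then r x i else l x)" using assms(1,2) by simp
next
  fix x assume "x \<in> Z"
  from assms(3)[OF this] show "\<exists>i<Suc n. 0 < fst (if i < n then r x i else l x)"
    by (auto intro: exI[of _ n] simp: less_Suc_eq)
next
  fix i assume "i < Suc n"
  then show "continuous_on Z (\<lambda>x. fst (if i < n then r x i else l x))"
    "continuous_map (top_of_set {x \<in> Z. 0 < fst (if i < n then r x i else l x)}) P
       (\<lambda>x. snd (if i < n then r x i else l x))"
    using assms(4-7) by (cases "i < n"; simp)+
qed

text \<open>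
  The map \<open>u\<close> is deformed to one that extends over the cube. Its first \<open>n\<close> coordinates extend to all
  cells of dimension less than \<open>b\<close>, its last coordinate to the dual skeleton, which meets no such
  cell and consists of cells of dimension at most \<open>k - b < a\<close>. Pulling back along
  \<open>squeeze\<close> and \<open>halve\<close> spreads the two extensions to neighbourhoods that together cover the cube.
\<close>

lemma join_nullhomotopic_on_grid:
  fixes u :: "(nat \<Rightarrow> real) \<Rightarrow> nat \<Rightarrow> real \<times> 'p" and P :: "'p topology"
  defines "Q \<equiv> \<lambda>k N. grid_cube k N" and "K \<equiv> \<lambda>k N. grid_boundary (\<lambda>_. 0) {..<k} (real N)"
  assumes ext: "\<And>j. j < a \<Longrightarrow> extensible j P" "\<And>j. j < b \<Longrightarrow> extensible j (join_space n P)"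
    and k: "k < a + b"
    and u: "continuous_map (top_of_set (K k N)) (join_space (Suc n) P) u"
    and cells: "\<And>c. cell c \<subseteq> K k N \<Longrightarrow>
      (\<forall>x\<in>cell c. \<exists>i<n. 0 < fst (u x i)) \<or> (\<forall>x\<in>cell c. 0 < fst (u x n))"
  shows "\<exists>p\<in>topspace (join_space (Suc n) P).
    homotopic_with (\<lambda>_. True) (top_of_set (K k N)) (join_space (Suc n) P) u (\<lambda>_. p)"
proof -
  let ?Q = "Q k N" and ?K = "K k N"
  let ?hom = "homotopic_with (\<lambda>_. True) (top_of_set ?K) (join_space (Suc n) P)"
  have KQ: "?K \<subseteq> ?Q" by (auto simp: K_def Q_def grid_boundary_def)
  note U = u[unfolded continuous_map_join_on]
  \<comment> \<open>\<open>A\<close> collects the boundary cells on which the last weight is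
    positive, \<open>B\<close> those on which the first \<open>n\<close> coordinates by themselves
    form a point of the \<open>n\<close>-fold join. By assumption every boundary cell is of one of
    these kinds.\<close>
  define A where "A = {c. cell c \<subseteq> ?K \<and> (\<forall>x\<in>cell c. 0 < fst (u x n))}"
  define B where "B = {c. cell c \<subseteq> ?K \<and> (\<forall>x\<in>cell c. \<exists>i<n. 0 < fst (u x i))}"
  define Sm where "Sm = {c. cell c \<subseteq> ?Q \<and> card (snd c) < b}"
  define S where "S = B \<union> Sm"
  define C2 where "C2 = dual_cells k (2 * N) b"
  \<comment> \<open>The cells of the dual skeleton that fall into a cell of \<open>A\<close> after
    halving: there the last fibre coordinate of \<open>u\<close> is defined and prescribes the
    extension \<open>p\<close>.\<close>
  define L2 where "L2 = {c \<in> C2. \<exists>c'\<in>A. \<forall>y\<in>cell c. (\<lambda>i. y i / 2) \<in> cell c'}"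
  define UA where "UA = \<Union>(cell ` A)"
  define UB where "UB = \<Union>(cell ` B)"
  define US where "US = \<Union>(cell ` S)"
  have GQ: "finite {c. cell c \<subseteq> ?Q}" unfolding Q_def by (rule finite_cells_subset_grid_box)
  have finA: "finite A" by (rule finite_subset[OF _ GQ]) (use KQ in \<open>auto simp: A_def\<close>)
  have finB: "finite B" by (rule finite_subset[OF _ GQ]) (use KQ in \<open>auto simp: B_def\<close>)
  have finS: "finite S" unfolding S_def using finB by (auto simp: Sm_def intro: finite_subset[OF _ GQ])
  have AQ: "cell c \<subseteq> ?Q" if "c \<in> A" for c using that KQ by (auto simp: A_def)
  have SQ: "cell c \<subseteq> ?Q" if "c \<in> S" for c using that KQ by (auto simp: S_def B_def Sm_def)
  have AB: "c \<in> A \<or> c \<in> B" if "cell c \<subseteq> ?K" for c using cells[OF that] that by (auto simp: A_def B_def)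
  have finsnd: "finite (snd c)" if "cell c \<subseteq> ?Q" for c
  proof -
    have "snd c \<subseteq> {..<k}" using that unfolding Q_def cell_subset_grid_box_iff by auto
    then show ?thesis using finite_subset by blast
  qed
  have UAK: "UA \<subseteq> ?K" and UBK: "UB \<subseteq> ?K" by (auto simp: UA_def A_def UB_def B_def)
  have closed: "closed UA" "closed UB" "closed US"
    unfolding UA_def UB_def US_def using finA finB finS by (auto intro!: closed_Union closed_cell)

  have fcB: "face_closed B" unfolding face_closed_def B_def by blast
  have fcSm: "face_closed Sm" unfolding Sm_def Q_def by (rule face_closed_small)
  have fcS: "face_closed S" using fcB fcSm unfolding face_closed_def S_def by blast
  have uB: "continuous_map (top_of_set UB) (join_space n P) u"
    unfolding continuous_map_join_on
  proof (intro conjI ballI allI impI)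
    fix x assume x: "x \<in> UB"
    then have xK: "x \<in> ?K" using UBK by blast
    show "0 \<le> fst (u x i)" if "i < n" for i using U xK that by simp
    show "\<exists>i<n. 0 < fst (u x i)" using x by (auto simp: UB_def B_def)
  next
    fix i assume i: "i < n"
    then have U': "continuous_on ?K (\<lambda>x. fst (u x i))"
      "continuous_map (top_of_set {x \<in> ?K. 0 < fst (u x i)}) P (\<lambda>x. snd (u x i))"
      using U by simp_all
    show "continuous_on UB (\<lambda>x. fst (u x i))" by (rule continuous_on_subset[OF U'(1) UBK])
    show "continuous_map (top_of_set {x \<in> UB. 0 < fst (u x i)}) P (\<lambda>x. snd (u x i))"
      by (rule continuous_map_from_subtopology_mono[OF U'(2)]) (use UBK in auto)
  qed
  have "\<exists>e. continuous_map (top_of_set (\<Union>(cell ` S))) (join_space n P) e \<and> (\<forall>x\<in>\<Union>(cell ` B). e x = u x)"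
  proof (rule extend_over_cells[OF finS _ fcS fcB])
    show "B \<subseteq> S" by (simp add: S_def)
    show "finite (snd c)" if "c \<in> S" for c using finsnd SQ that by blast
    show "extensible (card (snd c)) (join_space n P)" if "c \<in> S - B" for c
      using that by (intro ext(2)) (auto simp: S_def Sm_def)
    show "continuous_map (top_of_set (\<Union>(cell ` B))) (join_space n P) u" using uB by (simp add: UB_def)
  qed
  then obtain e where e: "continuous_map (top_of_set US) (join_space n P) e" and eu: "\<And>x. x \<in> UB \<Longrightarrow> e x = u x"
    unfolding US_def UB_def by blast
  note E = e[unfolded continuous_map_join_on]

  have uA: "continuous_map (top_of_set UA) P (\<lambda>x. snd (u x n))"
  proof (rule continuous_map_from_subtopology_mono)
    show "continuous_map (top_of_set {x \<in> ?K. 0 < fst (u x n)}) P (\<lambda>x. snd (u x n))"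
      using U by simp
    show "UA \<subseteq> {x \<in> ?K. 0 < fst (u x n)}" using UAK by (auto simp: UA_def A_def)
  qed
  have fcC2: "face_closed C2" unfolding C2_def by (rule face_closed_dual_cells)
  have fcL2: "face_closed L2" using fcC2 unfolding face_closed_def L2_def by blast
  have "\<exists>p. continuous_map (top_of_set (\<Union>(cell ` C2))) P p \<and>
      (\<forall>y\<in>\<Union>(cell ` L2). p y = snd (u (\<lambda>i. y i / 2) n))"
  proof (rule extend_over_cells[OF _ _ fcC2 fcL2])
    show "finite C2" unfolding C2_def by (rule finite_dual_cells)
    show "L2 \<subseteq> C2" by (auto simp: L2_def)
    show "finite (snd c)" if "c \<in> C2" for c using card_dual_cell(2) that unfolding C2_def by blast
    show "extensible (card (snd c)) P" if "c \<in> C2 - L2" for c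
      using card_dual_cell(1)[of c k "2 * N" b] that k by (intro ext(1)) (simp add: C2_def)
    show "continuous_map (top_of_set (\<Union>(cell ` L2))) P (\<lambda>y. snd (u (\<lambda>i. y i / 2) n))"
    proof (rule continuous_map_compose_on[OF uA])
      show "continuous_on (\<Union>(cell ` L2)) (\<lambda>y i. y i / 2)"
        by (intro continuous_on_coordinatewise_then_product continuous_intros) simp
      show "(\<lambda>y i. y i / 2) ` \<Union>(cell ` L2) \<subseteq> UA" by (auto simp: L2_def UA_def)
    qed
  qed
  then obtain p where p: "continuous_map (top_of_set (\<Union>(cell ` C2))) P p"
    and pu: "\<And>y. y \<in> \<Union>(cell ` L2) \<Longrightarrow> p y = snd (u (\<lambda>i. y i / 2) n)"
    by blast

  define R where "R = (\<lambda>(x::nat \<Rightarrow> real) i. squeeze N (x i))"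
  define H where "H = (\<lambda>(x::nat \<Rightarrow> real) i. halve N (x i))"
  have Rc: "continuous_on Z R" for Z
    unfolding R_def by (intro continuous_on_coordinatewise_then_product continuous_intros)
  have Hc: "continuous_on Z H" for Z
    unfolding H_def by (intro continuous_on_coordinatewise_then_product continuous_intros)
  have Rcell: "R x \<in> cell c" if "cell c \<subseteq> ?Q" "near k (3/8) c x" "x \<in> ?Q" for x c
    using that squeeze_near_cell[of c k N x] unfolding Q_def R_def by blast
  have Hcell: "(\<lambda>i. H x i / 2) \<in> cell c" if "cell c \<subseteq> ?Q" "near k (1/8) c x" "x \<in> ?Q" for x c
    using that halve_near_cell[of c k N x] unfolding Q_def H_def by blast
  have car: "cell (carrier_cell x) \<subseteq> ?K" "x \<in> cell (carrier_cell x)" if "x \<in> ?K" for x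
    using that carrier_cell_grid_box[of x k N] KQ unfolding Q_def K_def by blast+
  have nearcar: "near k r (carrier_cell x) x" if "x \<in> ?K" "0 < r" for x r
    using near_if_mem_cell car(2)[OF that(1)] that(2) by blast
  have RK: "R x \<in> ?K" if "x \<in> ?K" for x
  proof -
    have "R x \<in> cell (carrier_cell x)"
      by (rule Rcell) (use car[OF that] KQ nearcar[OF that] that in auto)
    then show ?thesis using car(1)[OF that] by blast
  qed
  \<comment> \<open>Each weight is positive only where the fibre coordinate it goes with is defined.
    On the cube, positivity of \<open>\<chi>B\<close>, \<open>\<chi>S\<close> or
    \<open>\<chi>A\<close> puts \<open>R x\<close> in the corresponding union of cells; positivity
    of \<open>\<omega>\<close> means that \<open>b\<close> coordinates are near half-integers and
    puts \<open>H x\<close> in the dual skeleton. The radius 1/8 for \<open>A\<close> suits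
    \<open>R\<close> and \<open>H\<close> alike, since both collapse neighbourhoods of that
    size.\<close>
  define \<chi>B where "\<chi>B = (\<lambda>x. \<Sum>c\<in>B. weight k (3/8) c x)"
  define \<chi>S where "\<chi>S = (\<lambda>x. \<Sum>c\<in>S. weight k (3/8) c x)"
  define \<chi>A where "\<chi>A = (\<lambda>x. \<Sum>c\<in>A. weight k (1/8) c x)"
  define \<omega> where "\<omega> = (\<lambda>x. \<Sum>D\<in>{D. D \<subseteq> {..<k} \<and> card D = b}. \<Prod>i\<in>D. bump N (x i))"
  have bump0: "0 \<le> bump N t" for t unfolding bump_def by (intro sum_nonneg) simp
  have fin\<omega>: "finite {D. D \<subseteq> {..<k} \<and> card D = b}" by (rule finite_subset[of _ "Pow {..<k}"]) auto
  have \<chi>c: "continuous_on Z \<chi>B" "continuous_on Z \<chi>S" "continuous_on Z \<chi>A" "continuous_on Z \<omega>" for Z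
    unfolding \<chi>B_def \<chi>S_def \<chi>A_def \<omega>_def by (intro continuous_intros)+
  have \<chi>0: "0 \<le> \<chi>B x" "0 \<le> \<chi>S x" "0 \<le> \<chi>A x" "0 \<le> \<omega> x" for x
    unfolding \<chi>B_def \<chi>S_def \<chi>A_def \<omega>_def by (intro sum_nonneg prod_nonneg weight_nonneg bump0)+
  have \<chi>Bp: "0 < \<chi>B x \<longleftrightarrow> (\<exists>c\<in>B. near k (3/8) c x)" for x
    unfolding \<chi>B_def by (subst sum_pos_iff[OF finB]) (auto simp: weight_nonneg weight_pos_iff)
  have \<chi>Sp: "0 < \<chi>S x \<longleftrightarrow> (\<exists>c\<in>S. near k (3/8) c x)" for x
    unfolding \<chi>S_def by (subst sum_pos_iff[OF finS]) (auto simp: weight_nonneg weight_pos_iff)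
  have \<chi>Ap: "0 < \<chi>A x \<longleftrightarrow> (\<exists>c\<in>A. near k (1/8) c x)" for x
    unfolding \<chi>A_def by (subst sum_pos_iff[OF finA]) (auto simp: weight_nonneg weight_pos_iff)
  have \<omega>p: "0 < \<omega> x \<longleftrightarrow> (\<exists>D\<subseteq>{..<k}. card D = b \<and> (\<forall>i\<in>D. 0 < bump N (x i)))" for x
  proof -
    have "0 < (\<Prod>i\<in>D. bump N (x i)) \<longleftrightarrow> (\<forall>i\<in>D. 0 < bump N (x i))" if "D \<subseteq> {..<k}" for D
      by (rule prod_pos_iff) (use that finite_subset bump0 in auto)
    then show ?thesis
      unfolding \<omega>_def by (subst sum_pos_iff[OF fin\<omega>]) (auto intro: prod_nonneg bump0)
  qed
  have RA: "R x \<in> UA" "(\<lambda>i. H x i / 2) \<in> UA" if pos: "0 < \<chi>A x" and x: "x \<in> ?Q" for x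
  proof -
    obtain c where c: "c \<in> A" "near k (1/8) c x" using pos \<chi>Ap by blast
    moreover have "near k (3/8) c x" using c(2) unfolding near_def by force
    ultimately show "R x \<in> UA" "(\<lambda>i. H x i / 2) \<in> UA"
      using Rcell[of c x] Hcell[of c x] AQ[of c] x unfolding UA_def by blast+
  qed
  have RB: "R x \<in> UB" if "0 < \<chi>B x" "x \<in> ?Q" for x
    using that Rcell[of _ x] SQ unfolding \<chi>Bp UB_def S_def by blast
  have RS: "R x \<in> US" if "0 < \<chi>S x" "x \<in> ?Q" for x
    using that Rcell[of _ x] SQ unfolding \<chi>Sp US_def by blast
  have BS: "0 < \<chi>S x" if "0 < \<chi>B x" for x
    using that unfolding \<chi>Bp \<chi>Sp S_def by blast
  \<comment> \<open>Either \<open>b\<close> coordinates have positive \<open>bump\<close>, or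
    \<open>x\<close> is near a face of dimension below \<open>b\<close>, which belongs to
    \<open>Sm\<close>.\<close>
  have cover: "0 < \<omega> x \<or> 0 < \<chi>S x" if x: "x \<in> ?Q" for x
  proof (rule ccontr)
    assume neg: "\<not> ?thesis"
    let ?D = "{i\<in>{..<k}. 0 < bump N (x i)}"
    have "card ?D < b"
    proof (rule ccontr)
      assume "\<not> card ?D < b"
      then obtain D where "D \<subseteq> ?D" "card D = b" using obtain_subset_with_card_n[of b ?D] by auto
      then have "0 < \<omega> x" unfolding \<omega>p by (intro exI[of _ D]) auto
      then show False using neg by simp
    qed
    from near_small_face_or_many_bumps[OF x[unfolded Q_def] this]
    obtain c where c: "cell c \<subseteq> cell (carrier_cell x)" "card (snd c) < b" "near k (3/8) c x" .
    have "cell c \<subseteq> ?Q" using c(1) carrier_cell_grid_box(1)[OF x[unfolded Q_def]] unfolding Q_def by (rule subset_trans)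
    then have "c \<in> S" using c(2) by (simp add: S_def Sm_def)
    then show False using neg c(3) \<chi>Sp by blast
  qed
  have coverK: "0 < \<chi>B x \<or> 0 < \<chi>A x" if x: "x \<in> ?K" for x
    using AB[OF car(1)[OF x]] nearcar[OF x, of "3/8"] nearcar[OF x, of "1/8"] unfolding \<chi>Bp \<chi>Ap by auto

  \<comment> \<open>The factor \<open>\<chi>S x\<close> vanishes wherever \<open>R x\<close> is
    outside \<open>US\<close>, the domain of \<open>e\<close>.\<close>
  define rest where "rest = (\<lambda>x i. (\<chi>S x * fst (e (R x) i), snd (e (R x) i)))"
  have Qclosed: "closed ?Q" unfolding Q_def by (rule closed_grid_box)
  have rest_c: "continuous_on ?Q (\<lambda>x. fst (rest x i))" if i: "i < n" for i
    unfolding rest_def fst_conv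
  proof (rule continuous_on_weighted[OF \<chi>c(2), where Z = "{x \<in> ?Q. R x \<in> US}"])
    have "continuous_on US (\<lambda>x. fst (e x i))" using E i by simp
    then show "continuous_on {x \<in> ?Q. R x \<in> US} (\<lambda>x. fst (e (R x) i))"
      by (rule continuous_on_compose2[OF _ Rc]) auto
    have "{x \<in> ?Q. R x \<in> US} = ?Q \<inter> R -` US" by auto
    moreover have "closed (R -` US)" using closed(3) Rc by (rule closed_vimage)
    ultimately show "closed {x \<in> ?Q. R x \<in> US}" using closed_Int[OF Qclosed] by metis
    show "\<chi>S x = 0" if "x \<in> ?Q" "x \<notin> {x \<in> ?Q. R x \<in> US}" for x
      using that RS[of x] \<chi>0(2)[of x] by (auto simp: less_le)
  qed auto
  have restD: "0 < \<chi>S x" "R x \<in> US" "0 < fst (e (R x) i)" if "0 < fst (rest x i)" "x \<in> ?Q" for x i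
  proof -
    have "0 < \<chi>S x * fst (e (R x) i)" using that(1) by (simp add: rest_def)
    then show "0 < \<chi>S x" "0 < fst (e (R x) i)"
      using \<chi>0(2)[of x] by (auto simp: zero_less_mult_iff)
    then show "R x \<in> US" using RS that(2) by blast
  qed
  have rest_s: "continuous_map (top_of_set {x \<in> ?Q. 0 < fst (rest x i)}) P (\<lambda>x. snd (rest x i))" if i: "i < n" for i
    unfolding rest_def snd_conv
  proof (rule continuous_map_compose_on[where g = "\<lambda>x. snd (e x i)" and \<phi> = R])
    show "continuous_map (top_of_set {x \<in> US. 0 < fst (e x i)}) P (\<lambda>x. snd (e x i))" using E i by simp
    show "R ` {x \<in> ?Q. 0 < fst (\<chi>S x * fst (e (R x) i), snd (e (R x) i))} \<subseteq> {x \<in> US. 0 < fst (e x i)}"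
      using restD unfolding rest_def by blast
  qed (rule Rc)
  have rest_nn: "0 \<le> fst (rest x i)" if "x \<in> ?Q" "i < n" for x i
  proof (cases "0 < \<chi>S x")
    case True
    then have "0 \<le> fst (e (R x) i)" using RS[OF True that(1)] E that(2) by simp
    then show ?thesis using \<chi>0(2)[of x] by (simp add: rest_def)
  next
    case False
    then have "\<chi>S x = 0" using \<chi>0(2)[of x] by simp
    then show ?thesis by (simp add: rest_def)
  qed
  have rest_pos: "\<exists>i<n. 0 < fst (rest x i)" if x: "x \<in> ?Q" and pos: "0 < \<chi>S x" for x
  proof -
    have "\<exists>i<n. 0 < fst (e (R x) i)" using conjunct1[OF E, THEN bspec, OF RS[OF pos x]] by simp
    then show ?thesis using pos by (auto simp: rest_def)
  qed
  have rest_cK: "continuous_on ?K (\<lambda>x. fst (rest x i))" if "i < n" for i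
    by (rule continuous_on_subset[OF rest_c[OF that] KQ])
  have rest_sK: "continuous_map (top_of_set {x \<in> ?K. 0 < fst (rest x i)}) P (\<lambda>x. snd (rest x i))" if "i < n" for i
    by (rule continuous_map_from_subtopology_mono[OF rest_s[OF that]]) (use KQ in auto)
  have UApos: "0 < fst (u x n)" if "x \<in> UA" for x using that by (auto simp: UA_def A_def)

  \<comment> \<open>The stages of the deformation. In \<open>v1\<close> the first \<open>n\<close>
    weights are cut down to where \<open>e\<close> agrees with \<open>u\<close>, so that
    \<open>v3\<close> may use \<open>e\<close> instead and shrink the last weight to the support of
    \<open>\<omega>\<close>. \<open>v4\<close> evaluates the last fibre coordinate at
    \<open>H x / 2\<close> in place of \<open>R x\<close>, where it is a value of \<open>p\<close>;
    \<open>v5\<close> then drops the factor \<open>\<chi>A\<close>, and all its data are defined on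
    the whole cube.\<close>
  define v1 where "v1 = (\<lambda>x i. if i < n then (\<chi>B x * fst (u (R x) i), snd (u (R x) i)) else u (R x) n)"
  define v3 where "v3 = (\<lambda>x i. if i < n then rest x i else (\<chi>A x * \<omega> x, snd (u (R x) n)))"
  define v4 where "v4 = (\<lambda>x i. if i < n then rest x i else (\<chi>A x * \<omega> x, snd (u (\<lambda>j. H x j / 2) n)))"
  define v5 where "v5 = (\<lambda>x i. if i < n then rest x i else (\<omega> x, p (H x)))"

  \<comment> \<open>The segment from \<open>x\<close> to \<open>R x\<close> stays in the carrier of
    \<open>x\<close>, hence in the boundary of the cube.\<close>
  have hom0: "?hom u (\<lambda>x. u (R x))"
  proof (rule homotopic_with_top_of_set[where h = "\<lambda>q. u (\<lambda>i. (1 - fst q) * snd q i + fst q * R (snd q) i)"])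
    show "continuous_map (top_of_set ({0..1} \<times> ?K)) (join_space (Suc n) P)
      (\<lambda>q. u (\<lambda>i. (1 - fst q) * snd q i + fst q * R (snd q) i))"
    proof (rule continuous_map_compose_on[OF u])
      show "continuous_on ({0..1} \<times> ?K) (\<lambda>q i. (1 - fst q) * snd q i + fst q * R (snd q) i)"
        by (intro continuous_on_coordinatewise_then_product continuous_intros
            continuous_on_compose2[OF continuous_on_coordinate continuous_on_snd]
            continuous_on_compose2[OF Rc continuous_on_snd, THEN continuous_on_compose2[OF continuous_on_coordinate]]) auto
      show "(\<lambda>q i. (1 - fst q) * snd q i + fst q * R (snd q) i) ` ({0..1} \<times> ?K) \<subseteq> ?K"
      proof safe
        fix t :: real and x assume tx: "t \<in> {0..1}" "x \<in> ?K"
        have "R x \<in> cell (carrier_cell x)"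
          by (rule Rcell) (use car[OF tx(2)] KQ nearcar[OF tx(2)] tx(2) in auto)
        from cell_convex[OF car(2)[OF tx(2)] this, of t]
        show "(\<lambda>i. (1 - fst (t, x)) * snd (t, x) i + fst (t, x) * R (snd (t, x)) i) \<in> ?K"
          using car(1)[OF tx(2)] tx(1) by auto
      qed
    qed
  qed simp_all

  have uR: "continuous_map (top_of_set ?K) (join_space (Suc n) P) (\<lambda>x. u (R x))"
    by (rule continuous_map_compose_on[OF u Rc]) (use RK in auto)
  note UR = uR[unfolded continuous_map_join_on]
  have v1: "continuous_map (top_of_set ?K) (join_space (Suc n) P) v1"
    unfolding v1_def
  proof (rule continuous_map_join_snoc)
    fix x assume x: "x \<in> ?K"
    show "(\<exists>i<n. 0 < fst (\<chi>B x * fst (u (R x) i), snd (u (R x) i))) \<or> 0 < fst (u (R x) n)"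
    proof (cases "0 < \<chi>B x")
      case True
      then have "R x \<in> UB" using RB x KQ by blast
      then obtain i where "i < n" "0 < fst (u (R x) i)" by (auto simp: UB_def B_def)
      then show ?thesis using True by auto
    next
      case False
      then have "R x \<in> UA" using coverK[OF x] RA(1)[of x] x KQ by blast
      then show ?thesis using UApos by blast
    qed
  next
    fix i assume i: "i < n"
    then have ui: "continuous_on ?K (\<lambda>x. fst (u (R x) i))" using UR by simp
    show "continuous_on ?K (\<lambda>x. fst (\<chi>B x * fst (u (R x) i), snd (u (R x) i)))"
      unfolding fst_conv by (intro continuous_on_mult \<chi>c ui)
    have us: "continuous_map (top_of_set {x \<in> ?K. 0 < fst (u (R x) i)}) P (\<lambda>x. snd (u (R x) i))"
      using UR i by simp
    show "continuous_map (top_of_set {x \<in> ?K. 0 < fst (\<chi>B x * fst (u (R x) i), snd (u (R x) i))}) P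
      (\<lambda>x. snd (\<chi>B x * fst (u (R x) i), snd (u (R x) i)))"
      unfolding snd_conv
      by (rule continuous_map_from_subtopology_mono[OF us]) (use \<chi>0(1) in \<open>auto simp: zero_less_mult_iff not_less[symmetric]\<close>)
  qed (use UR \<chi>0 in simp_all)

  have posK: "(\<exists>i<n. 0 < fst (rest x i)) \<or> 0 < \<chi>A x * \<omega> x" if x: "x \<in> ?K" for x
  proof (cases "0 < \<chi>S x")
    case True then show ?thesis using rest_pos x KQ by blast
  next
    case False
    then have "0 < \<omega> x" "0 < \<chi>A x" using cover[of x] coverK[OF x] BS x KQ by blast+
    then show ?thesis by simp
  qed
  have AwD: "0 < \<chi>A x" "0 < \<omega> x" if "0 < \<chi>A x * \<omega> x" for x
    using that \<chi>0(3)[of x] by (auto simp: zero_less_mult_iff)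
  \<comment> \<open>If \<open>\<chi>A x\<close> is positive, then \<open>R x\<close> and
    \<open>H x / 2\<close> lie in a common cell of \<open>A\<close>, and by convexity so does the
    segment between them.\<close>
  define h where "h = (\<lambda>q i. if i < n then rest (snd q) i
    else (\<chi>A (snd q) * \<omega> (snd q), snd (u (\<lambda>j. (1 - fst q) * R (snd q) j + fst q * (H (snd q) j / 2)) n)))"
  have "continuous_map (top_of_set ({0..1::real} \<times> ?K)) (join_space (Suc n) P) h"
    unfolding h_def
  proof (rule continuous_map_join_snoc)
    fix q :: "real \<times> (nat \<Rightarrow> real)" assume q: "q \<in> {0..1} \<times> ?K"
    show "0 \<le> fst (rest (snd q) i)" if "i < n" for i using rest_nn q KQ that by auto
    show "(\<exists>i<n. 0 < fst (rest (snd q) i)) \<or> 0 < fst (\<chi>A (snd q) * \<omega> (snd q),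
      snd (u (\<lambda>j. (1 - fst q) * R (snd q) j + fst q * (H (snd q) j / 2)) n))"
      using posK[of "snd q"] q by auto
  next
    fix i assume i: "i < n"
    show "continuous_on ({0..1::real} \<times> ?K) (\<lambda>q. fst (rest (snd q) i))"
      by (rule continuous_on_compose2[OF rest_cK[OF i] continuous_on_snd[OF continuous_on_id]]) auto
    show "continuous_map (top_of_set {q \<in> {0..1::real} \<times> ?K. 0 < fst (rest (snd q) i)}) P (\<lambda>q. snd (rest (snd q) i))"
      by (rule continuous_map_compose_on[OF rest_sK[OF i] continuous_on_snd[OF continuous_on_id]]) auto
  next
    show "continuous_on ({0..1::real} \<times> ?K) (\<lambda>q. fst (\<chi>A (snd q) * \<omega> (snd q),
        snd (u (\<lambda>j. (1 - fst q) * R (snd q) j + fst q * (H (snd q) j / 2)) n)))"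
      unfolding fst_conv
      by (intro continuous_on_mult continuous_on_compose2[OF \<chi>c(3) continuous_on_snd[OF continuous_on_id]]
          continuous_on_compose2[OF \<chi>c(4) continuous_on_snd[OF continuous_on_id]]) auto
    let ?Z = "{q \<in> {0..1::real} \<times> ?K. 0 < fst (\<chi>A (snd q) * \<omega> (snd q),
        snd (u (\<lambda>j. (1 - fst q) * R (snd q) j + fst q * (H (snd q) j / 2)) n))}"
    show "continuous_map (top_of_set ?Z) P (\<lambda>q. snd (\<chi>A (snd q) * \<omega> (snd q),
        snd (u (\<lambda>j. (1 - fst q) * R (snd q) j + fst q * (H (snd q) j / 2)) n)))"
      unfolding snd_conv
    proof (rule continuous_map_compose_on[OF uA])
      have 1: "continuous_on ?Z (\<lambda>q. R (snd q) j)" "continuous_on ?Z (\<lambda>q. H (snd q) j)" for j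
      proof -
        have "continuous_on ?Z (\<lambda>q. snd q j)"
          by (rule continuous_on_compose2[OF continuous_on_coordinate[of UNIV j] continuous_on_snd[OF continuous_on_id]]) simp
        then show "continuous_on ?Z (\<lambda>q. R (snd q) j)" "continuous_on ?Z (\<lambda>q. H (snd q) j)"
          unfolding R_def H_def by (rule continuous_on_squeeze continuous_on_halve)+
      qed
      show "continuous_on ?Z (\<lambda>q j. (1 - fst q) * R (snd q) j + fst q * (H (snd q) j / 2))"
        by (intro continuous_on_coordinatewise_then_product continuous_intros 1) auto
      show "(\<lambda>q j. (1 - fst q) * R (snd q) j + fst q * (H (snd q) j / 2)) ` ?Z \<subseteq> UA"
      proof safe
        fix t :: real and x assume tx: "t \<in> {0..1}" "x \<in> ?K" and pos: "0 < fst (\<chi>A (snd (t, x)) * \<omega> (snd (t, x)),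
          snd (u (\<lambda>j. (1 - fst (t, x)) * R (snd (t, x)) j + fst (t, x) * (H (snd (t, x)) j / 2)) n))"
        then have "0 < \<chi>A x" using AwD by simp
        then obtain c where c: "c \<in> A" "near k (1/8) c x" using \<chi>Ap by blast
        have xQ: "x \<in> ?Q" using tx(2) KQ by blast
        have "near k (3/8) c x" using c(2) unfolding near_def by force
        from cell_convex[OF Rcell[OF AQ[OF c(1)] this xQ] Hcell[OF AQ[OF c(1)] c(2) xQ], of t]
        show "(\<lambda>j. (1 - fst (t, x)) * R (snd (t, x)) j + fst (t, x) * (H (snd (t, x)) j / 2)) \<in> UA"
          using tx(1) c(1) by (auto simp: UA_def)
      qed
    qed
  qed (use \<chi>0 in simp_all)
  moreover have "h (0, x) = v3 x" "h (1, x) = v4 x" for x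
    by (simp_all add: h_def v3_def v4_def cong: if_cong)
  ultimately have hom34: "?hom v3 v4"
    by (rule homotopic_with_top_of_set)
  note v34 = homotopic_with_imp_continuous_maps[OF hom34]
  have hom13: "?hom v1 v3"
  proof (rule join_homotopic_linear[OF v1 conjunct1[OF v34]])
    fix x i assume x: "x \<in> topspace (top_of_set ?K)" and i: "i < Suc n" and pos: "0 < fst (v1 x i)" "0 < fst (v3 x i)"
    show "snd (v1 x i) = snd (v3 x i)"
    proof (cases "i < n")
      case True
      then have "0 < \<chi>B x * fst (u (R x) i)" using pos(1) by (simp add: v1_def)
      then have "0 < \<chi>B x" using \<chi>0(1)[of x] by (auto simp: zero_less_mult_iff)
      then have "e (R x) = u (R x)" using RB x KQ by (intro eu) auto
      then show ?thesis using True by (simp add: v1_def v3_def rest_def)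
    next
      case False then show ?thesis by (simp add: v1_def v3_def)
    qed
  qed
  have hom01: "?hom (\<lambda>x. u (R x)) v1"
  proof (rule join_homotopic_linear[OF uR v1])
    fix x i assume "i < Suc n"
    then have "\<not> i < n \<Longrightarrow> i = n" by simp
    then show "snd (u (R x) i) = snd (v1 x i)" by (cases "i < n") (simp_all add: v1_def)
  qed
  have HC2: "H x \<in> cell (carrier_cell (H x))" "carrier_cell (H x) \<in> C2" if x: "x \<in> ?Q" and pos: "0 < \<omega> x" for x
  proof -
    have q: "H x \<in> grid_cube k (2 * N)"
      using halve_grid_box[OF x[unfolded Q_def]] unfolding H_def .
    obtain D where D: "D \<subseteq> {..<k}" "card D = b" "\<And>i. i \<in> D \<Longrightarrow> 0 < bump N (x i)"
      using pos unfolding \<omega>p by blast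
    show "H x \<in> cell (carrier_cell (H x))" using carrier_cell_grid_box(2)[OF q] .
    show "carrier_cell (H x) \<in> C2"
      unfolding C2_def dual_cells_def
    proof (intro CollectI conjI exI[of _ D] D(1,2) ballI)
      show "cell (carrier_cell (H x)) \<subseteq> grid_cube k (2 * N)"
        by (rule carrier_cell_grid_box(1)[OF q])
      fix i assume "i \<in> D"
      from halve_odd[of N x i, OF D(3)[OF this]]
      show "i \<notin> snd (carrier_cell (H x))" "odd (fst (carrier_cell (H x)) i)" unfolding H_def by auto
    qed
  qed
  have v5: "continuous_map (top_of_set ?Q) (join_space (Suc n) P) v5"
    unfolding v5_def
  proof (rule continuous_map_join_snoc)
    fix x assume x: "x \<in> ?Q"
    show "(\<exists>i<n. 0 < fst (rest x i)) \<or> 0 < fst (\<omega> x, p (H x))"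
      using cover[OF x] rest_pos[OF x] by auto
  next
    show "continuous_map (top_of_set {x \<in> ?Q. 0 < fst (\<omega> x, p (H x))}) P (\<lambda>x. snd (\<omega> x, p (H x)))"
      unfolding fst_conv snd_conv
      by (rule continuous_map_compose_on[OF p Hc]) (use HC2 in blast)
    show "continuous_on ?Q (\<lambda>x. fst (\<omega> x, p (H x)))" using \<chi>c(4) by simp
  qed (use rest_nn rest_c rest_s \<chi>0 in simp_all)
  have v5K: "continuous_map (top_of_set ?K) (join_space (Suc n) P) v5"
    by (rule continuous_map_from_subtopology_mono[OF v5 KQ])
  have hom45: "?hom v4 v5"
  proof (rule join_homotopic_linear[OF conjunct2[OF v34] v5K])
    fix x i assume x: "x \<in> topspace (top_of_set ?K)" and i: "i < Suc n" and pos: "0 < fst (v4 x i)" "0 < fst (v5 x i)"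
    have xQ: "x \<in> ?Q" using x KQ by auto
    show "snd (v4 x i) = snd (v5 x i)"
    proof (cases "i < n")
      case True then show ?thesis by (simp add: v4_def v5_def)
    next
      case False
      then have "0 < \<chi>A x * \<omega> x" using pos(1) by (simp add: v4_def)
      note Aw = AwD[OF this]
      obtain c where c: "c \<in> A" "near k (1/8) c x" using Aw(1) \<chi>Ap by blast
      have "(\<lambda>i. H x i / 2) \<in> cell c" by (rule Hcell[OF AQ[OF c(1)] c(2) xQ])
      \<comment> \<open>The carrier of \<open>H x\<close> in the doubled grid falls into
        \<open>c\<close> after halving, which makes it a member of \<open>L2\<close>, where
        \<open>p\<close> is prescribed by \<open>u\<close>.\<close>
      then have "\<forall>y\<in>cell (carrier_cell (H x)). (\<lambda>i. y i / 2) \<in> cell c"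
        using carrier_cell_half by blast
      then have "carrier_cell (H x) \<in> L2" using HC2(2)[OF xQ Aw(2)] c(1) unfolding L2_def by blast
      then have "p (H x) = snd (u (\<lambda>i. H x i / 2) n)" using HC2(1)[OF xQ Aw(2)] by (intro pu) blast
      then show ?thesis using False by (simp add: v4_def v5_def)
    qed
  qed
  let ?o = "\<lambda>_::nat. 0::real"
  have oQ: "?o \<in> ?Q" unfolding Q_def mem_grid_cube by simp
  \<comment> \<open>As \<open>v5\<close> is defined on the cube, contracting the cube to the origin
    makes its restriction to the boundary null-homotopic.\<close>
  have hom5: "?hom v5 (\<lambda>_. v5 ?o)"
  proof (rule homotopic_with_top_of_set[where h = "\<lambda>q. v5 (\<lambda>i. (1 - fst q) * snd q i)"])
    show "continuous_map (top_of_set ({0..1} \<times> ?K)) (join_space (Suc n) P) (\<lambda>q. v5 (\<lambda>i. (1 - fst q) * snd q i))"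
    proof (rule continuous_map_compose_on[OF v5])
      show "continuous_on ({0..1} \<times> ?K) (\<lambda>q i. (1 - fst q) * snd q i)"
        by (intro continuous_on_coordinatewise_then_product continuous_intros
            continuous_on_compose2[OF continuous_on_coordinate continuous_on_snd[OF continuous_on_id]]) auto
      show "(\<lambda>q i. (1 - fst q) * snd q i) ` ({0..1} \<times> ?K) \<subseteq> ?Q"
      proof safe
        fix t :: real and x assume tx: "t \<in> {0..1}" "x \<in> ?K"
        then have "x \<in> ?Q" using KQ by blast
        note xi = this[unfolded Q_def mem_grid_cube, THEN spec]
        have "if i < k then 0 \<le> (1 - t) * x i \<and> (1 - t) * x i \<le> real N else (1 - t) * x i = 0" for i
        proof -
          have "(1 - t) * x i \<le> 1 * x i" if "0 \<le> x i" using tx(1) that by (intro mult_right_mono) auto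
          then show ?thesis using xi[of i] tx(1) by (auto split: if_splits)
        qed
        then show "(\<lambda>i. (1 - fst (t, x)) * snd (t, x) i) \<in> ?Q" unfolding Q_def mem_grid_cube by simp
      qed
    qed
  qed simp_all
  have "?hom u (\<lambda>_. v5 ?o)"
    by (rule homotopic_with_trans[OF hom0 homotopic_with_trans[OF hom01 homotopic_with_trans[OF hom13
          homotopic_with_trans[OF hom34 homotopic_with_trans[OF hom45 hom5]]]]])
  moreover have "v5 ?o \<in> topspace (join_space (Suc n) P)"
    using continuous_map_image_subset_topspace[OF v5] oQ by auto
  ultimately show ?thesis by blast
qed

text \<open>The metric on sequences sums truncated coordinate distances with weights
  \<open>(1/2)^n\<close>, whence the factor 2. It bounds the diameter of a grid cell in the Lebesgue
  number argument.\<close>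

lemma dist_fun_le:
  fixes x y :: "nat \<Rightarrow> real"
  assumes "\<And>i. \<bar>x i - y i\<bar> \<le> d"
  shows "dist x y \<le> 2 * d"
proof -
  have s: "summable (\<lambda>n. (1/2::real)^n)" by (simp add: summable_geometric_iff)
  have le: "(1/2)^n * min (dist (x (from_nat n)) (y (from_nat n))) 1 \<le> (1/2)^n * d" for n
    using assms[of "from_nat n"] by (intro mult_left_mono) (auto simp: dist_real_def)
  have "dist x y \<le> (\<Sum>n. (1/2)^n * d)"
    unfolding dist_fun_def
    by (rule suminf_le[OF le summable_comparison_test'[OF s, of 0] summable_mult2[OF s]]) auto
  also have "\<dots> = 2 * d" using suminf_mult2[OF s, of d] suminf_geometric[of "1/2::real"] by simp
  finally show ?thesis .
qed

lemma diameter_bound: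
  assumes "\<And>x y. \<lbrakk>x \<in> S; y \<in> S\<rbrakk> \<Longrightarrow> dist x y \<le> d" "0 \<le> d"
  shows "diameter S \<le> d"
  using assms by (auto simp: diameter_def intro!: cSUP_least)

lemma compact_grid_box: "compact (grid_box a D N)"
proof -
  have "grid_box a D N = (\<Pi>\<^sub>E i\<in>UNIV. if i \<in> D then {a i..a i + N} else {a i})"
    by (auto simp: grid_box_def PiE_iff split: if_splits)
  moreover have "compactin (product_topology (\<lambda>i. euclidean) UNIV) (\<Pi>\<^sub>E i\<in>UNIV. if i \<in> D then {a i..a i + N} else {a i})"
    unfolding compactin_PiE by (intro disjI2 ballI) simp
  ultimately show ?thesis by (simp only: euclidean_product_topology compactin_euclidean_iff)
qed

lemma compact_grid_boundary:
  assumes "finite D"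
  shows "compact (grid_boundary a D N)"
proof -
  have "grid_boundary a D N = grid_box a D N \<inter> (\<Union>i\<in>D. {x. x i = a i} \<union> {x. x i = a i + N})"
    by (auto simp: grid_boundary_def)
  moreover have "closed (\<Union>i\<in>D. {x::nat \<Rightarrow> real. x i = a i} \<union> {x. x i = a i + N})"
    using assms by (intro closed_UN) (auto intro!: closed_Un closed_Collect_eq continuous_intros)
  ultimately show ?thesis by (simp only: compact_Int_closed[OF compact_grid_box])
qed

text \<open>The places where the last weight is positive and where one of the first \<open>n\<close>
  is positive are two open sets covering the boundary of the cube. By a Lebesgue number, a fine grid
  has each boundary cell in one of them; with the mesh rescaled to 1 the deformation on the grid
  applies. The ranges add because \<open>k < a + b\<close> leaves room for a skeleton below
  dimension \<open>b\<close> and its dual below dimension \<open>a\<close>.\<close>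

lemma extensible_join_Suc:
  assumes ext: "\<And>j. j < a \<Longrightarrow> extensible j P" "\<And>j. j < b \<Longrightarrow> extensible j (join_space n P)"
    and k: "k < a + b"
  shows "extensible k (join_space (Suc n) P)"
proof -
  let ?K = "\<lambda>N::real. grid_boundary (\<lambda>_. 0) {..<k} N"
  have "extensible (card {..<k}) (join_space (Suc n) P)"
  proof (rule extensible_if_nullhomotopic_on_grid[where a = "\<lambda>_. 0" and N = 1])
    fix u assume u: "continuous_map (top_of_set (?K 1)) (join_space (Suc n) P) u"
    note U = u[unfolded continuous_map_join_on]
    let ?V = "\<lambda>i. {x \<in> ?K 1. 0 < fst (u x i)}"
    have "openin (top_of_set (?K 1)) (?V i)" if "i < Suc n" for i
      using U that openin_continuous_map_preimage[of "top_of_set (?K 1)" euclideanreal "\<lambda>x. fst (u x i)" "{0<..}"]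
      by simp
    then have "\<forall>i\<in>{..<Suc n}. \<exists>T. open T \<and> ?V i = ?K 1 \<inter> T"
      unfolding openin_open by blast
    from bchoice[OF this] obtain T where T': "\<forall>i\<in>{..<Suc n}. open (T i) \<and> ?V i = ?K 1 \<inter> T i" ..
    have T: "open (T i)" "?V i = ?K 1 \<inter> T i" if "i < Suc n" for i
      using bspec[OF T', of i] that by simp_all
    let ?C = "{T n, \<Union>i<n. T i}"
    have "\<exists>\<delta>>0. \<forall>S. S \<subseteq> ?K 1 \<longrightarrow> diameter S < \<delta> \<longrightarrow> (\<exists>B\<in>?C. S \<subseteq> B)"
    proof (rule Lebesgue_number_lemma)
      show "compact (?K 1)" by (rule compact_grid_boundary) simp
      show "?K 1 \<subseteq> \<Union>?C"
      proof
        fix x assume x: "x \<in> ?K 1"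
        from conjunct1[OF U, THEN bspec, OF x] obtain i where i: "i < Suc n" "0 < fst (u x i)" by blast
        then have "x \<in> ?V i" using x by simp
        then have "x \<in> T i" "i < n \<or> i = n" using T(2)[OF i(1)] i(1) by auto
        then show "x \<in> \<Union>?C" by auto
      qed
      show "open B" if "B \<in> ?C" for B using that T(1) by auto
      show "\<exists>\<delta>>0. \<forall>S. S \<subseteq> ?K 1 \<longrightarrow> diameter S < \<delta> \<longrightarrow> (\<exists>B\<in>?C. S \<subseteq> B)"
        if "0 < \<delta>" "\<And>S. \<lbrakk>S \<subseteq> ?K 1; diameter S < \<delta>\<rbrakk> \<Longrightarrow> \<exists>B\<in>?C. S \<subseteq> B" for \<delta>
        using that by (intro exI[of _ \<delta>]) simp
    qed simp
    then obtain \<delta> where \<delta>: "0 < \<delta>" "\<And>S. \<lbrakk>S \<subseteq> ?K 1; diameter S < \<delta>\<rbrakk> \<Longrightarrow> \<exists>B\<in>?C. S \<subseteq> B"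
      by blast
    \<comment> \<open>The coordinates of a rescaled cell vary by at most \<open>1 / N\<close>, so
      its diameter is at most \<open>2 / N\<close>.\<close>
    obtain N :: nat where N: "2 / \<delta> < real N" using reals_Archimedean2 by blast
    have N0: "0 < real N" using N \<delta>(1) by (meson divide_pos_pos less_trans zero_less_numeral)
    define \<phi> where "\<phi> = (\<lambda>(x::nat \<Rightarrow> real) i. x i / real N)"
    define \<phi>' where "\<phi>' = (\<lambda>(x::nat \<Rightarrow> real) i. real N * x i)"
    have c: "continuous_on S \<phi>" "continuous_on S \<phi>'" for S
      unfolding \<phi>_def \<phi>'_def using N0 by (intro continuous_on_coordinatewise_then_product continuous_intros; simp)+
    have \<phi>im: "\<phi> ` ?K (real N) \<subseteq> ?K 1"
    proof safe
      fix x assume x: "x \<in> ?K (real N)"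
      then obtain j where xi: "\<forall>i. if i \<in> {..<k} then 0 \<le> x i \<and> x i \<le> 0 + real N else x i = 0"
        and j: "j \<in> {..<k}" "x j = 0 \<or> x j = 0 + real N"
        unfolding grid_boundary_def grid_box_def by blast
      have "if i \<in> {..<k} then 0 \<le> \<phi> x i \<and> \<phi> x i \<le> 0 + 1 else \<phi> x i = 0" for i
        using xi[THEN spec[of _ i]] N0 by (auto simp: \<phi>_def split: if_splits)
      moreover have "\<phi> x j = 0 \<or> \<phi> x j = 0 + 1"
        using j N0 by (auto simp: \<phi>_def)
      moreover note j(1)
      ultimately show "\<phi> x \<in> ?K 1" unfolding grid_boundary_def grid_box_def by blast
    qed
    have \<phi>'im: "\<phi>' ` ?K 1 \<subseteq> ?K (real N)"
    proof safe
      fix x assume x: "x \<in> ?K 1"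
      then obtain j where xi: "\<forall>i. if i \<in> {..<k} then 0 \<le> x i \<and> x i \<le> 0 + 1 else x i = 0"
        and j: "j \<in> {..<k}" "x j = 0 \<or> x j = 0 + 1"
        unfolding grid_boundary_def grid_box_def by blast
      have "if i \<in> {..<k} then 0 \<le> \<phi>' x i \<and> \<phi>' x i \<le> 0 + real N else \<phi>' x i = 0" for i
        using xi[THEN spec[of _ i]] N0 by (auto simp: \<phi>'_def mult_left_le split: if_splits)
      moreover have "\<phi>' x j = 0 \<or> \<phi>' x j = 0 + real N"
        using j N0 by (auto simp: \<phi>'_def)
      moreover note j(1)
      ultimately show "\<phi>' x \<in> ?K (real N)" unfolding grid_boundary_def grid_box_def by blast
    qed
    have inv: "\<phi> (\<phi>' x) = x" for x using N0 by (simp add: \<phi>_def \<phi>'_def)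
    have "\<exists>p\<in>topspace (join_space (Suc n) P).
        homotopic_with (\<lambda>_. True) (top_of_set (?K (real N))) (join_space (Suc n) P) (\<lambda>x. u (\<phi> x)) (\<lambda>_. p)"
    proof (rule join_nullhomotopic_on_grid[OF ext k])
      show "continuous_map (top_of_set (?K (real N))) (join_space (Suc n) P) (\<lambda>x. u (\<phi> x))"
        by (rule continuous_map_compose_on[OF u c(1) \<phi>im])
      fix c assume c: "cell c \<subseteq> ?K (real N)"
      have sub: "\<phi> ` cell c \<subseteq> ?K 1" using c \<phi>im by blast
      have "diameter (\<phi> ` cell c) \<le> 2 * (1 / real N)"
      proof (rule diameter_bound)
        fix x y assume "x \<in> \<phi> ` cell c" "y \<in> \<phi> ` cell c"
        then obtain x' y' where xy: "x' \<in> cell c" "y' \<in> cell c" "x = \<phi> x'" "y = \<phi> y'" by blast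
        have "\<bar>x i - y i\<bar> \<le> 1 / real N" for i
        proof -
          have "\<bar>x' i - y' i\<bar> \<le> 1"
            using xy(1,2)[unfolded mem_cell, THEN spec[of _ i]] by (auto split: if_splits)
          moreover have "\<bar>x i - y i\<bar> = \<bar>x' i - y' i\<bar> / real N"
            using N0 by (simp add: xy \<phi>_def abs_divide flip: diff_divide_distrib)
          ultimately show ?thesis using N0 by (simp add: divide_right_mono)
        qed
        then show "dist x y \<le> 2 * (1 / real N)" by (rule dist_fun_le)
      qed simp
      also have "\<dots> < \<delta>" using N N0 \<delta>(1) by (simp add: field_simps)
      finally obtain B where B: "B \<in> ?C" "\<phi> ` cell c \<subseteq> B" using \<delta>(2)[OF sub] by blast
      show "(\<forall>x\<in>cell c. \<exists>i<n. 0 < fst (u (\<phi> x) i)) \<or> (\<forall>x\<in>cell c. 0 < fst (u (\<phi> x) n))"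
      proof (cases "B = T n")
        case True
        have "0 < fst (u (\<phi> x) n)" if "x \<in> cell c" for x
        proof -
          have "\<phi> x \<in> ?K 1 \<inter> T n" using that B(2) True sub by blast
          then have "\<phi> x \<in> ?V n" using T(2)[of n] by simp
          then show ?thesis by simp
        qed
        then show ?thesis by blast
      next
        case False
        have "\<exists>i<n. 0 < fst (u (\<phi> x) i)" if "x \<in> cell c" for x
        proof -
          have "\<phi> x \<in> (\<Union>i<n. T i)" using that B False by auto
          then obtain i where i: "i < n" "\<phi> x \<in> T i" by blast
          then have "\<phi> x \<in> ?K 1 \<inter> T i" using that sub by blast
          then have "\<phi> x \<in> ?V i" using T(2)[of i] i(1) by simp
          then show ?thesis using i(1) by blast
        qed
        then show ?thesis by blast
      qed
    qed
    then obtain p where p: "p \<in> topspace (join_space (Suc n) P)"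
      "homotopic_with (\<lambda>_. True) (top_of_set (?K (real N))) (join_space (Suc n) P) (\<lambda>x. u (\<phi> x)) (\<lambda>_. p)"
      by blast
    have "continuous_map (top_of_set (?K 1)) (top_of_set (?K (real N))) \<phi>'"
      using c(2) \<phi>'im by (auto simp: continuous_map_in_subtopology)
    from homotopic_with_compose_continuous_map_right[OF p(2) this]
    have "homotopic_with (\<lambda>_. True) (top_of_set (?K 1)) (join_space (Suc n) P) u (\<lambda>_. p)"
      by (simp add: comp_def inv)
    then show "\<exists>p\<in>topspace (join_space (Suc n) P).
        homotopic_with (\<lambda>_. True) (top_of_set (?K 1)) (join_space (Suc n) P) u (\<lambda>_. p)"
      using p(1) by blast
  qed simp_all
  then show ?thesis by simp
qed

text \<open>Each further factor adds \<open>a\<close> to the range, by the two-factor step with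
  \<open>b = n * a\<close>. For the empty join the range is empty.\<close>

lemma extensible_join:
  assumes "\<And>j. j < a \<Longrightarrow> extensible j P" "k < n * a"
  shows "extensible k (join_space n P)"
  using assms(2)
proof (induction n arbitrary: k)
  case (Suc n)
  show ?case
    by (rule extensible_join_Suc[where b = "n * a"]) (use assms(1) Suc in auto)
qed simp

text \<open>The index shifts because the k-sphere bounds the disc of dimension k+1. A free map
  becomes pointed by taking its own value at \<open>sphere_base\<close> as the base point.\<close>

lemma extensible_Suc_if_trivial_homotopy_group:
  assumes "\<And>y. y \<in> topspace Y \<Longrightarrow> trivial_homotopy_group k Y y"
  shows "extensible (Suc k) Y"
  unfolding extensible_def extends_def
proof (intro allI impI)
  fix u assume u: "continuous_map (top_of_set (disc_boundary (Suc k))) Y u"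
  have base: "sphere_base \<in> disc_boundary (Suc k)"
  proof -
    have "(\<Sum>i<Suc k. (sphere_base i)\<^sup>2) = (\<Sum>i<Suc k. if i = 0 then 1 else 0)"
      by (rule sum.cong) (auto simp: sphere_base_def)
    also have "\<dots> = 1" by (subst sum.delta) auto
    finally show ?thesis by (auto simp: disc_boundary_eq sphere_base_def)
  qed
  let ?y = "u sphere_base"
  have y: "?y \<in> topspace Y"
    using continuous_map_image_subset_topspace[OF u] base by auto
  have "continuous_map (nsphere k) Y u \<and> u sphere_base = ?y" using u by (simp only: nsphere_eq)
  then have "homotopic_with (\<lambda>h. h sphere_base = ?y) (nsphere k) Y u (\<lambda>_. ?y)"
    by (rule mp[OF spec[OF assms[OF y, unfolded trivial_homotopy_group_def], of u]])
  then have "homotopic_with (\<lambda>_. True) (nsphere k) Y u (\<lambda>_. ?y)"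
    by (rule homotopic_with_mono) (rule TrueI)
  then have hom: "homotopic_with (\<lambda>_. True)
      (top_of_set {z. (\<forall>i\<ge>Suc k. z i = 0) \<and> two_norm (Suc k) z = 1}) Y u (\<lambda>_. ?y)"
    by (simp only: nsphere_eq disc_boundary_two_norm)
  show "\<exists>v. continuous_map (top_of_set (disc_set (Suc k))) Y v \<and> (\<forall>x\<in>disc_boundary (Suc k). v x = u x)"
    unfolding disc_set_two_norm disc_boundary_two_norm
    by (rule nullhomotopic_imp_extension[OF continuous_on_two_norm two_norm_scale hom y])
qed

section \<open>Sections over a disc\<close>

definition path_fiber :: "'y topology \<Rightarrow> 'y \<Rightarrow> 'y \<Rightarrow> (real \<Rightarrow> 'y) topology" where
  "path_fiber Y y y' = subtopology (path_space Y) {\<gamma>. \<gamma> 0 = y \<and> \<gamma> 1 = y'}"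

lemma continuous_map_path_space_on:
  fixes S :: "'a::topological_space set"
  shows "continuous_map (top_of_set S) (path_space Y) h \<longleftrightarrow>
    continuous_map (top_of_set (S \<times> {0..1})) Y (\<lambda>q. h (fst q) (snd q))"
  by (simp add: continuous_map_path_space prod_topology_subtopology_eu case_prod_unfold)

lemma continuous_map_path_fiber_on:
  fixes S :: "'a::topological_space set"
  shows "continuous_map (top_of_set S) (path_fiber Y y y') h \<longleftrightarrow>
    continuous_map (top_of_set (S \<times> {0..1})) Y (\<lambda>q. h (fst q) (snd q)) \<and>
    (\<forall>x\<in>S. h x 0 = y \<and> h x 1 = y')"
  unfolding path_fiber_def continuous_map_in_subtopology continuous_map_path_space_on
  by auto

lemma continuous_on_fun_upd:
  fixes f :: "'a::topological_space \<Rightarrow> nat \<Rightarrow> real"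
  assumes "continuous_on S f" "continuous_on S g"
  shows "continuous_on S (\<lambda>q. (f q)(j := g q))"
proof (rule continuous_on_coordinatewise_then_product)
  fix i show "continuous_on S (\<lambda>q. ((f q)(j := g q)) i)"
    using assms(2) continuous_on_compose2[OF continuous_on_coordinate[of UNIV i] assms(1)]
    by (cases "i = j") simp_all
qed

text \<open>Adjunction, with coordinate \<open>j\<close> as time: a family of paths over the
  boundary of the \<open>j\<close>-cube, together with the constants \<open>y\<close> and
  \<open>y'\<close> on bottom and top, is a map on the boundary of the (j+1)-cube. An extension over
  that cube is a family of paths with the required ends.\<close>

lemma extensible_path_fiber:
  assumes ext: "extensible (Suc j) Y" and y: "y \<in> topspace Y" "y' \<in> topspace Y"
  shows "extensible j (path_fiber Y y y')"
proof -
  let ?Q = "\<lambda>k. grid_box (\<lambda>_. 0) {..<k} 1" and ?K = "\<lambda>k. grid_boundary (\<lambda>_. 0) {..<k} 1"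
  have memQ: "x \<in> ?Q k \<longleftrightarrow> (\<forall>i. if i < k then 0 \<le> x i \<and> x i \<le> 1 else x i = 0)" for x k
    using mem_grid_cube[of x k 1] by simp
  have memK: "x \<in> ?K k \<longleftrightarrow> x \<in> ?Q k \<and> (\<exists>i<k. x i = 0 \<or> x i = 1)" for x k
    by (auto simp: grid_boundary_def)
  have upQ: "x(j := t) \<in> ?Q (Suc j)" if "x \<in> ?Q j" "t \<in> {0..1}" for x t
    using that unfolding memQ by (auto simp: less_Suc_eq)
  have dnQ: "x(j := 0) \<in> ?Q j" "x j \<in> {0..1}" if "x \<in> ?Q (Suc j)" for x
  proof -
    have "if i < j then 0 \<le> (x(j := 0)) i \<and> (x(j := 0)) i \<le> 1 else (x(j := 0)) i = 0" for i
      using that[unfolded memQ, THEN spec[of _ i]] by (auto simp: less_Suc_eq split: if_splits)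
    then show "x(j := 0) \<in> ?Q j" unfolding memQ by blast
    show "x j \<in> {0..1}" using that[unfolded memQ, THEN spec[of _ j]] by simp
  qed
  have xj: "x(j := 0) = x" if "x \<in> ?Q j" for x
    using that[unfolded memQ, THEN spec[of _ j]] by auto
  have "extends (?Q j) (?K j) (path_fiber Y y y')"
    unfolding extends_def
  proof (intro allI impI)
    fix u assume u: "continuous_map (top_of_set (?K j)) (path_fiber Y y y') u"
    note U = u[unfolded continuous_map_path_fiber_on]
    \<comment> \<open>On bottom and top coordinate \<open>j\<close> is 0 or 1; the comparison with
      1/2 merely separates the two.\<close>
    define w where "w = (\<lambda>x. if x \<in> {x \<in> ?Q (Suc j). x(j := 0) \<in> ?K j} then u (x(j := 0)) (x j)
      else if x j \<le> 1/2 then y else y')"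
    let ?A = "{x \<in> ?Q (Suc j). x(j := 0) \<in> ?K j}" and ?B = "{x \<in> ?Q (Suc j). x j = 0 \<or> x j = 1}"
    have KAB: "?K (Suc j) = ?A \<union> ?B"
    proof -
      have e: "(\<exists>i<j. (x(j := 0)) i = 0 \<or> (x(j := 0)) i = 1) \<longleftrightarrow> (\<exists>i<j. x i = 0 \<or> x i = 1)"
        for x :: "nat \<Rightarrow> real"
        by (metis fun_upd_other less_irrefl)
      have "x \<in> ?K (Suc j) \<longleftrightarrow> x \<in> ?A \<union> ?B" for x
        unfolding memK Un_iff mem_Collect_eq e using dnQ(1)[of x] by (auto simp: less_Suc_eq)
      then show ?thesis by blast
    qed
    have wend: "w x = (if x j = 0 then y else y')" if "x \<in> ?B" for x
      using that U unfolding w_def by auto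
    have "continuous_map (top_of_set (?K (Suc j))) Y w"
      unfolding w_def
    proof (rule continuous_map_closed_cases[where B = ?B])
      have clA: "closed ?A"
      proof -
        have "?A = ?Q (Suc j) \<inter> (\<lambda>x. x(j := 0)) -` ?K j" by auto
        moreover have "closed ((\<lambda>x::nat \<Rightarrow> real. x(j := 0)) -` ?K j)"
          by (rule closed_vimage) (auto intro!: continuous_on_fun_upd compact_imp_closed compact_grid_boundary)
        ultimately show ?thesis by (simp only: closed_Int[OF closed_grid_box])
      qed
      have clB: "closed ?B"
      proof -
        have "?B = ?Q (Suc j) \<inter> ({x. x j = 0} \<union> {x. x j = 1})" by auto
        moreover have "closed ({x::nat \<Rightarrow> real. x j = 0} \<union> {x. x j = 1})"
          by (intro closed_Un closed_Collect_eq continuous_intros)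
        ultimately show ?thesis by (simp only: closed_Int[OF closed_grid_box])
      qed
      show "closedin (top_of_set (?K (Suc j))) ?A" "closedin (top_of_set (?K (Suc j))) ?B"
        using clA clB KAB by (auto intro!: closed_subset)
      show "topspace (top_of_set (?K (Suc j))) \<subseteq> ?A \<union> ?B" using KAB by simp
      have "?K (Suc j) \<inter> ?A = ?A" "?K (Suc j) \<inter> ?B = ?B" using KAB by auto
      note sub = this
      have "continuous_map (top_of_set ?A) Y (\<lambda>x. (\<lambda>q. u (fst q) (snd q)) (x(j := 0), x j))"
        by (rule continuous_map_compose_on[OF conjunct1[OF U]])
          (use dnQ in \<open>auto intro!: continuous_on_Pair continuous_on_fun_upd continuous_on_id continuous_on_const continuous_on_coordinate simp del: fun_upd_apply\<close>)
      then show "continuous_map (subtopology (top_of_set (?K (Suc j))) ?A) Y (\<lambda>x. u (x(j := 0)) (x j))"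
        unfolding subtopology_subtopology sub by simp
      have "continuous_map (top_of_set ?B) Y (\<lambda>x. if x j \<le> 1/2 then y else y')"
      proof (rule continuous_map_cases_le)
        show "continuous_map (top_of_set ?B) euclideanreal (\<lambda>x. x j)" by (simp add: continuous_on_coordinate)
      qed (use y in auto)
      then show "continuous_map (subtopology (top_of_set (?K (Suc j))) ?B) Y (\<lambda>x. if x j \<le> 1/2 then y else y')"
        unfolding subtopology_subtopology sub .
      fix x assume "x \<in> ?A" "x \<in> ?B"
      then show "u (x(j := 0)) (x j) = (if x j \<le> 1/2 then y else y')"
        using U by auto
    qed
    moreover have "extends (?Q (Suc j)) (?K (Suc j)) Y"
      by (rule iffD2[OF extends_grid_box_iff]) (use ext in simp_all)
    ultimately obtain v where v: "continuous_map (top_of_set (?Q (Suc j))) Y v" "\<And>x. x \<in> ?K (Suc j) \<Longrightarrow> v x = w x"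
      unfolding extends_def by blast
    \<comment> \<open>On the boundary the extension has to equal \<open>u\<close> as a function,
      whereas \<open>v\<close> reproduces the paths of \<open>u\<close> only for times in [0,1];
      hence the case distinction.\<close>
    define v' where "v' = (\<lambda>x. if x \<in> ?K j then u x else (\<lambda>t. v (x(j := t))))"
    have v'u: "v (x(j := t)) = u x t" if "x \<in> ?K j" "t \<in> {0..1}" for x t
    proof -
      have xQ: "x \<in> ?Q j" using that(1) memK by blast
      have "x(j := t) \<in> ?A" using that upQ[OF xQ that(2)] xj[OF xQ] by simp
      then have "v (x(j := t)) = w (x(j := t))" using v(2) KAB by blast
      also have "\<dots> = u x t" using \<open>x(j := t) \<in> ?A\<close> xj[OF xQ] by (simp add: w_def)
      finally show ?thesis .
    qed
    have "continuous_map (top_of_set (?Q j \<times> {0..1})) Y (\<lambda>q. v' (fst q) (snd q))"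
    proof (rule continuous_map_eq)
      show "continuous_map (top_of_set (?Q j \<times> {0..1})) Y (\<lambda>q. v ((fst q)(j := snd q)))"
      proof (rule continuous_map_compose_on[OF v(1)])
        show "(\<lambda>q. (fst q)(j := snd q)) ` (?Q j \<times> {0..1}) \<subseteq> ?Q (Suc j)" using upQ by auto
      qed (intro continuous_on_fun_upd continuous_intros)
      fix q :: "(nat \<Rightarrow> real) \<times> real" assume "q \<in> topspace (top_of_set (?Q j \<times> {0..1}))"
      then show "v ((fst q)(j := snd q)) = v' (fst q) (snd q)"
        using v'u[of "fst q" "snd q"] by (auto simp: v'_def)
    qed
    moreover have "v' x 0 = y \<and> v' x 1 = y'" if x: "x \<in> ?Q j" for x
    proof (cases "x \<in> ?K j")
      case True then show ?thesis using U by (simp add: v'_def)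
    next
      case False
      have "x(j := 0) \<in> ?B" "x(j := 1) \<in> ?B" using upQ[OF x, of 0] upQ[OF x, of 1] by auto
      then have "v (x(j := 0)) = y" "v (x(j := 1)) = y'" using v(2) KAB wend by auto
      then show ?thesis using False by (simp add: v'_def)
    qed
    ultimately have "continuous_map (top_of_set (?Q j)) (path_fiber Y y y') v'"
      unfolding continuous_map_path_fiber_on by blast
    moreover have "v' x = u x" if "x \<in> ?K j" for x using that by (simp add: v'_def)
    ultimately show "\<exists>v. continuous_map (top_of_set (?Q j)) (path_fiber Y y y') v \<and> (\<forall>x\<in>?K j. v x = u x)"
      by blast
  qed
  then have "extensible (card {..<j}) (path_fiber Y y y')"
    by (rule iffD1[OF extends_grid_box_iff, rotated 2]) simp_all
  then show ?thesis by simp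
qed

lemma extensible_join_path_fiber:
  assumes Y: "s_connected s Y" and y: "y \<in> topspace Y" "y' \<in> topspace Y" and k: "k < n * Suc s"
  shows "extensible k (join_space n (path_fiber Y y y'))"
proof (rule extensible_join[OF _ k])
  fix j assume j: "j < Suc s"
  have "extensible (Suc j) Y"
    by (rule extensible_Suc_if_trivial_homotopy_group) (use Y j in \<open>auto simp: s_connected_def\<close>)
  then show "extensible j (path_fiber Y y y')" by (rule extensible_path_fiber[OF _ y])
qed

section \<open>Paths assembled from three phases\<close>

lemma continuous_three_phase:
  fixes S :: "'a::topological_space set"
  assumes a: "continuous_on S a" and a01: "\<And>x. x \<in> S \<Longrightarrow> 0 \<le> a x \<and> a x \<le> 1/4"
    and f: "continuous_map (top_of_set {q \<in> S \<times> {0..1}. snd q \<le> a (fst q)}) Y f"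
    and g: "continuous_map (top_of_set {q \<in> S \<times> {0..1}. snd q \<le> a (fst q)}) Y g"
    and m: "continuous_map (top_of_set S) (path_space Y) m"
    and fm: "\<And>x. x \<in> S \<Longrightarrow> f (x, a x) = m x 0" and gm: "\<And>x. x \<in> S \<Longrightarrow> g (x, a x) = m x 1"
  shows "continuous_map (top_of_set (S \<times> {0..1})) Y
    (\<lambda>q. if snd q \<le> a (fst q) then f q
      else if snd q \<le> 1 - a (fst q) then m (fst q) ((snd q - a (fst q)) / (1 - 2 * a (fst q)))
      else g (fst q, 1 - snd q))"
proof (rule continuous_map_cases_le)
  let ?S = "S \<times> {0..1::real}"
  have ac: "continuous_on ?S (\<lambda>q. a (fst q))"
    by (rule continuous_on_compose2[OF a continuous_on_fst[OF continuous_on_id]]) auto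
  have sc: "continuous_on ?S snd" by (rule continuous_on_snd[OF continuous_on_id])
  show "continuous_map (top_of_set ?S) euclideanreal snd" using sc by simp
  show "continuous_map (top_of_set ?S) euclideanreal (\<lambda>q. a (fst q))" using ac by simp
  have sub: "subtopology (top_of_set ?S) {q \<in> topspace (top_of_set ?S). p q} = top_of_set {q \<in> ?S. p q}" for p
    by (auto simp: subtopology_subtopology intro!: arg_cong[where f = top_of_set])
  show "continuous_map (subtopology (top_of_set ?S) {q \<in> topspace (top_of_set ?S). snd q \<le> a (fst q)}) Y f"
    unfolding sub by (rule f)
  show "continuous_map (subtopology (top_of_set ?S) {q \<in> topspace (top_of_set ?S). a (fst q) \<le> snd q}) Y
     (\<lambda>q. if snd q \<le> 1 - a (fst q) then m (fst q) ((snd q - a (fst q)) / (1 - 2 * a (fst q)))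
      else g (fst q, 1 - snd q))"
    unfolding sub
  proof (rule continuous_map_cases_le)
    let ?M = "{q \<in> ?S. a (fst q) \<le> snd q}"
    have sub2: "subtopology (top_of_set ?M) {q \<in> topspace (top_of_set ?M). p q} = top_of_set {q \<in> ?M. p q}" for p
      by (auto simp: subtopology_subtopology intro!: arg_cong[where f = top_of_set])
    have acM: "continuous_on Z (\<lambda>q. a (fst q))" "continuous_on Z snd" if "Z \<subseteq> ?S" for Z
      using continuous_on_subset[OF ac that] continuous_on_subset[OF sc that] by auto
    show "continuous_map (top_of_set ?M) euclideanreal snd"
      "continuous_map (top_of_set ?M) euclideanreal (\<lambda>q. 1 - a (fst q))"
      using acM[of ?M] by (auto intro!: continuous_intros)
    show "continuous_map (subtopology (top_of_set ?M) {q \<in> topspace (top_of_set ?M). snd q \<le> 1 - a (fst q)}) Y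
      (\<lambda>q. m (fst q) ((snd q - a (fst q)) / (1 - 2 * a (fst q))))"
      unfolding sub2
    proof -
      let ?N = "{q \<in> ?M. snd q \<le> 1 - a (fst q)}"
      have den: "0 < 1 - 2 * a (fst q)" if "q \<in> ?N" for q using a01[of "fst q"] that by auto
      have "continuous_map (top_of_set ?N) Y
          (\<lambda>q. (\<lambda>q. m (fst q) (snd q)) (fst q, (snd q - a (fst q)) / (1 - 2 * a (fst q))))"
      proof (rule continuous_map_compose_on[OF m[unfolded continuous_map_path_space_on]])
        have "?N \<subseteq> ?S" by auto
        then show "continuous_on ?N (\<lambda>q. (fst q, (snd q - a (fst q)) / (1 - 2 * a (fst q))))"
          using den by (intro continuous_intros acM) fastforce+
        show "(\<lambda>q. (fst q, (snd q - a (fst q)) / (1 - 2 * a (fst q)))) ` ?N \<subseteq> ?S"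
        proof
          fix q' assume "q' \<in> (\<lambda>q. (fst q, (snd q - a (fst q)) / (1 - 2 * a (fst q)))) ` ?N"
          then obtain q where q: "q \<in> ?N" "q' = (fst q, (snd q - a (fst q)) / (1 - 2 * a (fst q)))" by blast
          have "0 \<le> (snd q - a (fst q)) / (1 - 2 * a (fst q))" "(snd q - a (fst q)) / (1 - 2 * a (fst q)) \<le> 1"
            using den[OF q(1)] q(1) by (auto simp: divide_le_eq_1)
          then show "q' \<in> ?S" using q by auto
        qed
      qed
      then show "continuous_map (top_of_set ?N) Y (\<lambda>q. m (fst q) ((snd q - a (fst q)) / (1 - 2 * a (fst q))))"
        by simp
    qed
    show "continuous_map (subtopology (top_of_set ?M) {q \<in> topspace (top_of_set ?M). 1 - a (fst q) \<le> snd q}) Y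
      (\<lambda>q. g (fst q, 1 - snd q))"
      unfolding sub2
      by (rule continuous_map_compose_on[OF g]) (auto intro!: continuous_intros)
    fix q assume "q \<in> topspace (top_of_set ?M)" and e: "snd q = 1 - a (fst q)"
    then have q: "fst q \<in> S" by auto
    have "1 - 2 * a (fst q) \<noteq> 0" using a01[OF q] by auto
    then have "(snd q - a (fst q)) / (1 - 2 * a (fst q)) = 1" unfolding e by simp
    then show "m (fst q) ((snd q - a (fst q)) / (1 - 2 * a (fst q))) = g (fst q, 1 - snd q)"
      using gm[OF q] e by simp
  qed
  fix q assume "q \<in> topspace (top_of_set ?S)" and e: "snd q = a (fst q)"
  then have q: "fst q \<in> S" by auto
  have "f q = m (fst q) 0" using fm[OF q] e by (metis prod.collapse)
  then show "f q = (if snd q \<le> 1 - a (fst q) then m (fst q) ((snd q - a (fst q)) / (1 - 2 * a (fst q)))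
      else g (fst q, 1 - snd q))"
    using a01[OF q] e by simp
qed

definition scale_by :: "real \<Rightarrow> (nat \<Rightarrow> real) \<Rightarrow> nat \<Rightarrow> real" where
  "scale_by c x = (\<lambda>i. c * x i)"

lemma continuous_on_scale_by [continuous_intros]:
  assumes "continuous_on S c" "continuous_on S x"
  shows "continuous_on S (\<lambda>q. scale_by (c q) (x q))"
  unfolding scale_by_def
proof (rule continuous_on_coordinatewise_then_product)
  fix i
  have "continuous_on S (\<lambda>q. x q i)"
    by (rule continuous_on_compose2[OF continuous_on_coordinate[of UNIV i] assms(2)]) simp
  then show "continuous_on S (\<lambda>q. c q * x q i)" by (intro continuous_intros assms(1))
qed

lemma scale_by_scale_by [simp]: "scale_by c (scale_by d x) = scale_by (c * d) x"
  by (simp add: scale_by_def mult.assoc)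

lemma scale_by_1 [simp]: "scale_by 1 x = x"
  by (simp add: scale_by_def)

lemma scale_by_0: "scale_by 0 x = (\<lambda>_. 0)"
  by (simp add: scale_by_def)

lemma two_norm_scale_by: "0 \<le> c \<Longrightarrow> two_norm k (scale_by c x) = c * two_norm k x"
  by (simp add: scale_by_def two_norm_scale)

lemma scale_by_disc_set: "\<lbrakk>x \<in> disc_set k; 0 \<le> c; c * two_norm k x \<le> 1\<rbrakk> \<Longrightarrow> scale_by c x \<in> disc_set k"
  by (simp add: disc_set_two_norm two_norm_scale_by) (simp add: scale_by_def)

lemma scale_by_disc_boundary: "\<lbrakk>x \<in> disc_set k; 0 \<le> c; c * two_norm k x = 1\<rbrakk> \<Longrightarrow> scale_by c x \<in> disc_boundary k"
  by (simp add: disc_set_two_norm disc_boundary_two_norm two_norm_scale_by) (simp add: scale_by_def)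

text \<open>The last phase runs \<open>g\<close> backwards, so that \<open>f 0\<close> and
  \<open>g 0\<close> become the ends of the path. The parameter \<open>a\<close> is kept in
  [0, 1/4], which leaves at least half of the time to the middle phase.\<close>

definition three_phase :: "real \<Rightarrow> (real \<Rightarrow> 'y) \<Rightarrow> (real \<Rightarrow> 'y) \<Rightarrow> (real \<Rightarrow> 'y) \<Rightarrow> real \<Rightarrow> 'y" where
  "three_phase a f m g t = (if t \<le> a then f t else if t \<le> 1 - a then m ((t - a) / (1 - 2 * a)) else g (1 - t))"

lemma continuous_map_three_phase:
  fixes S :: "'a::topological_space set"
  assumes "continuous_on S a" "\<And>x. x \<in> S \<Longrightarrow> 0 \<le> a x \<and> a x \<le> 1/4"
    and "continuous_map (top_of_set {q \<in> S \<times> {0..1}. snd q \<le> a (fst q)}) Y (\<lambda>q. f (fst q) (snd q))"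
    and "continuous_map (top_of_set {q \<in> S \<times> {0..1}. snd q \<le> a (fst q)}) Y (\<lambda>q. g (fst q) (snd q))"
    and "continuous_map (top_of_set S) (path_space Y) m"
    and "\<And>x. x \<in> S \<Longrightarrow> f x (a x) = m x 0" "\<And>x. x \<in> S \<Longrightarrow> g x (a x) = m x 1"
  shows "continuous_map (top_of_set (S \<times> {0..1})) Y (\<lambda>q. three_phase (a (fst q)) (f (fst q)) (m (fst q)) (g (fst q)) (snd q))"
proof -
  have "continuous_map (top_of_set (S \<times> {0..1})) Y
    (\<lambda>q. if snd q \<le> a (fst q) then f (fst q) (snd q)
      else if snd q \<le> 1 - a (fst q) then m (fst q) ((snd q - a (fst q)) / (1 - 2 * a (fst q)))
      else g (fst (fst q, 1 - snd q)) (snd (fst q, 1 - snd q)))"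
    by (rule continuous_three_phase[OF assms(1-5)]) (use assms(6,7) in simp_all)
  then show ?thesis unfolding three_phase_def fst_conv snd_conv .
qed

lemma three_phase_ends:
  assumes "0 \<le> a" "a \<le> 1/4" "g a = m 1"
  shows "three_phase a f m g 0 = f 0" "three_phase a f m g 1 = g 0"
  using assms by (auto simp: three_phase_def)

text \<open>Collar and core meet on the sphere of radius 1/2. There the collar path reaches the
  centre at time 1/12 and the boundary sphere at time 1/4, at speed 6 on both legs. The core path
  also reaches the centre at time 1/12; the middle phase has length 5/6, and a fifth of it, that is
  1/6, is spent going out, which again ends at \<open>1/12 + 1/6 = 1/4\<close>.\<close>

lemma three_phase_nested:
  fixes F G :: "real \<Rightarrow> 'y"
  assumes "0 \<le> t" "t \<le> 1"
  shows "three_phase (1/4) (\<lambda>t. F (max (1/2 - 6 * t) (6 * t - 1/2))) m (\<lambda>t. G (max (1/2 - 6 * t) (6 * t - 1/2))) t =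
    three_phase (1/12) (\<lambda>t. F ((1 - 12 * t) / 2)) (three_phase (1/5) (\<lambda>t. F (5 * t)) m (\<lambda>t. G (5 * t)))
      (\<lambda>t. G ((1 - 12 * t) / 2)) t"
proof -
  define t' where "t' = (t - 1/12) / (1 - 2 * (1/12))"
  have t': "t' = 6/5 * t - 1/10" by (simp add: t'_def field_simps)
  consider "t \<le> 1/12" | "1/12 < t" "t \<le> 1/4" | "1/4 < t" "t \<le> 3/4" | "3/4 < t" "t \<le> 11/12" | "11/12 < t"
    by linarith
  then show ?thesis
  proof cases
    case 1
    then have c: "t \<le> 1/4" "t \<le> 1/12" and e: "max (1/2 - 6 * t) (6 * t - 1/2) = (1 - 12 * t) / 2"
      by (simp_all add: max_def field_simps)
    show ?thesis unfolding three_phase_def by (simp only: c e if_True)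
  next
    case 2
    then have c: "t \<le> 1/4" "\<not> t \<le> 1/12" "t \<le> 1 - 1/12" "t' \<le> 1/5"
      and e: "max (1/2 - 6 * t) (6 * t - 1/2) = 5 * t'"
      by (simp_all add: t' max_def field_simps)
    show ?thesis unfolding three_phase_def t'_def[symmetric] by (simp only: c e if_True if_False)
  next
    case 3
    then have c: "\<not> t \<le> 1/4" "t \<le> 1 - 1/4" "\<not> t \<le> 1/12" "t \<le> 1 - 1/12" "\<not> t' \<le> 1/5" "t' \<le> 1 - 1/5"
      and e: "(t' - 1/5) / (1 - 2 * (1/5)) = (t - 1/4) / (1 - 2 * (1/4))"
      by (simp_all add: t' field_simps)
    show ?thesis unfolding three_phase_def t'_def[symmetric] by (simp only: c e if_True if_False)
  next
    case 4
    then have c: "\<not> t \<le> 1/4" "\<not> t \<le> 1 - 1/4" "\<not> t \<le> 1/12" "t \<le> 1 - 1/12" "\<not> t' \<le> 1/5" "\<not> t' \<le> 1 - 1/5"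
      and e: "max (1/2 - 6 * (1 - t)) (6 * (1 - t) - 1/2) = 5 * (1 - t')"
      by (simp_all add: t' max_def field_simps)
    show ?thesis unfolding three_phase_def t'_def[symmetric] by (simp only: c e if_True if_False)
  next
    case 5
    then have c: "\<not> t \<le> 1/4" "\<not> t \<le> 1 - 1/4" "\<not> t \<le> 1/12" "\<not> t \<le> 1 - 1/12"
      and e: "max (1/2 - 6 * (1 - t)) (6 * (1 - t) - 1/2) = (1 - 12 * (1 - t)) / 2"
      by (simp_all add: max_def field_simps)
    show ?thesis unfolding three_phase_def by (simp only: c e if_True if_False)
  qed
qed

text \<open>
  Reading inwards, the collar \<open>1/2 \<le> \<bar>x\<bar>\<close> prolongs each path along the ray through \<open>x\<close>, so that on
  the sphere of radius \<open>1/2\<close> all paths run through the values of \<open>f\<close> and \<open>g\<close> at the centre; the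
  middle pieces of those paths form a map to the join of a single path space, which extends.
\<close>

lemma extend_join_over_disc:
  assumes Z: "s_connected s Z" and m: "m < n * Suc s"
    and f: "continuous_map (top_of_set (disc_set m)) Z f" and g: "continuous_map (top_of_set (disc_set m)) Z g"
    and w: "continuous_map (top_of_set (disc_boundary m)) (join_space n (path_space Z)) w"
    and ends: "\<And>x i. \<lbrakk>x \<in> disc_boundary m; i < n; 0 < fst (w x i)\<rbrakk> \<Longrightarrow> snd (w x i) 0 = f x \<and> snd (w x i) 1 = g x"
  obtains v where "continuous_map (top_of_set (disc_set m)) (join_space n (path_space Z)) v"
    "\<And>x i. \<lbrakk>x \<in> disc_set m; i < n; 0 < fst (v x i)\<rbrakk> \<Longrightarrow> snd (v x i) 0 = f x \<and> snd (v x i) 1 = g x"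
    "\<And>x i. \<lbrakk>x \<in> disc_boundary m; i < n\<rbrakk> \<Longrightarrow> fst (v x i) = fst (w x i)"
    "\<And>x i t. \<lbrakk>x \<in> disc_boundary m; i < n; 0 < fst (w x i); 0 \<le> t; t \<le> 1\<rbrakk> \<Longrightarrow> snd (v x i) t = snd (w x i) t"
proof -
  let ?D = "disc_set m" and ?S = "disc_boundary m" and ?r = "two_norm m"
  let ?o = "\<lambda>_::nat. 0::real"
  note W = w[unfolded continuous_map_join_on]
  have oD: "?o \<in> ?D" by (simp add: disc_set_def)
  have SD: "?S \<subseteq> ?D" by (rule disc_boundary_subset)
  have Sr: "?r x = 1" if "x \<in> ?S" for x using that by (simp add: disc_boundary_two_norm)
  have Dr: "?r x \<le> 1" "0 \<le> ?r x" if "x \<in> ?D" for x using that two_norm_nonneg by (auto simp: disc_set_two_norm)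
  have fo: "f ?o \<in> topspace Z" "g ?o \<in> topspace Z"
    using continuous_map_image_subset_topspace[OF f] continuous_map_image_subset_topspace[OF g] oD by auto
  have rc: "continuous_on T ?r" for T by (rule continuous_on_two_norm)
  have rq: "continuous_on T (\<lambda>q. ?r (fst q))" for T :: "((nat \<Rightarrow> real) \<times> real) set"
    by (rule continuous_on_compose2[OF rc continuous_on_fst[OF continuous_on_id]]) auto

  \<comment> \<open>Each boundary path is prolonged at both ends by the images of the ray between
    the centre and \<open>y\<close>, in time 1/5; all of them then run from \<open>f\<close> of the
    centre to \<open>g\<close> of the centre and lie in one path fibre.\<close>
  define w' where "w' = (\<lambda>y i. (fst (w y i),
    three_phase (1/5) (\<lambda>t. f (scale_by (5 * t) y)) (snd (w y i)) (\<lambda>t. g (scale_by (5 * t) y))))"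
  have "continuous_map (top_of_set ?S) (join_space n (path_fiber Z (f ?o) (g ?o))) w'"
    unfolding continuous_map_join_on
  proof (intro conjI ballI allI impI)
    fix y i assume "y \<in> ?S" "i < n"
    then show "0 \<le> fst (w' y i)" using W by (simp add: w'_def)
  next
    fix y assume "y \<in> ?S"
    from conjunct1[OF W, THEN bspec, OF this] show "\<exists>i<n. 0 < fst (w' y i)" by (simp add: w'_def)
  next
    fix i assume i: "i < n"
    show "continuous_on ?S (\<lambda>y. fst (w' y i))" using W i by (simp add: w'_def)
    let ?V = "{y \<in> ?S. 0 < fst (w y i)}"
    have eqV: "{y \<in> ?S. 0 < fst (w' y i)} = ?V" by (simp add: w'_def)
    have ws: "continuous_map (top_of_set ?V) (path_space Z) (\<lambda>y. snd (w y i))" using W i by simp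
    have ray: "(\<lambda>q. scale_by (5 * snd q) (fst q)) ` {q \<in> ?V \<times> {0..1}. snd q \<le> 1/5} \<subseteq> ?D"
    proof safe
      fix y t assume "y \<in> ?S" "t \<in> {0..1::real}" "snd (y, t) \<le> 1/5"
      then show "scale_by (5 * snd (y, t)) (fst (y, t)) \<in> ?D" using SD Sr by (intro scale_by_disc_set) auto
    qed
    have rayc: "continuous_on {q \<in> ?V \<times> {0..1}. snd q \<le> 1/5} (\<lambda>q. scale_by (5 * snd q) (fst q))"
      by (intro continuous_intros)
    have "continuous_map (top_of_set (?V \<times> {0..1})) Z (\<lambda>q. three_phase (1/5) (\<lambda>t. f (scale_by (5 * t) (fst q)))
        (snd (w (fst q) i)) (\<lambda>t. g (scale_by (5 * t) (fst q))) (snd q))"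
    proof (rule continuous_map_three_phase[where a = "\<lambda>_. 1/5" and m = "\<lambda>y. snd (w y i)"])
      show "continuous_map (top_of_set {q \<in> ?V \<times> {0..1}. snd q \<le> 1/5}) Z (\<lambda>q. f (scale_by (5 * snd q) (fst q)))"
        by (rule continuous_map_compose_on[OF f rayc ray])
      show "continuous_map (top_of_set {q \<in> ?V \<times> {0..1}. snd q \<le> 1/5}) Z (\<lambda>q. g (scale_by (5 * snd q) (fst q)))"
        by (rule continuous_map_compose_on[OF g rayc ray])
      fix y assume "y \<in> ?V"
      then show "f (scale_by (5 * (1/5)) y) = snd (w y i) 0" "g (scale_by (5 * (1/5)) y) = snd (w y i) 1"
        using ends i by auto
    qed (use ws in auto)
    moreover have "three_phase (1/5) (\<lambda>t. f (scale_by (5 * t) y)) (snd (w y i)) (\<lambda>t. g (scale_by (5 * t) y)) 0 = f ?o \<and>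
        three_phase (1/5) (\<lambda>t. f (scale_by (5 * t) y)) (snd (w y i)) (\<lambda>t. g (scale_by (5 * t) y)) 1 = g ?o" for y
      by (simp add: three_phase_def scale_by_0)
    ultimately show "continuous_map (top_of_set {y \<in> ?S. 0 < fst (w' y i)}) (path_fiber Z (f ?o) (g ?o)) (\<lambda>y. snd (w' y i))"
      unfolding eqV continuous_map_path_fiber_on by (simp add: w'_def)
  qed
  with extensible_join_path_fiber[OF Z fo m] obtain z where
    z: "continuous_map (top_of_set ?D) (join_space n (path_fiber Z (f ?o) (g ?o))) z" and zw: "\<And>y. y \<in> ?S \<Longrightarrow> z y = w' y"
    unfolding extensible_def extends_def by blast
  note ZZ = z[unfolded continuous_map_join_on]

  \<comment> \<open>On the collar this is radial projection to the boundary sphere; truncating the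
    norm at 1/2 avoids the singularity at the origin.\<close>
  define nx where "nx = (\<lambda>x. scale_by (inverse (max (1/2) (?r x))) x)"
  have nxS: "nx x \<in> ?S" if "x \<in> ?D" "1/2 \<le> ?r x" for x
    unfolding nx_def using that by (intro scale_by_disc_boundary) (auto simp: max_def)
  have nx2: "nx x = scale_by 2 x" if "?r x = 1/2" for x using that by (simp add: nx_def)
  have nx1: "nx x = x" if "x \<in> ?S" for x using Sr[OF that] by (simp add: nx_def)
  have nxr: "scale_by (?r x) (nx x) = x" if "1/2 \<le> ?r x" for x using that by (simp add: nx_def max_def)
  have nxc: "continuous_on T nx" for T
    unfolding nx_def by (intro continuous_intros rc) (auto simp: max_def)
  have dbD: "scale_by 2 x \<in> ?D" if "x \<in> ?D" "?r x \<le> 1/2" for x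
    using that by (intro scale_by_disc_set) auto
  have dbc: "continuous_on T (scale_by 2)" for T
    using continuous_on_scale_by[OF continuous_on_const continuous_on_id, of T 2] by simp

  define \<tau> where "\<tau> = (\<lambda>x i. if 1/2 \<le> ?r x then fst (w (nx x) i) else fst (z (scale_by 2 x) i))"
  \<comment> \<open>With \<open>r\<close> the norm of \<open>x\<close>, the radius falls from
    \<open>r\<close> to \<open>2 * r - 1\<close> at time \<open>(1 - r) / 6\<close> and rises to 1
    at time \<open>(1 - r) / 2\<close>, where the middle phase of \<open>pa\<close> begins. For
    \<open>r = 1\<close> nothing is prolonged; for \<open>r = 1/2\<close> the turning point is the
    centre.\<close>
  define ra where "ra = (\<lambda>x t. scale_by (max (?r x - 6 * t) (3 * ?r x - 2 + 6 * t)) (nx x))"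
  define rb where "rb = (\<lambda>x t. scale_by (1 - 12 * t) x)"
  define pa where "pa = (\<lambda>x i. three_phase ((1 - ?r x) / 2) (\<lambda>t. f (ra x t)) (snd (w (nx x) i)) (\<lambda>t. g (ra x t)))"
  define pb where "pb = (\<lambda>x i. three_phase (1/12) (\<lambda>t. f (rb x t)) (snd (z (scale_by 2 x) i)) (\<lambda>t. g (rb x t)))"
  define v where "v = (\<lambda>x i. (\<tau> x i, \<lambda>t. if 1/2 \<le> ?r x then pa x i t else pb x i t))"

  have half: "z (scale_by 2 x) = w' (nx x)" "nx x \<in> ?S" if "x \<in> ?D" "?r x = 1/2" for x
    using nxS[of x] nx2[of x] zw that by auto
  have \<tau>half: "fst (w (nx x) i) = fst (z (scale_by 2 x) i)" if "x \<in> ?D" "?r x = 1/2" for x i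
    using half[OF that] by (simp add: w'_def)
  have sub: "subtopology (top_of_set A) {x \<in> topspace (top_of_set A). p x} = top_of_set {x \<in> A. p x}"
    for A :: "'b::topological_space set" and p
    by (auto simp: subtopology_subtopology intro!: arg_cong[where f = top_of_set])
  have \<tau>c: "continuous_on ?D (\<lambda>x. \<tau> x i)" if i: "i < n" for i
  proof -
    have "continuous_map (top_of_set ?D) euclideanreal (\<lambda>x. if 1/2 \<le> ?r x then fst (w (nx x) i) else fst (z (scale_by 2 x) i))"
    proof (rule continuous_map_cases_le)
      have "continuous_on ?S (\<lambda>y. fst (w y i))" "continuous_on ?D (\<lambda>y. fst (z y i))" using W ZZ i by simp_all
      then have "continuous_on {x \<in> ?D. 1/2 \<le> ?r x} (\<lambda>x. fst (w (nx x) i))"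
        "continuous_on {x \<in> ?D. ?r x \<le> 1/2} (\<lambda>x. fst (z (scale_by 2 x) i))"
        using nxS dbD by (auto intro: continuous_on_compose2[OF _ nxc] continuous_on_compose2[OF _ dbc])
      then show "continuous_map (subtopology (top_of_set ?D) {x \<in> topspace (top_of_set ?D). 1/2 \<le> ?r x}) euclideanreal (\<lambda>x. fst (w (nx x) i))"
        "continuous_map (subtopology (top_of_set ?D) {x \<in> topspace (top_of_set ?D). ?r x \<le> 1/2}) euclideanreal (\<lambda>x. fst (z (scale_by 2 x) i))"
        unfolding sub by simp_all
      fix x assume "x \<in> topspace (top_of_set ?D)" "1/2 = ?r x"
      then show "fst (w (nx x) i) = fst (z (scale_by 2 x) i)" by (intro \<tau>half) auto
    qed (auto simp: rc)
    then show ?thesis by (simp add: \<tau>_def)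
  qed
  have pab: "pa x i t = pb x i t" if x: "x \<in> ?D" "?r x = 1/2" and t: "0 \<le> t" "t \<le> 1" for x i t
  proof -
    have y: "nx x = scale_by 2 x" using nx2 x(2) by simp
    have zz: "snd (z (scale_by 2 x) i) = three_phase (1/5) (\<lambda>t. f (scale_by (5 * t) (nx x))) (snd (w (nx x) i)) (\<lambda>t. g (scale_by (5 * t) (nx x)))"
      using half[OF x] by (simp add: w'_def)
    have ra: "ra x t = scale_by (max (1/2 - 6 * t) (6 * t - 1/2)) (nx x)" for t
    proof -
      have "3 * (1/2) - 2 + 6 * t = 6 * t - 1/2" by simp
      then show ?thesis by (simp only: ra_def x(2))
    qed
    have rb: "rb x t = scale_by ((1 - 12 * t) / 2) (nx x)" for t
    proof -
      have "(1 - 12 * t) / 2 * 2 = 1 - 12 * t" by simp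
      then show ?thesis by (simp only: rb_def y scale_by_scale_by)
    qed
    have a: "(1 - ?r x) / 2 = 1/4" using x(2) by simp
    show ?thesis
      unfolding pa_def pb_def zz ra rb a
      by (rule three_phase_nested[where F = "\<lambda>c. f (scale_by c (nx x))" and G = "\<lambda>c. g (scale_by c (nx x))", OF t])
  qed
  have zpath: "continuous_map (top_of_set {y \<in> ?D. 0 < fst (z y i)}) (path_space Z) (\<lambda>y. snd (z y i))"
    "\<And>y. y \<in> ?D \<Longrightarrow> 0 < fst (z y i) \<Longrightarrow> snd (z y i) 0 = f ?o \<and> snd (z y i) 1 = g ?o" if i: "i < n" for i
  proof -
    have "continuous_map (top_of_set {y \<in> ?D. 0 < fst (z y i)}) (path_fiber Z (f ?o) (g ?o)) (\<lambda>y. snd (z y i))"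
      using ZZ i by simp
    then show "continuous_map (top_of_set {y \<in> ?D. 0 < fst (z y i)}) (path_space Z) (\<lambda>y. snd (z y i))"
      "\<And>y. y \<in> ?D \<Longrightarrow> 0 < fst (z y i) \<Longrightarrow> snd (z y i) 0 = f ?o \<and> snd (z y i) 1 = g ?o"
      unfolding continuous_map_path_fiber_on continuous_map_path_space_on by auto
  qed
  have outer: "continuous_map (top_of_set ({x \<in> ?D. 1/2 \<le> ?r x \<and> 0 < fst (w (nx x) i)} \<times> {0..1})) Z (\<lambda>q. pa (fst q) i (snd q))"
    "\<And>x. x \<in> {x \<in> ?D. 1/2 \<le> ?r x \<and> 0 < fst (w (nx x) i)} \<Longrightarrow> pa x i 0 = f x \<and> pa x i 1 = g x" if i: "i < n" for i
  proof -
    let ?O = "{x \<in> ?D. 1/2 \<le> ?r x \<and> 0 < fst (w (nx x) i)}" and ?a = "\<lambda>x. (1 - ?r x) / 2"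
    have ra_end: "ra x (?a x) = nx x" if "x \<in> ?O" for x
    proof -
      have "?r x \<le> 1" using that Dr by blast
      then have "max (?r x - 6 * ?a x) (3 * ?r x - 2 + 6 * ?a x) = 1" by (simp add: max_def field_simps)
      then show ?thesis by (simp add: ra_def)
    qed
    have raD: "ra x t \<in> ?D" if "x \<in> ?O" "0 \<le> t" "t \<le> ?a x" for x t
      unfolding ra_def
    proof (rule scale_by_disc_set)
      have "nx x \<in> ?S" using nxS that(1) by blast
      then show "nx x \<in> ?D" "max (?r x - 6 * t) (3 * ?r x - 2 + 6 * t) * ?r (nx x) \<le> 1"
        using SD Sr[of "nx x"] Dr[of x] that by auto
      have "1/2 \<le> ?r x" using that(1) by blast
      then show "0 \<le> max (?r x - 6 * t) (3 * ?r x - 2 + 6 * t)" by (simp add: le_max_iff_disj) linarith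
    qed
    have rac: "continuous_on T (\<lambda>q. ra (fst q) (snd q))" for T
      unfolding ra_def
      by (intro continuous_intros rq continuous_on_compose2[OF nxc continuous_on_fst[OF continuous_on_id]]) auto
    have ws: "continuous_map (top_of_set {y \<in> ?S. 0 < fst (w y i)}) (path_space Z) (\<lambda>y. snd (w y i))" using W i by simp
    have fw: "f (ra x (?a x)) = snd (w (nx x) i) 0" "g (ra x (?a x)) = snd (w (nx x) i) 1" if "x \<in> ?O" for x
      unfolding ra_end[OF that] using ends[of "nx x" i] nxS[of x] that i by auto
    have a01: "0 \<le> ?a x" "?a x \<le> 1/4" if "x \<in> ?O" for x using that Dr by auto
    show "continuous_map (top_of_set (?O \<times> {0..1})) Z (\<lambda>q. pa (fst q) i (snd q))"
      unfolding pa_def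
    proof (rule continuous_map_three_phase[where a = ?a and m = "\<lambda>x. snd (w (nx x) i)"])
      show "continuous_on ?O ?a" by (intro continuous_intros rc) simp
      show "continuous_map (top_of_set {q \<in> ?O \<times> {0..1}. snd q \<le> ?a (fst q)}) Z (\<lambda>q. f (ra (fst q) (snd q)))"
        by (rule continuous_map_compose_on[OF f rac]) (use raD in auto)
      show "continuous_map (top_of_set {q \<in> ?O \<times> {0..1}. snd q \<le> ?a (fst q)}) Z (\<lambda>q. g (ra (fst q) (snd q)))"
        by (rule continuous_map_compose_on[OF g rac]) (use raD in auto)
      show "continuous_map (top_of_set ?O) (path_space Z) (\<lambda>x. snd (w (nx x) i))"
        by (rule continuous_map_compose_on[OF ws nxc]) (use nxS in auto)
    qed (use fw a01 in blast)+
    show "pa x i 0 = f x \<and> pa x i 1 = g x" if x: "x \<in> ?O" for x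
    proof -
      have "?r x \<le> 1" using x Dr[of x] by blast
      then have "max (?r x - 6 * 0) (3 * ?r x - 2 + 6 * 0) = ?r x" by simp
      then have "ra x 0 = x" using x nxr[of x] unfolding ra_def by simp
      then show ?thesis
        using three_phase_ends[of "?a x" "\<lambda>t. g (ra x t)" "snd (w (nx x) i)" "\<lambda>t. f (ra x t)"] fw(2)[OF x] a01[OF x]
        unfolding pa_def by simp
    qed
  qed
  have inner: "continuous_map (top_of_set ({x \<in> ?D. ?r x \<le> 1/2 \<and> 0 < fst (z (scale_by 2 x) i)} \<times> {0..1})) Z (\<lambda>q. pb (fst q) i (snd q))"
    "\<And>x. x \<in> {x \<in> ?D. ?r x \<le> 1/2 \<and> 0 < fst (z (scale_by 2 x) i)} \<Longrightarrow> pb x i 0 = f x \<and> pb x i 1 = g x" if i: "i < n" for i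
  proof -
    let ?I = "{x \<in> ?D. ?r x \<le> 1/2 \<and> 0 < fst (z (scale_by 2 x) i)}"
    have rb_end: "rb x (1/12) = ?o" for x by (simp add: rb_def scale_by_0)
    have rbD: "rb x t \<in> ?D" if "x \<in> ?I" "0 \<le> t" "t \<le> 1/12" for x t
      unfolding rb_def
    proof (rule scale_by_disc_set)
      have "(1 - 12 * t) * ?r x \<le> 1 * 1" using that Dr[of x] by (intro mult_mono) auto
      then show "(1 - 12 * t) * ?r x \<le> 1" by simp
    qed (use that in auto)
    have rbc: "continuous_on T (\<lambda>q. rb (fst q) (snd q))" for T
      unfolding rb_def by (intro continuous_intros)
    have fz: "f (rb x (1/12)) = snd (z (scale_by 2 x) i) 0" "g (rb x (1/12)) = snd (z (scale_by 2 x) i) 1" if "x \<in> ?I" for x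
      unfolding rb_end using zpath(2)[OF i, of "scale_by 2 x"] dbD[of x] that by auto
    show "continuous_map (top_of_set (?I \<times> {0..1})) Z (\<lambda>q. pb (fst q) i (snd q))"
      unfolding pb_def
    proof (rule continuous_map_three_phase[where a = "\<lambda>_. 1/12" and m = "\<lambda>x. snd (z (scale_by 2 x) i)"])
      show "continuous_map (top_of_set {q \<in> ?I \<times> {0..1}. snd q \<le> 1/12}) Z (\<lambda>q. f (rb (fst q) (snd q)))"
        by (rule continuous_map_compose_on[OF f rbc]) (use rbD in auto)
      show "continuous_map (top_of_set {q \<in> ?I \<times> {0..1}. snd q \<le> 1/12}) Z (\<lambda>q. g (rb (fst q) (snd q)))"
        by (rule continuous_map_compose_on[OF g rbc]) (use rbD in auto)
      show "continuous_map (top_of_set ?I) (path_space Z) (\<lambda>x. snd (z (scale_by 2 x) i))"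
        by (rule continuous_map_compose_on[OF zpath(1)[OF i] dbc]) (use dbD in auto)
    qed (use fz in \<open>simp_all add: continuous_on_const\<close>)
    show "pb x i 0 = f x \<and> pb x i 1 = g x" if x: "x \<in> ?I" for x
    proof -
      have "rb x 0 = x" by (simp add: rb_def)
      then show ?thesis
        using three_phase_ends[of "1/12" "\<lambda>t. g (rb x t)" "snd (z (scale_by 2 x) i)" "\<lambda>t. f (rb x t)"] fz(2)[OF x]
        unfolding pb_def by simp
    qed
  qed
  have part: "x \<in> {x \<in> ?D. 1/2 \<le> ?r x \<and> 0 < fst (w (nx x) i)} \<longleftrightarrow> 1/2 \<le> ?r x"
    "x \<in> {x \<in> ?D. ?r x \<le> 1/2 \<and> 0 < fst (z (scale_by 2 x) i)} \<longleftrightarrow> ?r x \<le> 1/2"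
    if "x \<in> ?D" "0 < \<tau> x i" for x i
    using that \<tau>half[of x i] by (auto simp: \<tau>_def split: if_splits)
  show ?thesis
  proof (rule that[of v])
    show "continuous_map (top_of_set ?D) (join_space n (path_space Z)) v"
      unfolding continuous_map_join_on
    proof (intro conjI ballI allI impI)
      fix x i assume x: "x \<in> ?D" and i: "i < n"
      show "0 \<le> fst (v x i)"
      proof (cases "1/2 \<le> ?r x")
        case True
        then show ?thesis using conjunct1[OF W, THEN bspec, OF nxS[OF x True]] i by (simp add: v_def \<tau>_def)
      next
        case False
        then have D2: "scale_by 2 x \<in> ?D" using dbD x by simp
        show ?thesis using conjunct1[OF ZZ, THEN bspec, OF D2] i False by (simp add: v_def \<tau>_def)
      qed
    next
      fix x assume x: "x \<in> ?D"
      show "\<exists>i<n. 0 < fst (v x i)"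
      proof (cases "1/2 \<le> ?r x")
        case True
        then show ?thesis using conjunct1[OF W, THEN bspec, OF nxS[OF x True]] by (simp add: v_def \<tau>_def)
      next
        case False
        then have D2: "scale_by 2 x \<in> ?D" using dbD x by simp
        show ?thesis using conjunct1[OF ZZ, THEN bspec, OF D2] False by (simp add: v_def \<tau>_def)
      qed
    next
      fix i assume i: "i < n"
      show "continuous_on ?D (\<lambda>x. fst (v x i))" using \<tau>c[OF i] by (simp add: v_def)
      let ?V = "{x \<in> ?D. 0 < fst (v x i)}"
      have V: "?V = {x \<in> ?D. 0 < \<tau> x i}" by (simp add: v_def)
      have V1: "{x \<in> ?D. 1/2 \<le> ?r x \<and> 0 < fst (w (nx x) i)} = {x \<in> ?D. 0 < \<tau> x i \<and> 1/2 \<le> ?r x}"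
        by (auto simp: \<tau>_def)
      have "\<tau> x i = fst (z (scale_by 2 x) i)" if "x \<in> ?D" "?r x \<le> 1/2" for x
        using that \<tau>half[of x i] by (cases "?r x = 1/2") (simp_all add: \<tau>_def)
      then have V2: "{x \<in> ?D. ?r x \<le> 1/2 \<and> 0 < fst (z (scale_by 2 x) i)} = {x \<in> ?D. 0 < \<tau> x i \<and> ?r x \<le> 1/2}"
        by auto
      have "continuous_map (top_of_set (?V \<times> {0..1})) Z
          (\<lambda>q. if 1/2 \<le> ?r (fst q) then pa (fst q) i (snd q) else pb (fst q) i (snd q))"
      proof (rule continuous_map_cases_le)
        have "{q \<in> ?V \<times> {0..1::real}. 1/2 \<le> ?r (fst q)} = {x \<in> ?D. 1/2 \<le> ?r x \<and> 0 < fst (w (nx x) i)} \<times> {0..1}"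
          unfolding V V1 by auto
        then show "continuous_map (subtopology (top_of_set (?V \<times> {0..1})) {q \<in> topspace (top_of_set (?V \<times> {0..1})). 1/2 \<le> ?r (fst q)}) Z
            (\<lambda>q. pa (fst q) i (snd q))"
          unfolding sub using outer(1)[OF i] by simp
        have "{q \<in> ?V \<times> {0..1::real}. ?r (fst q) \<le> 1/2} = {x \<in> ?D. ?r x \<le> 1/2 \<and> 0 < fst (z (scale_by 2 x) i)} \<times> {0..1}"
          unfolding V V2 by auto
        then show "continuous_map (subtopology (top_of_set (?V \<times> {0..1})) {q \<in> topspace (top_of_set (?V \<times> {0..1})). ?r (fst q) \<le> 1/2}) Z
            (\<lambda>q. pb (fst q) i (snd q))"
          unfolding sub using inner(1)[OF i] by simp
        fix q :: "(nat \<Rightarrow> real) \<times> real" assume "q \<in> topspace (top_of_set (?V \<times> {0..1}))" "1/2 = ?r (fst q)"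
        then show "pa (fst q) i (snd q) = pb (fst q) i (snd q)" by (intro pab) auto
      qed (use rq in simp_all)
      then show "continuous_map (top_of_set ?V) (path_space Z) (\<lambda>x. snd (v x i))"
        unfolding continuous_map_path_space_on by (simp add: v_def)
    qed
    fix x i assume i: "i < n"
    show "snd (v x i) 0 = f x \<and> snd (v x i) 1 = g x" if x: "x \<in> ?D" and pos: "0 < fst (v x i)"
    proof -
      have pos': "0 < \<tau> x i" using pos by (simp add: v_def)
      show ?thesis
      proof (cases "1/2 \<le> ?r x")
        case True
        then show ?thesis using outer(2)[OF i] part(1)[OF x pos'] by (simp add: v_def)
      next
        case False
        then show ?thesis using inner(2)[OF i] part(2)[OF x pos'] by (simp add: v_def)
      qed
    qed
    show "fst (v x i) = fst (w x i)" if x: "x \<in> ?S"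
      using nx1[OF x] Sr[OF x] by (simp add: v_def \<tau>_def)
    show "snd (v x i) t = snd (w x i) t" if x: "x \<in> ?S" and pos: "0 < fst (w x i)" and t: "0 \<le> t" "t \<le> 1" for t
      using nx1[OF x] Sr[OF x] t ends[OF x i pos] by (simp add: v_def pa_def three_phase_def ra_def)
  qed
qed

section \<open>Equivariant sections over cells\<close>

text \<open>An equivariant section over \<open>A\<close> of the fibrewise join. The guards are there
  because fibre coordinates of weight 0 and path values outside [0,1] are junk.\<close>

definition join_section ::
    "('g, 'm) monoid_scheme \<Rightarrow> ('g \<Rightarrow> 'x \<Rightarrow> 'x) \<Rightarrow> 'x topology \<Rightarrow> ('g \<Rightarrow> 'y \<Rightarrow> 'y) \<Rightarrow> 'y topology \<Rightarrow>
      ('x \<Rightarrow> 'y) \<Rightarrow> ('x \<Rightarrow> 'y) \<Rightarrow> nat \<Rightarrow> 'x set \<Rightarrow> ('x \<Rightarrow> nat \<Rightarrow> real \<times> (real \<Rightarrow> 'y)) \<Rightarrow> bool" where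
  "join_section G \<phi> X \<psi> Y f g n A u \<longleftrightarrow>
     continuous_map (subtopology X A) (join_space n (path_space Y)) u \<and>
     (\<forall>x\<in>A. \<forall>i<n. 0 < fst (u x i) \<longrightarrow> snd (u x i) 0 = f x \<and> snd (u x i) 1 = g x) \<and>
     (\<forall>a\<in>carrier G. \<forall>x\<in>A. \<forall>i<n. fst (u (\<phi> a x) i) = fst (u x i) \<and>
        (0 < fst (u x i) \<longrightarrow> (\<forall>t\<in>{0..1}. snd (u (\<phi> a x) i) t = \<psi> a (snd (u x i) t))))"

section \<open>Maps on a single equivariant cell\<close>

lemma disc_boundary_interior: "disc_set m = disc_boundary m \<union> disc_interior m"
  by (auto simp: disc_boundary_def disc_interior_def topspace_disc disc_set_def)

lemma compact_disc_set: "compact (disc_set m)"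
proof -
  have "disc_set m \<subseteq> grid_box (\<lambda>i. if i < m then - 1 else 0) {..<m} 2"
  proof
    fix x assume x: "x \<in> disc_set m"
    have "\<bar>x i\<bar> \<le> 1" if "i < m" for i
    proof -
      have "(x i)\<^sup>2 \<le> (\<Sum>i<m. (x i)\<^sup>2)" by (rule member_le_sum) (use that in auto)
      then have "(x i)\<^sup>2 \<le> 1" using x by (simp add: disc_set_def)
      then show ?thesis by (simp add: abs_square_le_1)
    qed
    then show "x \<in> grid_box (\<lambda>i. if i < m then - 1 else 0) {..<m} 2"
      using x by (auto simp: grid_box_def disc_set_def abs_le_iff)
  qed
  moreover have "closed (disc_set m)"
  proof -
    have "disc_set m = (\<Inter>i\<in>{m..}. {x. x i = 0}) \<inter> {x. (\<Sum>i<m. (x i)\<^sup>2) \<le> 1}"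
      by (auto simp: disc_set_def)
    moreover have "closed ((\<Inter>i\<in>{m..}. {x::nat \<Rightarrow> real. x i = 0}) \<inter> {x. (\<Sum>i<m. (x i)\<^sup>2) \<le> 1})"
      by (intro closed_Int closed_INT ballI closed_Collect_eq closed_Collect_le continuous_intros)
    ultimately show ?thesis by simp
  qed
  ultimately show ?thesis
    using compact_Int_closed[OF compact_grid_box] by (simp only: inf.absorb_iff2) metis
qed

text \<open>The disc is compact Hausdorff, and the product of a quotient map with the identity of
  such a space is again a quotient map. Continuity on \<open>G/H \<times> D\<close> can thus be
  tested on \<open>G \<times> D\<close>.\<close>

lemma quotient_map_coset_space_disc:
  assumes "topspace T = carrier G"
  shows "quotient_map (prod_topology T (disc m)) (prod_topology (coset_space G T H) (disc m))
    (\<lambda>(a, d). (a <#\<^bsub>G\<^esub> H, d))"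
proof (rule quotient_map_prod_left)
  show "locally_compact_space (disc m)"
    unfolding disc_eq by (rule compact_imp_locally_compact_space) (simp add: compact_space_subtopology compact_disc_set)
  show "Hausdorff_space (disc m) \<or> regular_space (disc m)"
    unfolding disc_eq by (simp add: Hausdorff_space_subtopology)
  show "quotient_map T (coset_space G T H) (\<lambda>a. a <#\<^bsub>G\<^esub> H)"
    by (rule quotient_map_coset_space[OF assms])
qed

lemma g_space_mem:
  assumes "g_space G T \<phi> X" "a \<in> carrier G" "x \<in> topspace X"
  shows "\<phi> a x \<in> topspace X"
  using assms group_action.element_image unfolding g_space_def by metis

lemma g_space_mult:
  assumes "g_space G T \<phi> X" "a \<in> carrier G" "b \<in> carrier G" "x \<in> topspace X"
  shows "\<phi> (a \<otimes>\<^bsub>G\<^esub> b) x = \<phi> a (\<phi> b x)"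
  using assms group_action.composition_rule unfolding g_space_def by metis

lemma mem_lcosets:
  assumes "C \<in> lcosets\<^bsub>G\<^esub> H"
  obtains a where "a \<in> carrier G" "C = a <#\<^bsub>G\<^esub> H"
  using assms unfolding LCOSETS_def by blast

lemma lcosetsI: "a \<in> carrier G \<Longrightarrow> a <#\<^bsub>G\<^esub> H \<in> lcosets\<^bsub>G\<^esub> H"
  unfolding LCOSETS_def by blast

lemma subgroup_mem_lcosets:
  assumes "group G" "subgroup H G"
  shows "H \<in> lcosets\<^bsub>G\<^esub> H"
  using lcosetsI[of "\<one>\<^bsub>G\<^esub>" G H] group.lcos_mult_one[OF assms(1) subgroup.subset[OF assms(2)]]
    monoid.one_closed[OF group.is_monoid[OF assms(1)]] by simp

text \<open>The map that a cell inherits from its slice over the coset \<open>H\<close> by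
  translation. On \<open>G \<times> D\<close> its fibre coordinates are those of \<open>w d\<close>
  moved by \<open>\<psi> a\<close>, so they are continuous because the action is. The equations for
  \<open>F\<close> range over all representatives \<open>a\<close>, so they contain independence of
  the representative.\<close>

lemma continuous_map_coset_disc_join:
  assumes top: "topspace T = carrier G" and Y: "continuous_map (prod_topology T Y) Y (\<lambda>(a, y). \<psi> a y)"
    and w: "continuous_map (disc m) (join_space n (path_space (subtopology Y S))) w"
    and F: "\<And>a d i. \<lbrakk>a \<in> carrier G; d \<in> disc_set m; i < n\<rbrakk> \<Longrightarrow> fst (F (a <#\<^bsub>G\<^esub> H, d) i) = fst (w d i)"
      "\<And>a d i t. \<lbrakk>a \<in> carrier G; d \<in> disc_set m; i < n; 0 < fst (w d i); t \<in> {0..1}\<rbrakk> \<Longrightarrow>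
        snd (F (a <#\<^bsub>G\<^esub> H, d) i) t = \<psi> a (snd (w d i) t)"
  shows "continuous_map (prod_topology (coset_space G T H) (disc m)) (join_space n (path_space Y)) F"
proof (rule continuous_compose_quotient_map[OF quotient_map_coset_space_disc[OF top]])
  let ?q = "\<lambda>(a, d). (a <#\<^bsub>G\<^esub> H, d)"
  let ?P = "prod_topology T (disc m)"
  note W = w[unfolded disc_eq continuous_map_join_on]
  have P: "topspace ?P = carrier G \<times> disc_set m" using top by (simp add: topspace_disc)
  have F1: "fst ((F \<circ> ?q) p i) = fst (w (snd p) i)" if "p \<in> topspace ?P" "i < n" for p i
    using that F(1) unfolding P by auto
  show "continuous_map ?P (join_space n (path_space Y)) (F \<circ> ?q)"
    unfolding continuous_map_join_space
  proof (intro conjI ballI allI impI)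
    fix p i assume "p \<in> topspace ?P" "i < n"
    then show "0 \<le> fst ((F \<circ> ?q) p i)" using F1 W unfolding P by auto
  next
    fix p assume p: "p \<in> topspace ?P"
    then have "snd p \<in> disc_set m" unfolding P by auto
    from conjunct1[OF W, THEN bspec, OF this] show "\<exists>i<n. 0 < fst ((F \<circ> ?q) p i)" using F1[OF p] by auto
  next
    fix i assume i: "i < n"
    have "continuous_map (disc m) euclideanreal (\<lambda>d. fst (w d i))" using W i by (simp add: disc_eq)
    from continuous_map_compose[OF continuous_map_snd this]
    show "continuous_map ?P euclideanreal (\<lambda>p. fst ((F \<circ> ?q) p i))"
      by (rule continuous_map_eq) (use F1 i in \<open>auto simp: comp_def\<close>)
    let ?V = "{d \<in> disc_set m. 0 < fst (w d i)}"
    have V: "subtopology ?P {p. 0 < fst ((F \<circ> ?q) p i)} = subtopology ?P (carrier G \<times> ?V)"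
    proof -
      have "topspace ?P \<inter> {p. 0 < fst ((F \<circ> ?q) p i)} = topspace ?P \<inter> (carrier G \<times> ?V)"
      proof (intro equalityI subsetI)
        fix p assume "p \<in> topspace ?P \<inter> {p. 0 < fst ((F \<circ> ?q) p i)}"
        then have p: "p \<in> topspace ?P" "0 < fst ((F \<circ> ?q) p i)" by blast+
        then have "0 < fst (w (snd p) i)" using F1[OF p(1) i] by simp
        then show "p \<in> topspace ?P \<inter> (carrier G \<times> ?V)" using p(1) unfolding P by auto
      next
        fix p assume "p \<in> topspace ?P \<inter> (carrier G \<times> ?V)"
        then have p: "p \<in> topspace ?P" "0 < fst (w (snd p) i)" by auto
        then show "p \<in> topspace ?P \<inter> {p. 0 < fst ((F \<circ> ?q) p i)}" using F1[OF p(1) i] by simp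
      qed
      from arg_cong[OF this, of "subtopology ?P"] show ?thesis by (simp only: subtopology_restrict)
    qed
    have ws: "continuous_map (top_of_set (?V \<times> {0..1})) (subtopology Y S) (\<lambda>q. snd (w (fst q) i) (snd q))"
      using W i unfolding continuous_map_path_space_on by simp
    let ?R = "prod_topology (subtopology ?P (carrier G \<times> ?V)) (top_of_set {0..1::real})"
    have c1: "continuous_map ?R T (\<lambda>q. fst (fst q))"
      using continuous_map_compose[OF continuous_map_fst continuous_map_from_subtopology[OF continuous_map_fst]]
      by (simp only: comp_def)
    have "continuous_map ?R (disc m) (\<lambda>q. snd (fst q))"
      using continuous_map_compose[OF continuous_map_fst continuous_map_from_subtopology[OF continuous_map_snd]]
      by (simp only: comp_def)
    then have "continuous_map ?R (top_of_set ?V) (\<lambda>q. snd (fst q))"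
      by (auto simp: disc_eq continuous_map_in_subtopology)
    then have c2: "continuous_map ?R (top_of_set (?V \<times> {0..1})) (\<lambda>q. (snd (fst q), snd q))"
      unfolding prod_topology_subtopology_eu[symmetric] continuous_map_paired by (simp add: continuous_map_snd)
    have c3: "continuous_map ?R Y (\<lambda>q. snd (w (snd (fst q)) i) (snd q))"
      using continuous_map_compose[OF c2 ws] by (simp add: comp_def continuous_map_in_subtopology)
    have c4: "continuous_map ?R (prod_topology T Y) (\<lambda>q. (fst (fst q), snd (w (snd (fst q)) i) (snd q)))"
      unfolding continuous_map_paired using c1 c3 by blast
    from continuous_map_compose[OF c4 Y]
    have "continuous_map ?R Y (\<lambda>q. \<psi> (fst (fst q)) (snd (w (snd (fst q)) i) (snd q)))" by (simp add: comp_def)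
    then have "continuous_map ?R Y (\<lambda>(p, t). snd ((F \<circ> ?q) p i) t)"
      by (rule continuous_map_eq) (use F(2) i in auto)
    then show "continuous_map (subtopology ?P {p. 0 < fst ((F \<circ> ?q) p i)}) (path_space Y) (\<lambda>p. snd ((F \<circ> ?q) p i))"
      unfolding V continuous_map_path_space .
  qed
qed

text \<open>The slice \<open>\<Phi> (H, d)\<close> consists of points fixed by \<open>H\<close>, so
  by equivariance \<open>f\<close>, \<open>g\<close> and the paths of \<open>u\<close> over it take
  values in the fixed-point set of \<open>H\<close>. The equivariant problem becomes a plain
  extension problem over the disc, in an s-connected space.\<close>

lemma extend_join_section_over_cell:
  assumes G: "topological_group G T" and H: "closed_subgroup G T H"
    and Y: "g_space G T \<psi> Y" and conn: "s_g_connected s G T \<psi> Y" and m: "m < n * Suc s"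
    and f: "g_map G \<phi> X \<psi> Y f" and g: "g_map G \<phi> X \<psi> Y g"
    and B: "B \<subseteq> topspace X"
    and \<Phi>: "continuous_map (prod_topology (coset_space G T H) (disc m)) (subtopology X B) \<Phi>"
      "\<And>a C d. \<lbrakk>a \<in> carrier G; C \<in> lcosets\<^bsub>G\<^esub> H; d \<in> disc_set m\<rbrakk> \<Longrightarrow> \<Phi> (a <#\<^bsub>G\<^esub> C, d) = \<phi> a (\<Phi> (C, d))"
      "\<Phi> ` ((lcosets\<^bsub>G\<^esub> H) \<times> disc_boundary m) \<subseteq> A"
    and u: "join_section G \<phi> X \<psi> Y f g n A u"
  shows "\<exists>w. continuous_map (disc m) (join_space n (path_space (subtopology Y (fixed_points \<psi> Y H)))) w \<and>
    (\<forall>d\<in>disc_set m. \<forall>i<n. 0 < fst (w d i) \<longrightarrow> snd (w d i) 0 = f (\<Phi> (H, d)) \<and> snd (w d i) 1 = g (\<Phi> (H, d))) \<and>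
    (\<forall>d\<in>disc_boundary m. \<forall>i<n. fst (w d i) = fst (u (\<Phi> (H, d)) i) \<and>
      (0 < fst (w d i) \<longrightarrow> (\<forall>t\<in>{0..1}. snd (w d i) t = snd (u (\<Phi> (H, d)) i) t)))"
proof -
  have grp: "group G" and topT: "topspace T = carrier G" using G by (auto simp: topological_group_def)
  have sub: "subgroup H G" using H by (simp add: closed_subgroup_def)
  let ?Z = "subtopology Y (fixed_points \<psi> Y H)"
  let ?v = "\<lambda>d. \<Phi> (H, d)"
  have Z: "s_connected s ?Z" using conn H by (simp add: s_g_connected_def)
  have HL: "H \<in> lcosets\<^bsub>G\<^esub> H" by (rule subgroup_mem_lcosets[OF grp sub])
  have hH: "h \<in> carrier G" "h <#\<^bsub>G\<^esub> H = H" if "h \<in> H" for h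
    using subgroup.mem_carrier[OF sub that] group.coset_join3[OF grp _ sub that] by auto
  have vfix: "\<phi> h (?v d) = ?v d" if "h \<in> H" "d \<in> disc_set m" for h d
    using \<Phi>(2)[OF hH(1)[OF that(1)] HL that(2)] hH(2)[OF that(1)] by simp
  have "continuous_map (disc m) (prod_topology (coset_space G T H) (disc m)) (\<lambda>d. (H, d))"
    unfolding continuous_map_paired using HL by (simp add: topspace_coset_space[OF topT])
  from continuous_map_compose[OF this \<Phi>(1)]
  have vB: "continuous_map (disc m) (subtopology X B) ?v" by (simp add: comp_def)
  then have vX: "continuous_map (disc m) X ?v" by (simp add: continuous_map_in_subtopology)
  have vtop: "?v d \<in> topspace X" if "d \<in> disc_set m" for d
    using continuous_map_image_subset_topspace[OF vX] that by (auto simp: topspace_disc)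
  have fix_map: "continuous_map (top_of_set (disc_set m)) ?Z (\<lambda>d. k (?v d))" if k: "g_map G \<phi> X \<psi> Y k" for k
  proof -
    have kc: "continuous_map X Y k" and ke: "\<And>a x. a \<in> carrier G \<Longrightarrow> x \<in> topspace X \<Longrightarrow> k (\<phi> a x) = \<psi> a (k x)"
      using k by (auto simp: g_map_def equivariant_on_def)
    have c: "continuous_map (disc m) Y (\<lambda>d. k (?v d))"
      using continuous_map_compose[OF vX kc] by (simp add: comp_def)
    have "k (?v d) \<in> fixed_points \<psi> Y H" if d: "d \<in> disc_set m" for d
      unfolding fixed_points_def
    proof (intro CollectI conjI ballI)
      show "k (?v d) \<in> topspace Y"
        using continuous_map_image_subset_topspace[OF c] d by (auto simp: topspace_disc)
      fix h assume h: "h \<in> H"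
      show "\<psi> h (k (?v d)) = k (?v d)"
        using ke[OF hH(1)[OF h] vtop[OF d]] vfix[OF h d] by simp
    qed
    then show ?thesis using c by (auto simp: disc_eq continuous_map_in_subtopology)
  qed
  have vS: "?v ` disc_boundary m \<subseteq> A" using \<Phi>(3) HL by auto
  have SD: "disc_boundary m \<subseteq> disc_set m" by (rule disc_boundary_subset)
  have U: "continuous_map (subtopology X A) (join_space n (path_space Y)) u"
    "\<And>x i. x \<in> A \<Longrightarrow> i < n \<Longrightarrow> 0 < fst (u x i) \<Longrightarrow> snd (u x i) 0 = f x \<and> snd (u x i) 1 = g x"
    "\<And>a x i t. a \<in> carrier G \<Longrightarrow> x \<in> A \<Longrightarrow> i < n \<Longrightarrow> 0 < fst (u x i) \<Longrightarrow> t \<in> {0..1} \<Longrightarrow>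
      snd (u (\<phi> a x) i) t = \<psi> a (snd (u x i) t)"
    using u unfolding join_section_def by auto
  have "continuous_map (top_of_set (disc_boundary m)) X ?v"
    using continuous_map_from_subtopology_mono[OF vX[unfolded disc_eq] SD] .
  then have "continuous_map (top_of_set (disc_boundary m)) (subtopology X A) ?v"
    using vS by (auto simp: continuous_map_in_subtopology)
  from continuous_map_compose[OF this U(1)]
  have uv: "continuous_map (top_of_set (disc_boundary m)) (join_space n (path_space Y)) (\<lambda>d. u (?v d))" by (simp add: comp_def)
  have "continuous_map (top_of_set (disc_boundary m)) (join_space n (path_space ?Z)) (\<lambda>d. u (?v d))"
    unfolding continuous_map_join_on
  proof (intro conjI allI impI)
    show "\<forall>x\<in>disc_boundary m. (\<forall>i<n. 0 \<le> fst (u (?v x) i)) \<and> (\<exists>i<n. 0 < fst (u (?v x) i))"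
      using uv unfolding continuous_map_join_on by simp
    fix i assume i: "i < n"
    show "continuous_on (disc_boundary m) (\<lambda>x. fst (u (?v x) i))"
      using uv i unfolding continuous_map_join_on by simp
    let ?V = "{x \<in> disc_boundary m. 0 < fst (u (?v x) i)}"
    have c: "continuous_map (top_of_set (?V \<times> {0..1})) Y (\<lambda>q. snd (u (?v (fst q)) i) (snd q))"
      using uv i unfolding continuous_map_join_on continuous_map_path_space_on by simp
    have "snd (u (?v (fst q)) i) (snd q) \<in> fixed_points \<psi> Y H" if q: "q \<in> ?V \<times> {0..1}" for q
      unfolding fixed_points_def
    proof (intro CollectI conjI ballI)
      show "snd (u (?v (fst q)) i) (snd q) \<in> topspace Y"
        using continuous_map_image_subset_topspace[OF c] q by auto
      fix h assume h: "h \<in> H"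
      have "?v (fst q) \<in> A" "fst q \<in> disc_set m" "0 < fst (u (?v (fst q)) i)" "snd q \<in> {0..1}" using q vS SD by auto
      from U(3)[OF hH(1)[OF h] this(1) i this(3,4)] vfix[OF h this(2)]
      show "\<psi> h (snd (u (?v (fst q)) i) (snd q)) = snd (u (?v (fst q)) i) (snd q)" by simp
    qed
    then show "continuous_map (top_of_set ?V) (path_space ?Z) (\<lambda>x. snd (u (?v x) i))"
      unfolding continuous_map_path_space_on using c by (auto simp: continuous_map_in_subtopology)
  qed
  moreover have "snd (u (?v x) i) 0 = f (?v x) \<and> snd (u (?v x) i) 1 = g (?v x)"
    if "x \<in> disc_boundary m" "i < n" "0 < fst (u (?v x) i)" for x i
    using U(2)[OF _ that(2,3)] vS that(1) by blast
  ultimately show ?thesis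
  proof (rule extend_join_over_disc[OF Z m fix_map[OF f] fix_map[OF g]])
    fix w
    assume w: "continuous_map (top_of_set (disc_set m)) (join_space n (path_space ?Z)) w"
      "\<And>x i. \<lbrakk>x \<in> disc_set m; i < n; 0 < fst (w x i)\<rbrakk> \<Longrightarrow> snd (w x i) 0 = f (?v x) \<and> snd (w x i) 1 = g (?v x)"
      "\<And>x i. \<lbrakk>x \<in> disc_boundary m; i < n\<rbrakk> \<Longrightarrow> fst (w x i) = fst (u (?v x) i)"
      "\<And>x i t. \<lbrakk>x \<in> disc_boundary m; i < n; 0 < fst (u (?v x) i); 0 \<le> t; t \<le> 1\<rbrakk> \<Longrightarrow> snd (w x i) t = snd (u (?v x) i) t"
    show ?thesis
      by (intro exI[of _ w]) (use w in \<open>auto simp: disc_eq\<close>)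
  qed
qed

text \<open>Over each cell the section on its slice is spread by translation. In the interior this
  is well defined because elements of \<open>H j\<close> fix the values of the paths on the slice;
  on the boundary it matches \<open>u\<close> because \<open>u\<close> is equivariant. Continuity
  comes from the pushout topology. Invariance of \<open>B\<close> is recorded for the next
  attachment.\<close>

lemma extend_join_section:
  fixes X :: "'x topology"
  assumes G: "topological_group G T" and X: "g_space G T \<phi> X"
    and Y: "g_space G T \<psi> Y" and conn: "s_g_connected s G T \<psi> Y" and m: "m < n * Suc s"
    and f: "g_map G \<phi> X \<psi> Y f" and g: "g_map G \<phi> X \<psi> Y g"
    and attach: "attach_g_cells G T \<phi> X m A B" and B: "B \<subseteq> topspace X"
    and inv: "invariant_set G \<phi> A" and u: "join_section G \<phi> X \<psi> Y f g n A u"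
  shows "invariant_set G \<phi> B \<and> (\<exists>v. join_section G \<phi> X \<psi> Y f g n B v)"
proof -
  have grp: "group G" and topT: "topspace T = carrier G" using G by (auto simp: topological_group_def)
  interpret group G by (rule grp)
  have AB: "A \<subseteq> B" using attach by (simp add: attach_g_cells_def)
  from conjunct2[OF attach[unfolded attach_g_cells_def]] obtain J :: "'x set" and H \<Phi> where JH: "(\<forall>j\<in>J.
        closed_subgroup G T (H j) \<and>
        continuous_map (prod_topology (coset_space G T (H j)) (disc m)) (subtopology X B) (\<Phi> j) \<and>
        (\<forall>a\<in>carrier G. \<forall>C\<in>lcosets\<^bsub>G\<^esub> (H j). \<forall>d\<in>topspace (disc m). \<Phi> j (a <#\<^bsub>G\<^esub> C, d) = \<phi> a (\<Phi> j (C, d))) \<and>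
        \<Phi> j ` ((lcosets\<^bsub>G\<^esub> (H j)) \<times> disc_boundary m) \<subseteq> A) \<and>
    bij_betw (\<lambda>(j, p). \<Phi> j p) (SIGMA j:J. (lcosets\<^bsub>G\<^esub> (H j)) \<times> disc_interior m) (B - A) \<and>
    (\<forall>U\<subseteq>B. openin (subtopology X B) U \<longleftrightarrow> openin (subtopology X A) (U \<inter> A) \<and>
        (\<forall>j\<in>J. openin (prod_topology (coset_space G T (H j)) (disc m))
           {p \<in> (lcosets\<^bsub>G\<^esub> (H j)) \<times> topspace (disc m). \<Phi> j p \<in> U}))"
    by (elim exE) (rule that)
  note cell = conjunct1[OF JH] and bij = conjunct1[OF conjunct2[OF JH]] and top = conjunct2[OF conjunct2[OF JH]]
  have cl: "closed_subgroup G T (H j)" if "j \<in> J" for j using bspec[OF cell that] by (elim conjE)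
  have sub: "subgroup (H j) G" if "j \<in> J" for j using cl[OF that] by (simp add: closed_subgroup_def)
  have \<Phi>c: "continuous_map (prod_topology (coset_space G T (H j)) (disc m)) (subtopology X B) (\<Phi> j)" if "j \<in> J" for j
    using bspec[OF cell that] by (elim conjE)
  have \<Phi>e: "\<Phi> j (a <#\<^bsub>G\<^esub> C, d) = \<phi> a (\<Phi> j (C, d))"
    if "j \<in> J" "a \<in> carrier G" "C \<in> lcosets\<^bsub>G\<^esub> (H j)" "d \<in> disc_set m" for j a C d
    using bspec[OF cell that(1)] that(2-4) unfolding topspace_disc by blast
  have \<Phi>b: "\<Phi> j ` ((lcosets\<^bsub>G\<^esub> (H j)) \<times> disc_boundary m) \<subseteq> A" if "j \<in> J" for j
    using bspec[OF cell that] by (elim conjE)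
  let ?S = "SIGMA j:J. (lcosets\<^bsub>G\<^esub> (H j)) \<times> disc_interior m"
  have ptop: "topspace (prod_topology (coset_space G T (H j)) (disc m)) = (lcosets\<^bsub>G\<^esub> (H j)) \<times> disc_set m" for j
    by (simp add: topspace_coset_space[OF topT] topspace_disc)
  have ex_cell: "\<exists>j\<in>J. \<exists>a\<in>carrier G. \<exists>d\<in>disc_interior m. x = \<Phi> j (a <#\<^bsub>G\<^esub> H j, d)" if x: "x \<in> B - A" for x
  proof -
    have "x \<in> (\<lambda>(j, p). \<Phi> j p) ` ?S" using bij_betw_imp_surj_on[OF bij] x by blast
    then obtain j C d where j: "j \<in> J" "C \<in> lcosets\<^bsub>G\<^esub> (H j)" "d \<in> disc_interior m" "x = \<Phi> j (C, d)" by auto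
    from mem_lcosets[OF j(2)] obtain a where "a \<in> carrier G" "C = a <#\<^bsub>G\<^esub> H j" .
    then show ?thesis using j by blast
  qed
  have intD: "disc_interior m \<subseteq> disc_set m" by (auto simp: disc_boundary_interior)
  have trans: "\<phi> b (\<Phi> j (a <#\<^bsub>G\<^esub> H j, d)) = \<Phi> j ((b \<otimes>\<^bsub>G\<^esub> a) <#\<^bsub>G\<^esub> H j, d)"
    if "j \<in> J" "a \<in> carrier G" "b \<in> carrier G" "d \<in> disc_set m" for j a b d
    using \<Phi>e[OF that(1,3) lcosetsI[OF that(2)] that(4)] lcos_m_assoc[OF subgroup.subset[OF sub[OF that(1)]] that(3,2)]
    by simp
  have invB: "invariant_set G \<phi> B"
    unfolding invariant_set_def
  proof (intro ballI)
    fix b x assume b: "b \<in> carrier G" and x: "x \<in> B"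
    show "\<phi> b x \<in> B"
    proof (cases "x \<in> A")
      case True
      then show ?thesis using inv b AB by (auto simp: invariant_set_def)
    next
      case False
      then obtain j a d where j: "j \<in> J" "a \<in> carrier G" "d \<in> disc_interior m" "x = \<Phi> j (a <#\<^bsub>G\<^esub> H j, d)"
        using ex_cell x by blast
      have d: "d \<in> disc_set m" using j(3) intD by blast
      have "\<phi> b x = \<Phi> j ((b \<otimes>\<^bsub>G\<^esub> a) <#\<^bsub>G\<^esub> H j, d)" unfolding j(4) by (rule trans[OF j(1,2) b d])
      moreover have "((b \<otimes>\<^bsub>G\<^esub> a) <#\<^bsub>G\<^esub> H j, d) \<in> topspace (prod_topology (coset_space G T (H j)) (disc m))"
        unfolding ptop using lcosetsI[of "b \<otimes>\<^bsub>G\<^esub> a" G "H j"] b j(2) d by simp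
      ultimately show ?thesis
        using continuous_map_image_subset_topspace[OF \<Phi>c[OF j(1)]] by auto
    qed
  qed
  let ?P = "\<lambda>j w. continuous_map (disc m) (join_space n (path_space (subtopology Y (fixed_points \<psi> Y (H j))))) w \<and>
    (\<forall>d\<in>disc_set m. \<forall>i<n. 0 < fst (w d i) \<longrightarrow> snd (w d i) 0 = f (\<Phi> j (H j, d)) \<and> snd (w d i) 1 = g (\<Phi> j (H j, d))) \<and>
    (\<forall>d\<in>disc_boundary m. \<forall>i<n. fst (w d i) = fst (u (\<Phi> j (H j, d)) i) \<and>
      (0 < fst (w d i) \<longrightarrow> (\<forall>t\<in>{0..1}. snd (w d i) t = snd (u (\<Phi> j (H j, d)) i) t)))"
  have "\<forall>j\<in>J. \<exists>w. ?P j w"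
  proof
    fix j assume j: "j \<in> J"
    show "\<exists>w. ?P j w"
      by (rule extend_join_section_over_cell[OF G cl[OF j] Y conn m f g B \<Phi>c[OF j] \<Phi>e[OF j] \<Phi>b[OF j] u])
  qed
  from bchoice[OF this] obtain w where w: "\<forall>j\<in>J. ?P j (w j)" ..
  have wc: "continuous_map (disc m) (join_space n (path_space (subtopology Y (fixed_points \<psi> Y (H j))))) (w j)" if "j \<in> J" for j
    using bspec[OF w that] by (elim conjE)
  have we: "snd (w j d i) 0 = f (\<Phi> j (H j, d)) \<and> snd (w j d i) 1 = g (\<Phi> j (H j, d))"
    if "j \<in> J" "d \<in> disc_set m" "i < n" "0 < fst (w j d i)" for j d i
    using bspec[OF w that(1)] that(2-4) by simp
  have wb: "fst (w j d i) = fst (u (\<Phi> j (H j, d)) i)" "0 < fst (w j d i) \<Longrightarrow> t \<in> {0..1} \<Longrightarrow> snd (w j d i) t = snd (u (\<Phi> j (H j, d)) i) t"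
    if "j \<in> J" "d \<in> disc_boundary m" "i < n" for j d i t
    using bspec[OF w that(1)] that(2-3) by simp_all
  have wv: "snd (w j d i) t \<in> topspace Y" "\<And>h. h \<in> H j \<Longrightarrow> \<psi> h (snd (w j d i) t) = snd (w j d i) t"
    if "j \<in> J" "d \<in> disc_set m" "i < n" "0 < fst (w j d i)" "t \<in> {0..1}" for j d i t
  proof -
    have "w j d \<in> topspace (join_space n (path_space (subtopology Y (fixed_points \<psi> Y (H j)))))"
      using continuous_map_image_subset_topspace[OF wc[OF that(1)]] that(2) by (auto simp: topspace_disc)
    then have "pathin (subtopology Y (fixed_points \<psi> Y (H j))) (snd (w j d i))"
      using that(3,4) by (simp add: topspace_join_space topspace_path_space)
    then have "snd (w j d i) t \<in> topspace (subtopology Y (fixed_points \<psi> Y (H j)))"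
      using that(5) unfolding pathin_def by (auto simp: continuous_map_def)
    then show "snd (w j d i) t \<in> topspace Y" "\<And>h. h \<in> H j \<Longrightarrow> \<psi> h (snd (w j d i) t) = snd (w j d i) t"
      by (auto simp: fixed_points_def)
  qed
  have uc: "continuous_map (subtopology X A) (join_space n (path_space Y)) u"
    and ue: "\<And>x i. x \<in> A \<Longrightarrow> i < n \<Longrightarrow> 0 < fst (u x i) \<Longrightarrow> snd (u x i) 0 = f x \<and> snd (u x i) 1 = g x"
    and ua: "\<And>a x i. a \<in> carrier G \<Longrightarrow> x \<in> A \<Longrightarrow> i < n \<Longrightarrow> fst (u (\<phi> a x) i) = fst (u x i)"
      "\<And>a x i t. a \<in> carrier G \<Longrightarrow> x \<in> A \<Longrightarrow> i < n \<Longrightarrow> 0 < fst (u x i) \<Longrightarrow> t \<in> {0..1} \<Longrightarrow>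
      snd (u (\<phi> a x) i) t = \<psi> a (snd (u x i) t)"
    using u unfolding join_section_def by auto

  \<comment> \<open>A point of \<open>B\<close> outside \<open>A\<close> lies in exactly one open
    cell, so \<open>idx\<close> recovers the cell, the coset and the point of the disc;
    \<open>rep\<close> picks some representative of the coset.\<close>
  define idx where "idx = inv_into ?S (\<lambda>(j, p). \<Phi> j p)"
  define rep where "rep = (\<lambda>j C. SOME a. a \<in> carrier G \<and> a <#\<^bsub>G\<^esub> H j = C)"
  define v where "v = (\<lambda>x. if x \<in> A then u x else
    (\<lambda>i. (fst (w (fst (idx x)) (snd (snd (idx x))) i),
       \<lambda>t. \<psi> (rep (fst (idx x)) (fst (snd (idx x)))) (snd (w (fst (idx x)) (snd (snd (idx x))) i) t))))"
  have vA: "v x = u x" if "x \<in> A" for x using that by (simp add: v_def)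
  have vcell: "fst (v (\<Phi> j (a <#\<^bsub>G\<^esub> H j, d)) i) = fst (w j d i)"
    "0 < fst (w j d i) \<Longrightarrow> t \<in> {0..1} \<Longrightarrow> snd (v (\<Phi> j (a <#\<^bsub>G\<^esub> H j, d)) i) t = \<psi> a (snd (w j d i) t)"
    if j: "j \<in> J" and a: "a \<in> carrier G" and d: "d \<in> disc_set m" and i: "i < n" for j a d i t
  proof -
    have HL: "H j \<in> lcosets\<^bsub>G\<^esub> (H j)" by (rule subgroup_mem_lcosets[OF grp sub[OF j]])
    have aL: "a <#\<^bsub>G\<^esub> H j \<in> lcosets\<^bsub>G\<^esub> (H j)" by (rule lcosetsI[OF a])
    have "fst (v (\<Phi> j (a <#\<^bsub>G\<^esub> H j, d)) i) = fst (w j d i) \<and>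
      (0 < fst (w j d i) \<longrightarrow> t \<in> {0..1} \<longrightarrow> snd (v (\<Phi> j (a <#\<^bsub>G\<^esub> H j, d)) i) t = \<psi> a (snd (w j d i) t))"
    proof (cases "d \<in> disc_boundary m")
      case True
      have e: "\<Phi> j (a <#\<^bsub>G\<^esub> H j, d) = \<phi> a (\<Phi> j (H j, d))" by (rule \<Phi>e[OF j a HL d])
      have in0: "\<Phi> j (H j, d) \<in> A" and in1: "\<Phi> j (a <#\<^bsub>G\<^esub> H j, d) \<in> A"
        using \<Phi>b[OF j] HL aL True by auto
      show ?thesis
        unfolding vA[OF in1] using ua[OF a in0 i] wb[OF j True i] unfolding e by simp
    next
      case False
      then have di: "d \<in> disc_interior m" using d by (simp add: disc_boundary_interior)
      have mem: "(j, a <#\<^bsub>G\<^esub> H j, d) \<in> ?S" using j aL di by blast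
      have nA: "\<Phi> j (a <#\<^bsub>G\<^esub> H j, d) \<notin> A"
        using bij_betwE[OF bij, rule_format, OF mem] by simp
      have id: "idx (\<Phi> j (a <#\<^bsub>G\<^esub> H j, d)) = (j, a <#\<^bsub>G\<^esub> H j, d)"
        using inv_into_f_f[OF bij_betw_imp_inj_on[OF bij] mem] by (simp add: idx_def)
      let ?b = "rep j (a <#\<^bsub>G\<^esub> H j)"
      have b: "?b \<in> carrier G" "?b <#\<^bsub>G\<^esub> H j = a <#\<^bsub>G\<^esub> H j"
        using someI[of "\<lambda>b. b \<in> carrier G \<and> b <#\<^bsub>G\<^esub> H j = a <#\<^bsub>G\<^esub> H j" a] a by (simp_all add: rep_def)
      \<comment> \<open>Two representatives differ by an element of \<open>H j\<close>, which fixes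
        the path values of \<open>w j d\<close>.\<close>
      have "?b \<in> a <#\<^bsub>G\<^esub> H j" using lcos_self[OF b(1) sub[OF j]] b(2) by simp
      then obtain h where h: "h \<in> H j" "?b = a \<otimes>\<^bsub>G\<^esub> h" by (auto simp: l_coset_def)
      have hG: "h \<in> carrier G" using subgroup.mem_carrier[OF sub[OF j] h(1)] .
      have "\<psi> ?b (snd (w j d i) t) = \<psi> a (snd (w j d i) t)" if pos: "0 < fst (w j d i)" and t: "t \<in> {0..1}"
        unfolding h(2) g_space_mult[OF Y a hG wv(1)[OF j d i pos t]] wv(2)[OF j d i pos t h(1)] ..
      then show ?thesis using nA by (simp add: v_def id)
    qed
    then show "fst (v (\<Phi> j (a <#\<^bsub>G\<^esub> H j, d)) i) = fst (w j d i)"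
      "0 < fst (w j d i) \<Longrightarrow> t \<in> {0..1} \<Longrightarrow> snd (v (\<Phi> j (a <#\<^bsub>G\<^esub> H j, d)) i) t = \<psi> a (snd (w j d i) t)" by blast+
  qed
  have Yc: "continuous_map (prod_topology T Y) Y (\<lambda>(a, y). \<psi> a y)" using Y by (simp add: g_space_def)
  have v\<Phi>: "continuous_map (prod_topology (coset_space G T (H j)) (disc m)) (join_space n (path_space Y)) (\<lambda>p. v (\<Phi> j p))"
    if j: "j \<in> J" for j
    by (rule continuous_map_coset_disc_join[where w = "w j", OF topT Yc wc[OF j]]) (use vcell[OF j] in auto)
  have vc: "continuous_map (subtopology X B) (join_space n (path_space Y)) v"
    unfolding continuous_map_def
  proof (intro conjI allI impI funcsetI)
    have Btop: "topspace (subtopology X B) = B" using B by auto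
    have vin: "v x \<in> topspace (join_space n (path_space Y))" if xB: "x \<in> B" for x
    proof (cases "x \<in> A")
      case True
      then show ?thesis
        using continuous_map_image_subset_topspace[OF uc] AB B unfolding vA[OF True] by auto
    next
      case False
      then obtain j a d where j: "j \<in> J" "a \<in> carrier G" "d \<in> disc_interior m" "x = \<Phi> j (a <#\<^bsub>G\<^esub> H j, d)"
        using ex_cell xB by blast
      have "(a <#\<^bsub>G\<^esub> H j, d) \<in> topspace (prod_topology (coset_space G T (H j)) (disc m))"
        unfolding ptop using lcosetsI[OF j(2)] j(3) intD by blast
      then show ?thesis using continuous_map_image_subset_topspace[OF v\<Phi>[OF j(1)]] j(4) by auto
    qed
    show "v x \<in> topspace (join_space n (path_space Y))" if "x \<in> topspace (subtopology X B)" for x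
      using vin that Btop by blast
    fix W assume W: "openin (join_space n (path_space Y)) W"
    let ?U = "{x \<in> B. v x \<in> W}"
    have "openin (subtopology X A) (?U \<inter> A)"
    proof -
      have "openin (subtopology X A) {x \<in> topspace (subtopology X A). u x \<in> W}"
        by (rule openin_continuous_map_preimage[OF uc W])
      moreover have "{x \<in> topspace (subtopology X A). u x \<in> W} = ?U \<inter> A"
        using AB B vA by auto
      ultimately show ?thesis by simp
    qed
    moreover have "openin (prod_topology (coset_space G T (H j)) (disc m))
        {p \<in> (lcosets\<^bsub>G\<^esub> (H j)) \<times> topspace (disc m). \<Phi> j p \<in> ?U}" if j: "j \<in> J" for j
    proof -
      have "openin (prod_topology (coset_space G T (H j)) (disc m))
        {p \<in> topspace (prod_topology (coset_space G T (H j)) (disc m)). v (\<Phi> j p) \<in> W}"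
        by (rule openin_continuous_map_preimage[OF v\<Phi>[OF j] W])
      moreover have "\<Phi> j p \<in> B" if "p \<in> topspace (prod_topology (coset_space G T (H j)) (disc m))" for p
        using continuous_map_image_subset_topspace[OF \<Phi>c[OF j]] that by auto
      then have "{p \<in> topspace (prod_topology (coset_space G T (H j)) (disc m)). v (\<Phi> j p) \<in> W} =
        {p \<in> (lcosets\<^bsub>G\<^esub> (H j)) \<times> topspace (disc m). \<Phi> j p \<in> ?U}"
        unfolding ptop topspace_disc by blast
      ultimately show ?thesis by simp
    qed
    moreover have "?U \<subseteq> B" by blast
    ultimately show "openin (subtopology X B) {x \<in> topspace (subtopology X B). v x \<in> W}"
      unfolding Btop using top by simp
  qed
  have fe: "k (\<phi> a x) = \<psi> a (k x)" if "g_map G \<phi> X \<psi> Y k" "a \<in> carrier G" "x \<in> topspace X" for k a x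
    using that by (simp add: g_map_def equivariant_on_def)
  have "join_section G \<phi> X \<psi> Y f g n B v"
    unfolding join_section_def
  proof (intro conjI ballI allI impI vc)
    fix x i assume x: "x \<in> B" and i: "i < n" and pos: "0 < fst (v x i)"
    have "snd (v x i) 0 = f x \<and> snd (v x i) 1 = g x"
    proof (cases "x \<in> A")
      case True
      then show ?thesis using ue[OF True i] pos vA by simp
    next
      case False
      then obtain j a d where j: "j \<in> J" "a \<in> carrier G" "d \<in> disc_interior m" "x = \<Phi> j (a <#\<^bsub>G\<^esub> H j, d)"
        using ex_cell x by blast
      have d: "d \<in> disc_set m" using j(3) intD by blast
      note vc1 = vcell[OF j(1,2) d i, folded j(4)]
      have pos': "0 < fst (w j d i)" using pos vc1(1) by simp
      have HL: "H j \<in> lcosets\<^bsub>G\<^esub> (H j)" by (rule subgroup_mem_lcosets[OF grp sub[OF j(1)]])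
      have "(H j, d) \<in> topspace (prod_topology (coset_space G T (H j)) (disc m))" unfolding ptop using HL d by blast
      then have xt: "\<Phi> j (H j, d) \<in> topspace X"
        using continuous_map_image_subset_topspace[OF \<Phi>c[OF j(1)]] by auto
      have e: "x = \<phi> a (\<Phi> j (H j, d))" unfolding j(4) by (rule \<Phi>e[OF j(1,2) HL d])
      show ?thesis
        using vc1(2)[OF pos', of 0] vc1(2)[OF pos', of 1] we[OF j(1) d i pos'] fe[OF f j(2) xt] fe[OF g j(2) xt] e by simp
    qed
    then show "snd (v x i) 0 = f x" "snd (v x i) 1 = g x" by blast+
  next
    fix b x i assume b: "b \<in> carrier G" and x: "x \<in> B" and i: "i < n"
    have "fst (v (\<phi> b x) i) = fst (v x i) \<and>
      (\<forall>t. 0 < fst (v x i) \<longrightarrow> t \<in> {0..1} \<longrightarrow> snd (v (\<phi> b x) i) t = \<psi> b (snd (v x i) t))"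
    proof (cases "x \<in> A")
      case True
      then have "\<phi> b x \<in> A" using inv b by (simp add: invariant_set_def)
      then show ?thesis using ua[OF b True i] vA True by simp
    next
      case False
      then obtain j a d where j: "j \<in> J" "a \<in> carrier G" "d \<in> disc_interior m" "x = \<Phi> j (a <#\<^bsub>G\<^esub> H j, d)"
        using ex_cell x by blast
      have d: "d \<in> disc_set m" using j(3) intD by blast
      have e: "\<phi> b x = \<Phi> j ((b \<otimes>\<^bsub>G\<^esub> a) <#\<^bsub>G\<^esub> H j, d)" unfolding j(4) by (rule trans[OF j(1,2) b d])
      note v1 = vcell[OF j(1,2) d i, folded j(4)] and v2 = vcell[OF j(1) m_closed[OF b j(2)] d i, folded e]
      have "\<psi> (b \<otimes>\<^bsub>G\<^esub> a) (snd (w j d i) t) = \<psi> b (\<psi> a (snd (w j d i) t))" if "0 < fst (w j d i)" "t \<in> {0..1}" for t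
        by (rule g_space_mult[OF Y b j(2) wv(1)[OF j(1) d i that]])
      then show ?thesis using v1 v2 by simp
    qed
    then show "fst (v (\<phi> b x) i) = fst (v x i)"
      "\<And>t. 0 < fst (v x i) \<Longrightarrow> t \<in> {0..1} \<Longrightarrow> snd (v (\<phi> b x) i) t = \<psi> b (snd (v x i) t)" by blast+
  qed
  with invB show ?thesis by blast
qed

text \<open>Induction over the skeleta, starting from the section over the empty set. The attached
  cells have dimension at most \<open>d\<close>, within the range in which the join of path fibres
  is connected enough.\<close>

lemma join_section_on_skeleton:
  assumes G: "topological_group G T" and X: "g_cw_complex G T \<phi> X sk"
    and Y: "g_space G T \<psi> Y" and conn: "s_g_connected s G T \<psi> Y"
    and f: "g_map G \<phi> X \<psi> Y f" and g: "g_map G \<phi> X \<psi> Y g"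
    and d: "d < n * Suc s"
  shows "\<exists>u. join_section G \<phi> X \<psi> Y f g n (sk d) u"
proof -
  have gX: "g_space G T \<phi> X" and sk0: "attach_g_cells G T \<phi> X 0 {} (sk 0)"
    and sk1: "\<And>k. attach_g_cells G T \<phi> X (Suc k) (sk k) (sk (Suc k))" and skU: "(\<Union>k. sk k) = topspace X"
    using X unfolding g_cw_complex_def by blast+
  have skX: "sk k \<subseteq> topspace X" for k using skU by blast
  have empty: "join_section G \<phi> X \<psi> Y f g n {} (\<lambda>_ _. (0, \<lambda>_. undefined))"
    by (simp add: join_section_def continuous_map_on_empty)
  have "invariant_set G \<phi> (sk k) \<and> (\<exists>u. join_section G \<phi> X \<psi> Y f g n (sk k) u)" if "k \<le> d" for k
    using that
  proof (induction k)
    case 0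
    show ?case
      by (rule extend_join_section[OF G gX Y conn _ f g sk0 skX _ empty]) (use d in \<open>auto simp: invariant_set_def\<close>)
  next
    case (Suc k)
    then obtain u where "invariant_set G \<phi> (sk k)" "join_section G \<phi> X \<psi> Y f g n (sk k) u" by auto
    then show ?case
      by (intro extend_join_section[OF G gX Y conn _ f g sk1 skX]) (use d Suc.prems in auto)
  qed
  then show ?thesis by blast
qed

section \<open>The bound on the equivariant distance\<close>

text \<open>The weights are continuous and constant on orbits, so their positivity sets are open and
  invariant, and some weight is positive at every point. Over the \<open>i\<close>-th set the
  \<open>i\<close>-th fibre coordinate is the homotopy. \<open>Suc n\<close> factors correspond to
  sets numbered from 0 to \<open>n\<close>.\<close>

lemma g_homotopic_cover_if_join_section:
  assumes X: "g_space G T \<phi> X" and u: "join_section G \<phi> X \<psi> Y f g (Suc n) (topspace X) u"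
  defines "U \<equiv> \<lambda>i. {x \<in> topspace X. 0 < fst (u x i)}"
  shows "(\<Union>i\<le>n. U i) = topspace X"
    and "i \<le> n \<Longrightarrow> openin X (U i) \<and> invariant_set G \<phi> (U i) \<and> g_homotopic G \<phi> (subtopology X (U i)) \<psi> Y f g"
proof -
  have uc: "continuous_map X (join_space (Suc n) (path_space Y)) u"
    using u by (simp add: join_section_def)
  note UU = uc[unfolded continuous_map_join_space]
  have ue: "\<And>x i. x \<in> topspace X \<Longrightarrow> i < Suc n \<Longrightarrow> 0 < fst (u x i) \<Longrightarrow> snd (u x i) 0 = f x \<and> snd (u x i) 1 = g x"
    and ua: "\<And>a x i. a \<in> carrier G \<Longrightarrow> x \<in> topspace X \<Longrightarrow> i < Suc n \<Longrightarrow> fst (u (\<phi> a x) i) = fst (u x i)"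
      "\<And>a x i t. a \<in> carrier G \<Longrightarrow> x \<in> topspace X \<Longrightarrow> i < Suc n \<Longrightarrow> 0 < fst (u x i) \<Longrightarrow> t \<in> {0..1} \<Longrightarrow>
      snd (u (\<phi> a x) i) t = \<psi> a (snd (u x i) t)"
    using u unfolding join_section_def by auto
  show "(\<Union>i\<le>n. U i) = topspace X"
  proof
    show "topspace X \<subseteq> (\<Union>i\<le>n. U i)"
    proof
      fix x assume x: "x \<in> topspace X"
      from conjunct1[OF UU, THEN bspec, OF x] obtain i where "i < Suc n" "0 < fst (u x i)" by blast
      then show "x \<in> (\<Union>i\<le>n. U i)" using x by (auto simp: U_def less_Suc_eq_le)
    qed
  qed (auto simp: U_def)
  assume "i \<le> n"
  then have i: "i < Suc n" by simp
  have inv: "invariant_set G \<phi> (U i)"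
    using g_space_mem[OF X] ua(1)[OF _ _ i] by (auto simp: invariant_set_def U_def)
  have op: "openin X (U i)"
    using UU i openin_continuous_map_preimage[of X euclideanreal "\<lambda>x. fst (u x i)" "{0<..}"] by (simp add: U_def)
  let ?S = "subtopology X (U i)"
  have top: "topspace ?S = U i" by (auto simp: U_def)
  have "subtopology X {x. 0 < fst (u x i)} = ?S"
    using subtopology_restrict[of X "{x. 0 < fst (u x i)}"] by (simp add: U_def Int_def)
  moreover have "continuous_map (subtopology X {x. 0 < fst (u x i)}) (path_space Y) (\<lambda>x. snd (u x i))"
    using UU i by simp
  ultimately have "continuous_map ?S (path_space Y) (\<lambda>x. snd (u x i))" by (simp only:)
  then have c: "continuous_map (prod_topology ?S (top_of_set {0..1})) Y (\<lambda>(x, t). snd (u x i) t)"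
    unfolding continuous_map_path_space .
  have "continuous_map (prod_topology (top_of_set {0..1::real}) ?S) (prod_topology ?S (top_of_set {0..1})) (\<lambda>q. (snd q, fst q))"
    unfolding continuous_map_paired by (intro conjI continuous_map_snd continuous_map_fst)
  from continuous_map_compose[OF this c]
  have h: "continuous_map (prod_topology (top_of_set {0..1::real}) ?S) Y (\<lambda>q. snd (u (snd q) i) (fst q))"
    by (simp add: comp_def)
  have "homotopic_with (equivariant_on G \<phi> \<psi> (topspace ?S)) ?S Y f g"
  \<comment> \<open>The endpoint equations hold on \<open>U i\<close> only. This characterisation
    ignores values elsewhere, provided that equivariance does too, which it does because
    \<open>U i\<close> is invariant.\<close>
  proof (rule iffD2[OF homotopic_with])
    show "equivariant_on G \<phi> \<psi> (topspace ?S) h \<longleftrightarrow> equivariant_on G \<phi> \<psi> (topspace ?S) k"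
      if "\<And>x. x \<in> topspace ?S \<Longrightarrow> h x = k x" for h k
      using that inv unfolding equivariant_on_def top invariant_set_def by auto
    show "\<exists>h. continuous_map (prod_topology (top_of_set {0..1::real}) ?S) Y h \<and>
      (\<forall>x\<in>topspace ?S. h (0, x) = f x) \<and> (\<forall>x\<in>topspace ?S. h (1, x) = g x) \<and>
      (\<forall>t\<in>{0..1}. equivariant_on G \<phi> \<psi> (topspace ?S) (\<lambda>x. h (t, x)))"
    proof (intro exI[of _ "\<lambda>q. snd (u (snd q) i) (fst q)"] conjI ballI h)
      fix x assume "x \<in> topspace ?S"
      then have x: "x \<in> topspace X" "0 < fst (u x i)" by (auto simp: U_def)
      show "snd (u (snd (0, x)) i) (fst (0, x)) = f x" "snd (u (snd (1, x)) i) (fst (1, x)) = g x"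
        using ue[OF x(1) i x(2)] by simp_all
    next
      fix t :: real assume t: "t \<in> {0..1}"
      show "equivariant_on G \<phi> \<psi> (topspace ?S) (\<lambda>x. snd (u (snd (t, x)) i) (fst (t, x)))"
        unfolding equivariant_on_def top using ua(2)[OF _ _ i _ t] by (simp add: U_def)
    qed
  qed
  with op inv show "openin X (U i) \<and> invariant_set G \<phi> (U i) \<and> g_homotopic G \<phi> ?S \<psi> Y f g"
    unfolding g_homotopic_def by blast
qed

text \<open>On the preimage \<open>V\<close> the homotopies form the chain \<open>f \<simeq> f
  \<circ> b \<circ> a \<simeq> g \<circ> b \<circ> a \<simeq> g\<close>: the outer ones come from
  \<open>b \<circ> a \<simeq> id\<close>, the middle one from the homotopy over \<open>U\<close>
  precomposed with \<open>a\<close>.\<close>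

lemma g_homotopic_cover_pullback:
  assumes X: "g_space G T \<phi> X"
    and a: "g_map G \<phi> X \<phi>' X' a" and b: "g_map G \<phi>' X' \<phi> X b" and ba: "g_homotopic G \<phi> X \<phi> X (b \<circ> a) id"
    and f: "g_map G \<phi> X \<psi> Y f" and g: "g_map G \<phi> X \<psi> Y g"
    and U: "openin X' U" "invariant_set G \<phi>' U" "g_homotopic G \<phi>' (subtopology X' U) \<psi> Y (f \<circ> b) (g \<circ> b)"
  defines "V \<equiv> {x \<in> topspace X. a x \<in> U}"
  shows "openin X V \<and> invariant_set G \<phi> V \<and> g_homotopic G \<phi> (subtopology X V) \<psi> Y f g"
proof (intro conjI)
  have ac: "continuous_map X X' a" and ae: "\<And>c x. c \<in> carrier G \<Longrightarrow> x \<in> topspace X \<Longrightarrow> a (\<phi> c x) = \<phi>' c (a x)"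
    using a by (auto simp: g_map_def equivariant_on_def)
  show op: "openin X V" unfolding V_def by (rule openin_continuous_map_preimage[OF ac U(1)])
  show inv: "invariant_set G \<phi> V"
    using g_space_mem[OF X] ae U(2) by (auto simp: invariant_set_def V_def)
  let ?S = "subtopology X V" and ?S' = "subtopology X' U"
  have top: "topspace ?S = V" by (auto simp: V_def)
  have U': "topspace ?S' = U" using openin_subset[OF U(1)] by auto
  let ?E = "equivariant_on G \<phi> \<psi> V"
  have step: "homotopic_with ?E ?S Y (k \<circ> (b \<circ> a)) k" if k: "g_map G \<phi> X \<psi> Y k" for k
  proof -
    have kc: "continuous_map X Y k" and ke: "\<And>c x. c \<in> carrier G \<Longrightarrow> x \<in> topspace X \<Longrightarrow> k (\<phi> c x) = \<psi> c (k x)"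
      using k by (auto simp: g_map_def equivariant_on_def)
    \<comment> \<open>Continuity of the stages is added to the predicate so that they map
      \<open>topspace X\<close> to itself, where \<open>k\<close> is equivariant.\<close>
    have "homotopic_with (\<lambda>h. continuous_map X X h \<and> equivariant_on G \<phi> \<phi> (topspace X) h) X X (b \<circ> a) id"
      using ba unfolding g_homotopic_def by (rule homotopic_with_mono) simp
    then have "homotopic_with ?E X Y (k \<circ> (b \<circ> a)) (k \<circ> id)"
    proof (rule homotopic_with_compose_continuous_map_left[OF _ kc])
      fix h assume h: "continuous_map X X h \<and> equivariant_on G \<phi> \<phi> (topspace X) h"
      then have "h x \<in> topspace X" if "x \<in> topspace X" for x
        using that by (auto simp: continuous_map_def)
      then show "?E (k \<circ> h)" using h ke by (auto simp: equivariant_on_def V_def)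
    qed
    then show ?thesis using homotopic_from_subtopology by (simp only: comp_id) blast
  qed
  have amap: "continuous_map ?S ?S' a"
    using continuous_map_from_subtopology[OF ac] by (auto simp: continuous_map_in_subtopology V_def)
  have "homotopic_with ?E ?S Y ((f \<circ> b) \<circ> a) ((g \<circ> b) \<circ> a)"
  proof (rule homotopic_with_compose_continuous_map_right[OF U(3)[unfolded g_homotopic_def U'] amap])
    fix h assume "equivariant_on G \<phi>' \<psi> U h"
    then show "?E (h \<circ> a)" using ae by (auto simp: equivariant_on_def V_def)
  qed
  then have mid: "homotopic_with ?E ?S Y (f \<circ> (b \<circ> a)) (g \<circ> (b \<circ> a))" by (simp only: comp_assoc)
  have "homotopic_with ?E ?S Y f g"
    by (rule homotopic_with_trans[OF iffD1[OF homotopic_with_sym step[OF f]] homotopic_with_trans[OF mid step[OF g]]])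
  then show "g_homotopic G \<phi> ?S \<psi> Y f g" unfolding g_homotopic_def top .
qed

lemma Inf_enat_mem: "A \<noteq> {} \<Longrightarrow> Inf A \<in> (A :: enat set)"
  unfolding Inf_enat_def by (auto intro: LeastI)

lemma g_distance_le_div:
  assumes G: "topological_group G T" and X: "g_space G T \<phi> X"
    and X': "g_cw_complex G T \<phi>' X' sk'" "sk' d = topspace X'" and eqv: "g_homotopy_equivalent G \<phi> X \<phi>' X'"
    and Y: "g_space G T \<psi> Y" and f: "g_map G \<phi> X \<psi> Y f" and g: "g_map G \<phi> X \<psi> Y g"
    and conn: "s_g_connected s G T \<psi> Y"
  shows "g_distance G \<phi> X \<psi> Y f g \<le> enat (d div Suc s)"
proof -
  let ?n = "d div Suc s"
  obtain a b where a: "g_map G \<phi> X \<phi>' X' a" and b: "g_map G \<phi>' X' \<phi> X b"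
    and ba: "g_homotopic G \<phi> X \<phi> X (b \<circ> a) id"
    using eqv unfolding g_homotopy_equivalent_def by blast
  have gX': "g_space G T \<phi>' X'" using X'(1) by (simp add: g_cw_complex_def)
  have comp: "g_map G \<phi>' X' \<psi> Y (k \<circ> b)" if k: "g_map G \<phi> X \<psi> Y k" for k
    unfolding g_map_def
  proof
    have bc: "continuous_map X' X b" using b by (simp add: g_map_def)
    then show "continuous_map X' Y (k \<circ> b)" using k continuous_map_compose by (auto simp: g_map_def)
    have "b x \<in> topspace X" if "x \<in> topspace X'" for x using bc that by (auto simp: continuous_map_def)
    then show "equivariant_on G \<phi>' \<psi> (topspace X') (k \<circ> b)"
      using b k by (auto simp: g_map_def equivariant_on_def)
  qed
  \<comment> \<open>With one factor more than the bound \<open>d div Suc s\<close>, the join is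
    connected enough for cells of dimension up to \<open>d\<close>.\<close>
  have "d < Suc ?n * Suc s" using dividend_less_div_times[of "Suc s" d] by simp
  from join_section_on_skeleton[OF G X'(1) Y conn comp[OF f] comp[OF g] this]
  obtain u where u: "join_section G \<phi>' X' \<psi> Y (f \<circ> b) (g \<circ> b) (Suc ?n) (topspace X') u"
    unfolding X'(2) by blast
  define U where "U = (\<lambda>i. {x \<in> topspace X'. 0 < fst (u x i)})"
  define V where "V = (\<lambda>i. {x \<in> topspace X. a x \<in> U i})"
  have cov1: "(\<Union>i\<le>?n. U i) = topspace X'"
    unfolding U_def by (rule g_homotopic_cover_if_join_section(1)[OF gX' u])
  have cov2: "openin X' (U i) \<and> invariant_set G \<phi>' (U i) \<and>
      g_homotopic G \<phi>' (subtopology X' (U i)) \<psi> Y (f \<circ> b) (g \<circ> b)" if "i \<le> ?n" for i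
    unfolding U_def by (rule g_homotopic_cover_if_join_section(2)[OF gX' u that])
  have V: "openin X (V i) \<and> invariant_set G \<phi> (V i) \<and> g_homotopic G \<phi> (subtopology X (V i)) \<psi> Y f g" if "i \<le> ?n" for i
    unfolding V_def
    by (rule g_homotopic_cover_pullback[OF X a b ba f g conjunct1[OF cov2[OF that]]
        conjunct1[OF conjunct2[OF cov2[OF that]]] conjunct2[OF conjunct2[OF cov2[OF that]]]])
  have "a x \<in> (\<Union>i\<le>?n. U i)" if "x \<in> topspace X" for x
    unfolding cov1 using a that by (auto simp: g_map_def continuous_map_def)
  then have "(\<Union>i\<le>?n. V i) = topspace X" by (auto simp: V_def)
  with V show ?thesis
    unfolding g_distance_def by (intro Inf_lower CollectI exI[of _ ?n] conjI refl exI[of _ V]) auto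
qed

text \<open>Finiteness of \<open>hdim\<close> turns the infima in it and in \<open>gcw_dim\<close>
  into minima, so some equivalent complex equals its skeleton of dimension \<open>d\<close>. With
  \<open>hdim\<close> infinite the right-hand side would be infinite, and the strict inequality
  would assert that the distance is finite.\<close>

theorem proposition3p11:
  fixes G :: "('g, 'm) monoid_scheme" and T :: "'g topology"
    and \<phi> :: "'g \<Rightarrow> 'x \<Rightarrow> 'x" and X :: "'x topology" and sk :: "nat \<Rightarrow> 'x set"
    and \<psi> :: "'g \<Rightarrow> 'y \<Rightarrow> 'y" and Y :: "'y topology"
    and f g :: "'x \<Rightarrow> 'y" and s :: nat
  assumes "compact_lie_group G T"
    and "g_cw_complex G T \<phi> X sk" and "2 \<le> gcw_dim X sk"
    and "g_space G T \<psi> Y"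
    and "g_map G \<phi> X \<psi> Y f" and "g_map G \<phi> X \<psi> Y g"
    and "s_g_connected s G T \<psi> Y"
    and "hdim TYPE('z) G T \<phi> X \<noteq> \<infinity>"
  shows "ereal_of_enat (g_distance G \<phi> X \<psi> Y f g)
           < (ereal_of_enat (hdim TYPE('z) G T \<phi> X) + 1) / (ereal (real s) + 1)"
proof -
  have G: "topological_group G T"
    using assms(1) by (simp add: compact_lie_group_def lie_group_def)
  let ?A = "{gcw_dim X' sk' | (X' :: 'z topology) \<phi>' sk'.
       g_cw_complex G T \<phi>' X' sk' \<and> g_homotopy_equivalent G \<phi> X \<phi>' X'}"
  obtain d where d: "hdim TYPE('z) G T \<phi> X = enat d"
    using assms(8) by auto
  have "?A \<noteq> {}"
  proof
    assume "?A = {}"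
    then have "hdim TYPE('z) G T \<phi> X = \<infinity>" unfolding hdim_def Inf_enat_def by (rule if_P)
    then show False using d by simp
  qed
  then have "enat d \<in> ?A" using Inf_enat_mem[of ?A] d unfolding hdim_def by simp
  then obtain X' :: "'z topology" and \<phi>' sk' where X': "gcw_dim X' sk' = enat d"
    "g_cw_complex G T \<phi>' X' sk'" "g_homotopy_equivalent G \<phi> X \<phi>' X'"
    by auto
  have "{enat n |n. sk' n = topspace X'} \<noteq> {}"
  proof
    assume "{enat n |n. sk' n = topspace X'} = {}"
    then have "gcw_dim X' sk' = \<infinity>" unfolding gcw_dim_def Inf_enat_def by (rule if_P)
    then show False using X'(1) by simp
  qed
  from Inf_enat_mem[OF this] have "sk' d = topspace X'"
    using X'(1) unfolding gcw_dim_def by simp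
  from g_distance_le_div[OF G _ X'(2) this X'(3) assms(4-7)] assms(2)
  have "g_distance G \<phi> X \<psi> Y f g \<le> enat (d div Suc s)" by (simp add: g_cw_complex_def)
  then have "ereal_of_enat (g_distance G \<phi> X \<psi> Y f g) \<le> ereal (real (d div Suc s))"
    unfolding ereal_of_enat_simps(1)[symmetric] ereal_of_enat_le_iff .
  \<comment> \<open>Rounding down gives at most \<open>d / (s + 1)\<close>; the extra 1 in the
    numerator makes the inequality strict.\<close>
  also have "real (d div Suc s) < (real d + 1) / (real s + 1)"
  proof -
    have "real (d div Suc s * Suc s) \<le> real d"
      unfolding of_nat_le_iff by (rule div_times_less_eq_dividend)
    then have "real (d div Suc s) * (real s + 1) \<le> real d"
      by (simp only: of_nat_mult of_nat_Suc add.commute)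
    then show ?thesis by (simp add: pos_less_divide_eq)
  qed
  then have "ereal (real (d div Suc s)) < (ereal (real d) + 1) / (ereal (real s) + 1)"
    by (simp add: one_ereal_def)
  finally show ?thesis unfolding d by simp
qed

end
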